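(* Let $n\ge 2$. For every $1<q<\infty$, $n/q<s<\infty$ and $1\le p<\infty$ there is a constant $C_{n,p,q,s}$, depending only on $n,p,q,s$, such that $$\|f\|_{L^\infty(\mathbb{R}^n)}\le C_{n,p,q,s}\left(1+\left(\|f\|_{L^p(\mathbb{R}^n)}+\|f\|_{Q_\alpha(\mathbb{R}^n)}\right)\log\left(e+\|(-\triangle)^{s/2}f\|_{L^q(\mathbb{R}^n)}\right)\right)$$ holds for all $-\infty<\alpha<1$ and all $f\in L^p(\mathbb{R}^n)\cap Q_\alpha(\mathbb{R}^n)$ satisfying $(-\triangle)^{s/2}f\in L^q(\mathbb{R}^n)$.
   Context: For $\alpha\in(-\infty,1)$, $Q_\alpha(\mathbb{R}^n)$ is the set of all measurable complex-valued functions $f$ on $\mathbb{R}^n$ with $$\|f\|_{Q_\alpha(\mathbb{R}^n)}=\sup_I\left((l(I))^{2\alpha-n}\int_I\int_I\frac{|f(x)-f(y)|^2}{|x-y|^{n+2\alpha}}\,dx\,dy\right)^{1/2}<\infty,$$ where the supremum is over all cubes $I\subset\mathbb{R}^n$ with edges parallel to the coordinate axes and $l(I)$ is the edge length of $I$. The fractional Laplacian $(-\triangle)^{s/2}$ is the Fourier multiplier operator with $\mathcal{F}((-\triangle)^{s/2}f)(\xi)=|\xi|^s\mathcal{F}f(\xi)$, where $\mathcal{F}$ is the Fourier transform. *)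

theory Defs
  imports "HOL-Probability.Essential_Supremum"
begin

section \<open>Norms with values in the extended nonnegative reals\<close>

text \<open>Power with an exponent \<open>r > 0\<close>, so that infinity is sent to infinity.\<close>

definition enn_powr :: "ennreal \<Rightarrow> real \<Rightarrow> ennreal" where
  "enn_powr t r = (if t = \<infinity> then \<infinity> else ennreal (enn2real t powr r))"

definition Lp_norm :: "real \<Rightarrow> (real^'n \<Rightarrow> complex) \<Rightarrow> ennreal" where
  "Lp_norm p f = enn_powr (\<integral>\<^sup>+x. ennreal (cmod (f x) powr p) \<partial>lebesgue) (1 / p)"

definition Lp_space :: "real \<Rightarrow> (real^'n \<Rightarrow> complex) set" where
  "Lp_space p = {f \<in> borel_measurable lebesgue. Lp_norm p f < \<infinity>}"

definition Linf_norm :: "(real^'n \<Rightarrow> complex) \<Rightarrow> ennreal" where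
  "Linf_norm f = esssup lebesgue (\<lambda>x. ennreal (cmod (f x)))"

definition cube :: "real^'n \<Rightarrow> real \<Rightarrow> (real^'n) set" where
  "cube a l = {x. \<forall>i. a $ i \<le> x $ i \<and> x $ i \<le> a $ i + l}"

text \<open>On the diagonal \<open>x = y\<close>, a null set, the integrand is \<open>0 / 0 = 0\<close>.\<close>

definition Q_norm :: "real \<Rightarrow> (real^'n \<Rightarrow> complex) \<Rightarrow> ennreal" where
  "Q_norm \<alpha> f =
    (SUP (a, l) \<in> UNIV \<times> {0<..}.
      enn_powr
        (ennreal (l powr (2 * \<alpha> - real CARD('n))) *
          (\<integral>\<^sup>+x\<in>cube a l. (\<integral>\<^sup>+y\<in>cube a l.
             ennreal ((cmod (f x - f y))\<^sup>2 / norm (x - y) powr (real CARD('n) + 2 * \<alpha>))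
           \<partial>lebesgue) \<partial>lebesgue))
        (1 / 2))"

definition Q_space :: "real \<Rightarrow> (real^'n \<Rightarrow> complex) set" where
  "Q_space \<alpha> = {f \<in> borel_measurable lebesgue. Q_norm \<alpha> f < \<infinity>}"


section \<open>The fractional Laplacian\<close>

definition partial_deriv :: "'n \<Rightarrow> (real^'n \<Rightarrow> complex) \<Rightarrow> real^'n \<Rightarrow> complex" where
  "partial_deriv i \<psi> x = frechet_derivative \<psi> (at x) (axis i 1)"

text \<open>Schwartz functions; the list \<open>is\<close> plays the role of a multi-index. Differentiability of
  all iterated partial derivatives is smoothness.\<close>

definition schwartz :: "(real^'n \<Rightarrow> complex) \<Rightarrow> bool" where
  "schwartz \<psi> \<longleftrightarrow>
    (\<forall>is. (\<forall>x. foldr partial_deriv is \<psi> differentiable (at x)) \<and>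
          (\<forall>k::nat. bounded (range (\<lambda>x. (1 + norm x) ^ k *\<^sub>R foldr partial_deriv is \<psi> x))))"

text \<open>With this normalisation \<open>|\<xi>|\<^sup>2\<close> is the symbol of minus the Laplacian.\<close>

definition fourier :: "(real^'n \<Rightarrow> complex) \<Rightarrow> real^'n \<Rightarrow> complex" where
  "fourier \<psi> \<xi> = (\<integral>x. cis (- (x \<bullet> \<xi>)) * \<psi> x \<partial>lebesgue)"

text \<open>A function in \<open>L\<^sup>p\<close> with \<open>p > 2\<close> need not have a pointwise Fourier transform; its Fourier
  transform is the tempered distribution \<open>\<psi> \<mapsto> \<integral> f (F \<psi>)\<close>.\<close>

definition fourier_distr :: "(real^'n \<Rightarrow> complex) \<Rightarrow> (real^'n \<Rightarrow> complex) \<Rightarrow> complex" where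
  "fourier_distr f \<psi> = (\<integral>x. f x * fourier \<psi> x \<partial>lebesgue)"

text \<open>\<open>is_frac_laplacian s f g\<close> says that \<open>g\<close> is \<open>(-\<Delta>)\<^sup>s\<^sup>/\<^sup>2 f\<close>, i.e. that \<open>F g = |\<xi>|\<^sup>s F f\<close> as
  tempered distributions. It is meant for \<open>s > 0\<close> and \<open>f\<close>, \<open>g\<close> in Lebesgue spaces: for Schwartz
  \<open>\<psi>\<close> the Fourier transform of \<open>|\<xi>|\<^sup>s \<psi>\<close> is continuous and \<open>O(|x|\<^sup>-\<^sup>n\<^sup>-\<^sup>s)\<close>, hence lies in every
  \<open>L\<^sup>r\<close>, and both pairings below are absolutely convergent.\<close>

definition is_frac_laplacian ::
    "real \<Rightarrow> (real^'n \<Rightarrow> complex) \<Rightarrow> (real^'n \<Rightarrow> complex) \<Rightarrow> bool" where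
  "is_frac_laplacian s f g \<longleftrightarrow>
    (\<forall>\<psi>. schwartz \<psi> \<longrightarrow>
      fourier_distr g \<psi> = fourier_distr f (\<lambda>\<xi>. of_real (norm \<xi> powr s) * \<psi> \<xi>))"

end

theory Submission
  imports Defs "HOL-Probability.Characteristic_Functions"
begin

text \<open>
  Let \<open>m\<close> be a radial Schwartz function with \<open>m(0) = 1\<close> whose derivatives of positive order vanish at the
  origin, and let \<open>A\<^sub>k\<close> be the average of \<open>f\<close> at scale \<open>2\<^sup>-\<^sup>k\<close> against the Fourier transform of \<open>m\<close>. Then
  \<open>A\<^sub>0\<close> is bounded by the \<open>L\<^sup>p\<close> norm of \<open>f\<close>, while \<open>A\<^sub>k\<^sub>+\<^sub>1 - A\<^sub>k\<close> is an average of \<open>f\<close> against the Fourier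
  transform of \<open>d(\<xi>) = m(\<xi>/2) - m(\<xi>)\<close>. Since that kernel has mean zero, the difference is bounded by the
  \<open>Q\<^sub>\<alpha>\<close> norm of \<open>f\<close>; since \<open>|\<xi>|\<^sup>-\<^sup>s d(\<xi>)\<close> is again Schwartz, it is also an average of \<open>(-\<Delta>)\<^sup>s\<^sup>/\<^sup>2 f\<close>, hence
  bounded by \<open>2\<^sup>-\<^sup>k\<^sup>(\<^sup>s\<^sup>-\<^sup>n\<^sup>/\<^sup>q\<^sup>)\<close> times its \<open>L\<^sup>q\<close> norm. The first bound is used for the logarithmically many
  \<open>k\<close> at which the second is not small. Finally \<open>A\<^sub>k\<close> converges weakly to \<open>(2\<pi>)\<^sup>n f\<close>.
\<close>

section \<open>Schwartz functions\<close>

text \<open>The factor |xi|^-s is singular at 0, so the cutoff has to be flat there, while at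
  infinity rapid decrease suffices. This leads to a logistic function of r u - 1/(r u) with u =
  |xi|^2, whose derivatives stay within an explicit algebra. The constant must be uniform in
  \<alpha> < 1, even as \<alpha> tends to minus infinity. The oscillation is therefore measured
  between two small cubes lying far apart inside a larger one, and only then carried over to a
  single cube by the triangle inequality. Fourier inversion enters only through its value at 0: it
  gives the low-pass kernel mean (2 pi)^n and the band-pass kernel mean 0. Since f is merely in L^p,
  the weak limit is read off by testing the averages against continuous functions of compact
  support, then against indicators of compact sets. Testing four directions of the complex plane
  bounds |f| at the cost of a factor 2. Weighted inequalities with a free parameter stand in for
  those of Hoelder and Cauchy-Schwarz; the parameter is a bound on a norm and must be positive. The
  last step hence enlarges the norms slightly, and the additive 1 in the claim absorbs this.\<close>

definition rapidly_decreasing :: "(real^'n \<Rightarrow> complex) \<Rightarrow> bool" where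
  "rapidly_decreasing h \<longleftrightarrow> (\<forall>k::nat. \<exists>B. \<forall>x. (1 + norm x) ^ k * cmod (h x) \<le> B)"

lemma rapidly_decreasing_iff_bounded:
  "rapidly_decreasing h \<longleftrightarrow> (\<forall>k::nat. bounded (range (\<lambda>x. (1 + norm x) ^ k *\<^sub>R h x)))"
  unfolding rapidly_decreasing_def bounded_iff by (auto simp: abs_of_nonneg)

lemma rapidly_decreasing_add:
  assumes "rapidly_decreasing h" "rapidly_decreasing k"
  shows "rapidly_decreasing (\<lambda>x. h x + k x)"
  unfolding rapidly_decreasing_def
proof
  fix j :: nat
  obtain B C where "\<And>x. (1 + norm x) ^ j * cmod (h x) \<le> B" "\<And>x. (1 + norm x) ^ j * cmod (k x) \<le> C"
    using assms unfolding rapidly_decreasing_def by metis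
  moreover have "(1 + norm x) ^ j * cmod (h x + k x)
      \<le> (1 + norm x) ^ j * cmod (h x) + (1 + norm x) ^ j * cmod (k x)" for x
    unfolding distrib_left[symmetric] by (intro mult_left_mono norm_triangle_ineq) auto
  ultimately show "\<exists>B. \<forall>x. (1 + norm x) ^ j * cmod (h x + k x) \<le> B"
    by (meson add_mono order_trans)
qed

lemma rapidly_decreasing_mult:
  assumes h: "rapidly_decreasing h" and c: "\<And>x. cmod (c x) \<le> A * (1 + norm x) ^ j"
  shows "rapidly_decreasing (\<lambda>x. c x * h x)"
  unfolding rapidly_decreasing_def
proof
  fix k :: nat
  obtain B where B: "\<And>x. (1 + norm x) ^ (k + j) * cmod (h x) \<le> B"
    using h unfolding rapidly_decreasing_def by metis
  have "0 \<le> cmod (c 0)" by simp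
  also have "\<dots> \<le> A" using c[of 0] by simp
  finally have A: "0 \<le> A" .
  have "(1 + norm x) ^ k * cmod (c x * h x) \<le> A * B" for x
  proof -
    have "(1 + norm x) ^ k * cmod (c x * h x) \<le> (1 + norm x) ^ k * (A * (1 + norm x) ^ j * cmod (h x))"
      by (auto simp: norm_mult intro!: mult_left_mono mult_right_mono c)
    also have "\<dots> = A * ((1 + norm x) ^ (k + j) * cmod (h x))" by (simp add: power_add)
    also have "\<dots> \<le> A * B" using B A by (intro mult_left_mono)
    finally show ?thesis .
  qed
  then show "\<exists>B. \<forall>x. (1 + norm x) ^ k * cmod (c x * h x) \<le> B" by blast
qed

lemma schwartzD:
  assumes "schwartz h"
  shows "h differentiable (at x)" "rapidly_decreasing h"
  using assms[unfolded schwartz_def, rule_format, of "[]"] by (auto simp: rapidly_decreasing_iff_bounded)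

lemma schwartz_partial_deriv:
  assumes "schwartz h" shows "schwartz (partial_deriv i h)"
  unfolding schwartz_def
proof
  fix js
  have "foldr partial_deriv js (partial_deriv i h) = foldr partial_deriv (js @ [i]) h" by simp
  then show "(\<forall>x. foldr partial_deriv js (partial_deriv i h) differentiable at x) \<and>
      (\<forall>k. bounded (range (\<lambda>x. (1 + norm x) ^ k *\<^sub>R foldr partial_deriv js (partial_deriv i h) x)))"
    using assms unfolding schwartz_def by (simp only:) blast
qed

text \<open>Being Schwartz is the largest property which implies differentiability and rapid decrease
  and is inherited by partial derivatives.\<close>

lemma schwartz_coinduct:
  assumes "h \<in> S"
    and diff: "\<And>h x. h \<in> S \<Longrightarrow> h differentiable (at x)"
    and rap: "\<And>h. h \<in> S \<Longrightarrow> rapidly_decreasing h"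
    and part: "\<And>h i. h \<in> S \<Longrightarrow> partial_deriv i h \<in> S"
  shows "schwartz h"
proof -
  have "foldr partial_deriv js h \<in> S" for js
    by (induction js) (auto intro: part \<open>h \<in> S\<close>)
  then show ?thesis
    using diff rap unfolding schwartz_def rapidly_decreasing_iff_bounded by simp
qed

lemma partial_deriv_eqI:
  assumes "(h has_derivative h') (at x)"
  shows "partial_deriv i h x = h' (axis i 1)"
  unfolding partial_deriv_def using frechet_derivative_at[OF assms] by simp

lemma differentiable_has_derivative:
  assumes "h differentiable (at x)"
  shows "(h has_derivative frechet_derivative h (at x)) (at x)"
  using assms by (simp add: frechet_derivative_works)

lemma schwartz_has_derivative:
  "schwartz h \<Longrightarrow> (h has_derivative frechet_derivative h (at x)) (at x)"
  using schwartzD(1) frechet_derivative_works by blast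

lemma schwartz_add:
  assumes "schwartz h" "schwartz k"
  shows "schwartz (\<lambda>x. h x + k x)"
proof -
  let ?S = "{\<lambda>x. h x + k x | h k. schwartz h \<and> schwartz k}"
  have "(\<lambda>x. h x + k x) \<in> ?S" using assms by blast
  then show ?thesis
  proof (rule schwartz_coinduct, goal_cases differentiable rapid partial)
    case (differentiable h x)
    then show ?case by (auto intro: differentiable_add schwartzD(1))
  next
    case (rapid h)
    then show ?case by (auto intro: rapidly_decreasing_add schwartzD(2))
  next
    case (partial f i)
    then obtain h k where f: "f = (\<lambda>x. h x + k x)" and hk: "schwartz h" "schwartz k" by auto
    have "partial_deriv i f = (\<lambda>x. partial_deriv i h x + partial_deriv i k x)"
      unfolding f
      by (rule ext, subst partial_deriv_eqI[OF has_derivative_add[OF hk[THEN schwartz_has_derivative]]])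
        (simp add: partial_deriv_def)
    then show ?case using hk schwartz_partial_deriv by blast
  qed
qed

lemma schwartz_cmult:
  assumes "schwartz h"
  shows "schwartz (\<lambda>x. c * h x)"
proof -
  let ?S = "{\<lambda>x. c * h x | h. schwartz h}"
  have "(\<lambda>x. c * h x) \<in> ?S" using assms by blast
  then show ?thesis
  proof (rule schwartz_coinduct, goal_cases differentiable rapid partial)
    case (differentiable h x)
    then show ?case by (auto intro: differentiable_mult schwartzD(1))
  next
    case (rapid h)
    then show ?case by (auto intro!: rapidly_decreasing_mult[where A = "cmod c" and j = 0] dest: schwartzD(2))
  next
    case (partial f i)
    then obtain h where f: "f = (\<lambda>x. c * h x)" and h: "schwartz h" by auto
    have "partial_deriv i f = (\<lambda>x. c * partial_deriv i h x)"
      unfolding f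
      by (rule ext, subst partial_deriv_eqI[OF has_derivative_mult_right[OF h[THEN schwartz_has_derivative]]])
        (simp add: partial_deriv_def)
    then show ?case using h schwartz_partial_deriv by blast
  qed
qed

section \<open>Modulations and dilations of Schwartz functions\<close>

lemma has_derivative_cis_inner:
  fixes x y :: "'a::real_inner"
  shows "((\<lambda>x. cis (y \<bullet> x)) has_derivative (\<lambda>v. (y \<bullet> v) *\<^sub>R (\<i> * cis (y \<bullet> x)))) (at x)"
proof -
  have "((\<lambda>x. y \<bullet> x) has_derivative (\<lambda>v. y \<bullet> v)) (at x)"
    by (intro has_derivative_inner_right has_derivative_ident)
  then have "((\<lambda>x. \<i> * complex_of_real (y \<bullet> x)) has_derivative (\<lambda>v. \<i> * of_real (y \<bullet> v))) (at x)"
    by (intro has_derivative_mult_right has_derivative_of_real)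
  from has_derivative_compose[OF this DERIV_exp[unfolded has_field_derivative_def]]
  show ?thesis by (simp add: cis_conv_exp scaleR_conv_of_real mult_ac)
qed

text \<open>With \<open>y\<close> fixed, the family of all such products is closed under partial
  derivatives: the derivative is the same exponential times the Schwartz function i y_i h + d_i h.
  No Leibniz formula for iterated derivatives is needed. The modulation later moves the centre of an
  average to \<open>y\<close>.\<close>

lemma schwartz_cis:
  assumes "schwartz h"
  shows "schwartz (\<lambda>x. cis (y \<bullet> x) * h x)"
proof -
  let ?S = "{\<lambda>x. cis (y \<bullet> x) * h x | h. schwartz h}"
  have "(\<lambda>x. cis (y \<bullet> x) * h x) \<in> ?S" using assms by blast
  then show ?thesis
  proof (rule schwartz_coinduct, goal_cases differentiable rapid partial)
    case (differentiable h x)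
    then show ?case
      by (auto intro: differentiable_mult schwartzD(1) differentiableI[OF has_derivative_cis_inner])
  next
    case (rapid h)
    then show ?case by (auto intro!: rapidly_decreasing_mult[where A = 1 and j = 0] dest: schwartzD(2))
  next
    case (partial f i)
    then obtain h where f: "f = (\<lambda>x. cis (y \<bullet> x) * h x)" and h: "schwartz h" by auto
    have "partial_deriv i f = (\<lambda>x. cis (y \<bullet> x) * (\<i> * (y $ i) * h x + partial_deriv i h x))"
      unfolding f
      by (rule ext, subst partial_deriv_eqI[OF has_derivative_mult[OF has_derivative_cis_inner h[THEN schwartz_has_derivative]]])
        (simp add: partial_deriv_def inner_axis scaleR_conv_of_real algebra_simps)
    moreover have "schwartz (\<lambda>x. \<i> * (y $ i) * h x + partial_deriv i h x)"
      by (intro schwartz_add schwartz_cmult schwartz_partial_deriv h)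
    ultimately show ?case
      by (auto intro!: exI[of _ "\<lambda>x. \<i> * (y $ i) * h x + partial_deriv i h x"])
  qed
qed

lemma schwartz_dilation:
  fixes h :: "real^'n \<Rightarrow> complex"
  assumes "schwartz h" "t \<noteq> 0"
  shows "schwartz (\<lambda>x. h (t *\<^sub>R x))"
proof -
  let ?S = "{\<lambda>x. h (t *\<^sub>R x) | h :: real^'n \<Rightarrow> complex. schwartz h}"
  have "(\<lambda>x. h (t *\<^sub>R x)) \<in> ?S" using assms by blast
  then show ?thesis
  proof (rule schwartz_coinduct, goal_cases differentiable rapid partial)
    case (differentiable f x)
    then obtain h where f: "f = (\<lambda>x. h (t *\<^sub>R x))" and h: "schwartz h" by auto
    show ?case unfolding f
      by (rule differentiable_compose[where f = h]) (auto intro!: schwartzD h derivative_intros)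
  next
    case (rapid f)
    then obtain h where f: "f = (\<lambda>x. h (t *\<^sub>R x))" and h: "schwartz h" by auto
    show ?case
      unfolding rapidly_decreasing_def
    proof
      fix k :: nat
      obtain B where B: "\<And>x. (1 + norm x) ^ k * cmod (h x) \<le> B"
        using schwartzD(2)[OF h] unfolding rapidly_decreasing_def by metis
      define A where "A = max 1 (1 / \<bar>t\<bar>)"
      have A: "1 + norm x \<le> A * (1 + norm (t *\<^sub>R x))" for x :: "real^'n"
      proof -
        have "1 / \<bar>t\<bar> * (\<bar>t\<bar> * norm x) \<le> A * (\<bar>t\<bar> * norm x)"
          by (intro mult_right_mono) (auto simp: A_def)
        then show ?thesis using \<open>t \<noteq> 0\<close> by (simp add: algebra_simps) (simp add: A_def)
      qed
      have "(1 + norm x) ^ k * cmod (f x) \<le> A ^ k * B" for x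
      proof -
        have "(1 + norm x) ^ k * cmod (f x) \<le> (A * (1 + norm (t *\<^sub>R x))) ^ k * cmod (f x)"
          using A[of x] by (intro mult_right_mono power_mono) auto
        also have "\<dots> = A ^ k * ((1 + norm (t *\<^sub>R x)) ^ k * cmod (h (t *\<^sub>R x)))"
          by (simp add: f power_mult_distrib)
        also have "\<dots> \<le> A ^ k * B" by (intro mult_left_mono B) (auto simp: A_def)
        finally show ?thesis .
      qed
      then show "\<exists>B. \<forall>x. (1 + norm x) ^ k * cmod (f x) \<le> B" by blast
    qed
  next
    case (partial f i)
    then obtain h where f: "f = (\<lambda>x. h (t *\<^sub>R x))" and h: "schwartz h" by auto
    have "partial_deriv i f x = t * partial_deriv i h (t *\<^sub>R x)" for x
    proof -
      have lin: "((\<lambda>x. t *\<^sub>R x) has_derivative (\<lambda>x. t *\<^sub>R x)) (at x)"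
        by (auto intro!: derivative_eq_intros)
      have "linear (frechet_derivative h (at (t *\<^sub>R x)))"
        using schwartz_has_derivative[OF h] has_derivative_linear by blast
      from linear_cmul[OF this, of t "axis i 1"] show ?thesis
        unfolding f
        using partial_deriv_eqI[OF has_derivative_compose[OF lin schwartz_has_derivative[OF h]], of i]
        by (simp only: partial_deriv_def scaleR_conv_of_real)
    qed
    then have "partial_deriv i f = (\<lambda>x. (\<lambda>z. t * partial_deriv i h z) (t *\<^sub>R x))" by auto
    moreover have "schwartz (\<lambda>z. t * partial_deriv i h z)"
      by (intro schwartz_cmult schwartz_partial_deriv h)
    ultimately show ?case by (auto intro!: exI[of _ "\<lambda>z. t * partial_deriv i h z"])
  qed
qed

text \<open>Polynomials times radial profiles. The profile is taken in |x|^2 and not in |x|, which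
  is not differentiable at the origin; a partial derivative of h(|x|^2) is 2 x_i h'(|x|^2), so the
  span is closed under differentiation as soon as \<open>H\<close> is.\<close>

inductive_set radial_span :: "(real \<Rightarrow> real) set \<Rightarrow> (real^'n \<Rightarrow> complex) set" for H where
  base: "h \<in> H \<Longrightarrow> (\<lambda>x. of_real (h ((norm x)\<^sup>2))) \<in> radial_span H"
| coord: "\<phi> \<in> radial_span H \<Longrightarrow> (\<lambda>x. of_real (x $ i) * \<phi> x) \<in> radial_span H"
| add: "\<phi> \<in> radial_span H \<Longrightarrow> \<psi> \<in> radial_span H \<Longrightarrow> (\<lambda>x. \<phi> x + \<psi> x) \<in> radial_span H"
| scale: "\<phi> \<in> radial_span H \<Longrightarrow> (\<lambda>x. c * \<phi> x) \<in> radial_span H"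

text \<open>Reduces the Schwartz property to one variable. Decay is asked only for u >= 0, the range
  of |x|^2, but derivatives on the whole line, so that the chain rule applies at x = 0 as
  well.\<close>

lemma schwartz_radial:
  assumes H: "h \<in> H"
    and deriv: "\<And>h. h \<in> H \<Longrightarrow> \<exists>h'\<in>H. \<forall>u. (h has_real_derivative h' u) (at u)"
    and bound: "\<And>h k. h \<in> H \<Longrightarrow> \<exists>B. \<forall>u\<ge>0. (1 + u) ^ k * \<bar>h u\<bar> \<le> B"
  shows "schwartz (\<lambda>x::real^'n. complex_of_real (h ((norm x)\<^sup>2)))"
proof -
  have main: "(\<forall>x. \<phi> differentiable (at x)) \<and> rapidly_decreasing \<phi> \<and> (\<forall>i. partial_deriv i \<phi> \<in> radial_span H)"
    if "\<phi> \<in> radial_span H" for \<phi> :: "real^'n \<Rightarrow> complex"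
    using that
  proof induction
    case (base h)
    then obtain h' where h': "h' \<in> H" "\<And>u. (h has_real_derivative h' u) (at u)" using deriv by blast
    have der: "((\<lambda>x::real^'n. complex_of_real (h ((norm x)\<^sup>2))) has_derivative
        (\<lambda>v. of_real (h' ((norm x)\<^sup>2) * (2 * (x \<bullet> v))))) (at x)" for x
    proof -
      have "((\<lambda>x::real^'n. x \<bullet> x) has_derivative (\<lambda>v. 2 * (x \<bullet> v))) (at x)"
        using has_derivative_inner[OF has_derivative_ident[of "at x"] has_derivative_ident]
        by (simp add: inner_commute)
      moreover have "(h has_derivative (\<lambda>y. h' (x \<bullet> x) * y)) (at (x \<bullet> x))"
        using h'(2) by (simp add: has_field_derivative_def)
      ultimately have "((\<lambda>x::real^'n. h (x \<bullet> x)) has_derivative (\<lambda>v. h' (x \<bullet> x) * (2 * (x \<bullet> v)))) (at x)"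
        by (rule has_derivative_compose)
      from has_derivative_of_real[OF this] show ?thesis by (simp add: power2_norm_eq_inner)
    qed
    have "partial_deriv i (\<lambda>x. complex_of_real (h ((norm x)\<^sup>2))) \<in> radial_span H" for i :: 'n
    proof -
      have "partial_deriv i (\<lambda>x. complex_of_real (h ((norm x)\<^sup>2)))
          = (\<lambda>x. 2 * (of_real (x $ i) * of_real (h' ((norm x)\<^sup>2))))"
        by (rule ext) (simp add: partial_deriv_eqI[OF der] inner_axis)
      also have "\<dots> \<in> radial_span H"
        by (rule radial_span.scale[OF radial_span.coord[OF radial_span.base[OF h'(1)]]])
      finally show ?thesis .
    qed
    moreover have "rapidly_decreasing (\<lambda>x::real^'n. complex_of_real (h ((norm x)\<^sup>2)))"
      unfolding rapidly_decreasing_def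
    proof
      fix k
      obtain B where B: "\<And>u. 0 \<le> u \<Longrightarrow> (1 + u) ^ k * \<bar>h u\<bar> \<le> B" using bound[OF base] by blast
      have "(1 + norm x) ^ k * cmod (complex_of_real (h ((norm x)\<^sup>2))) \<le> 2 ^ k * B" for x :: "real^'n"
      proof -
        have "0 \<le> (norm x - 1)\<^sup>2 + 3 * (norm x)\<^sup>2 + 1" by simp
        then have "1 + norm x \<le> 2 * (1 + (norm x)\<^sup>2)" by (simp add: power2_eq_square algebra_simps)
        then have "(1 + norm x) ^ k \<le> (2 * (1 + (norm x)\<^sup>2)) ^ k" by (intro power_mono) auto
        then have "(1 + norm x) ^ k * \<bar>h ((norm x)\<^sup>2)\<bar> \<le> 2 ^ k * ((1 + (norm x)\<^sup>2) ^ k * \<bar>h ((norm x)\<^sup>2)\<bar>)"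
          by (metis abs_ge_zero mult.assoc mult_right_mono power_mult_distrib)
        also have "\<dots> \<le> 2 ^ k * B" by (intro mult_left_mono B) auto
        finally show ?thesis by simp
      qed
      then show "\<exists>B. \<forall>x::real^'n. (1 + norm x) ^ k * cmod (complex_of_real (h ((norm x)\<^sup>2))) \<le> B" by blast
    qed
    ultimately show ?case using der differentiableI by blast
  next
    case (coord \<phi> i)
    have der: "((\<lambda>x. of_real (x $ i) * \<phi> x) has_derivative
        (\<lambda>v. of_real (x $ i) * frechet_derivative \<phi> (at x) v + of_real (v $ i) * \<phi> x)) (at x)" for x
      using coord by (intro has_derivative_mult has_derivative_of_real
          bounded_linear_imp_has_derivative bounded_linear_vec_nth differentiable_has_derivative) auto
    have "partial_deriv j (\<lambda>x. of_real (x $ i) * \<phi> x) \<in> radial_span H" for j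
    proof -
      have "partial_deriv j (\<lambda>x. of_real (x $ i) * \<phi> x) =
          (\<lambda>x. of_real (x $ i) * partial_deriv j \<phi> x + (of_bool (i = j)) * \<phi> x)"
        by (rule ext) (auto simp add: partial_deriv_eqI[OF der] axis_def partial_deriv_def[of j \<phi>])
      also have "\<dots> \<in> radial_span H"
        using coord by (intro radial_span.add[OF radial_span.coord radial_span.scale]) auto
      finally show ?thesis .
    qed
    moreover have "rapidly_decreasing (\<lambda>x. of_real (x $ i) * \<phi> x)"
    proof (rule rapidly_decreasing_mult[where A = 1 and j = 1])
      show "cmod (of_real (x $ i)) \<le> 1 * (1 + norm x) ^ 1" for x :: "real^'n"
        using component_le_norm_cart[of x i] by simp
    qed (use coord in blast)
    ultimately show ?case using der differentiableI by blast
  next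
    case (add \<phi> \<psi>)
    have der: "((\<lambda>x. \<phi> x + \<psi> x) has_derivative
        (\<lambda>v. frechet_derivative \<phi> (at x) v + frechet_derivative \<psi> (at x) v)) (at x)" for x
      using add by (intro has_derivative_add differentiable_has_derivative) auto
    have "partial_deriv j (\<lambda>x. \<phi> x + \<psi> x) = (\<lambda>x. partial_deriv j \<phi> x + partial_deriv j \<psi> x)" for j
      by (rule ext) (auto simp add: partial_deriv_eqI[OF der] partial_deriv_def[of j \<phi>] partial_deriv_def[of j \<psi>])
    then show ?case using add der differentiableI by (auto intro: rapidly_decreasing_add radial_span.add)
  next
    case (scale \<phi> c)
    have der: "((\<lambda>x. c * \<phi> x) has_derivative (\<lambda>v. c * frechet_derivative \<phi> (at x) v)) (at x)" for x
      using scale by (intro has_derivative_mult_right differentiable_has_derivative) auto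
    have "partial_deriv j (\<lambda>x. c * \<phi> x) = (\<lambda>x. c * partial_deriv j \<phi> x)" for j
      by (rule ext) (auto simp add: partial_deriv_eqI[OF der] partial_deriv_def[of j \<phi>])
    moreover have "rapidly_decreasing (\<lambda>x. c * \<phi> x)"
      using scale by (auto intro!: rapidly_decreasing_mult[where A = "cmod c" and j = 0])
    ultimately show ?case using scale der differentiableI by (auto intro: radial_span.scale)
  qed
  have "(\<lambda>x::real^'n. complex_of_real (h ((norm x)\<^sup>2))) \<in> radial_span H" by (intro radial_span.base H)
  then show ?thesis by (rule schwartz_coinduct) (use main in auto)
qed

section \<open>A smooth cutoff that is flat at the origin\<close>

text \<open>The derivative of a logistic function is a polynomial in that function, so products of such cutoffs
  with powers of \<open>u\<close> are closed under differentiation.\<close>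

definition cutoff :: "real \<Rightarrow> real \<Rightarrow> real" where
  "cutoff r u = (if u \<le> 0 then 1 else 1 / (1 + exp (r * u - 1 / (r * u))))"

text \<open>In the base product the first factor decays exponentially at infinity and the second
  vanishes to infinite order at 0 from the right, so multiplication by any real power of u, negative
  ones included, is harmless. The other rules are what differentiation produces.\<close>

inductive_set flat_profiles :: "(real \<Rightarrow> real) set" where
  base: "r > 0 \<Longrightarrow> s > 0 \<Longrightarrow> (\<lambda>u. cutoff r u * (1 - cutoff s u)) \<in> flat_profiles"
| mult_powr: "h \<in> flat_profiles \<Longrightarrow> (\<lambda>u. u powr a * h u) \<in> flat_profiles"
| mult_cutoff: "h \<in> flat_profiles \<Longrightarrow> r > 0 \<Longrightarrow> (\<lambda>u. cutoff r u * h u) \<in> flat_profiles"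
| add: "h \<in> flat_profiles \<Longrightarrow> k \<in> flat_profiles \<Longrightarrow> (\<lambda>u. h u + k u) \<in> flat_profiles"
| scale: "h \<in> flat_profiles \<Longrightarrow> (\<lambda>u. c * h u) \<in> flat_profiles"

lemma cutoff_nonpos [simp]: "u \<le> 0 \<Longrightarrow> cutoff r u = 1"
  by (simp add: cutoff_def)

lemma cutoff_bounds: "0 < cutoff r u" "cutoff r u \<le> 1"
  by (auto simp: cutoff_def add_pos_pos intro!: add_increasing2)

lemma cutoff_le_exp: "u > 0 \<Longrightarrow> cutoff r u \<le> exp (1 / (r * u) - r * u)"
proof -
  assume "u > 0"
  then have "cutoff r u \<le> 1 / exp (r * u - 1 / (r * u))"
    by (auto simp: cutoff_def intro!: divide_left_mono mult_pos_pos add_pos_pos)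
  then show ?thesis by (simp add: exp_diff)
qed

lemma one_minus_cutoff_le_exp: "u > 0 \<Longrightarrow> 1 - cutoff r u \<le> exp (r * u - 1 / (r * u))"
proof -
  assume u: "u > 0"
  define e where "e = exp (r * u - 1 / (r * u))"
  have "e > 0" by (simp add: e_def)
  then have "1 - 1 / (1 + e) \<le> e" by (simp add: field_simps)
  then show ?thesis using u by (simp add: cutoff_def e_def)
qed

text \<open>The logistic identity c' = - E' c (1 - c) for c = 1 / (1 + exp E), with E = r u - 1/(r
  u) and E' = r + 1/(r u^2).\<close>

lemma cutoff_deriv:
  assumes "r > 0" "u > 0"
  shows "(cutoff r has_real_derivative - ((r + inverse r * u powr -2) * (cutoff r u * (1 - cutoff r u)))) (at u)"
proof -
  have "((\<lambda>u. 1 / (1 + exp (r * u - 1 / (r * u)))) has_real_derivative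
      - (exp (r * u - 1 / (r * u)) * (r + r / (r * u)\<^sup>2)) / (1 + exp (r * u - 1 / (r * u)))\<^sup>2) (at u)"
    using assms by (auto intro!: derivative_eq_intros simp: power2_eq_square add_pos_pos[THEN less_imp_neq, THEN not_sym])
  moreover have "- (exp (r * u - 1 / (r * u)) * (r + r / (r * u)\<^sup>2)) / (1 + exp (r * u - 1 / (r * u)))\<^sup>2
      = - ((r + inverse r * u powr -2) * (cutoff r u * (1 - cutoff r u)))"
  proof -
    define e where "e = exp (r * u - 1 / (r * u))"
    have "e > 0" by (simp add: e_def)
    then have "1 + e \<noteq> 0" by simp
    have "r / (r * u)\<^sup>2 = inverse r * u powr -2"
      using assms by (simp add: powr_minus powr_numeral field_simps power2_eq_square)
    moreover have "cutoff r u = 1 / (1 + e)" using assms by (simp add: cutoff_def e_def)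
    moreover have "1 - 1 / (1 + e) = e / (1 + e)" using \<open>1 + e \<noteq> 0\<close> by (simp add: field_simps)
    ultimately show ?thesis
      unfolding e_def[symmetric] by (simp add: power2_eq_square)
  qed
  ultimately have "((\<lambda>u. 1 / (1 + exp (r * u - 1 / (r * u)))) has_real_derivative
       - ((r + inverse r * u powr -2) * (cutoff r u * (1 - cutoff r u)))) (at u)" by simp
  then show ?thesis
    by (rule has_field_derivative_transform_within_open[where S = "{0<..}"])
      (use assms in \<open>auto simp: cutoff_def\<close>)
qed

text \<open>From (1 + x/k)^k <= exp x with x = r u and a natural number k >= a.\<close>

lemma powr_exp_bounded:
  fixes a r :: real
  assumes "r > 0"
  shows "\<exists>B. \<forall>u\<ge>1. u powr a * exp (- r * u) \<le> B"
proof -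
  obtain k :: nat where k: "a \<le> k" "k > 0"
    using reals_Archimedean2[of "max 1 a"] by (metis less_eq_real_def max.strict_boundedE of_nat_0_less_iff zero_less_one less_trans)
  have "u powr a * exp (- r * u) \<le> (k / r) ^ k" if "u \<ge> 1" for u
  proof -
    have "(r * u / k) ^ k \<le> (1 + r * u / k) ^ k" using assms that by (intro power_mono) auto
    also have "\<dots> \<le> exp (r * u)"
    proof (rule exp_ge_one_plus_x_over_n_power_n)
      have "0 \<le> r * u" using assms that by simp
      then show "- real k \<le> r * u" by linarith
    qed (use k in simp)
    finally have *: "u ^ k \<le> (k / r) ^ k * exp (r * u)"
      using assms k by (simp add: power_divide power_mult_distrib field_simps)
    have "u powr a \<le> u powr real k" using k that by (intro powr_mono) auto
    also have "\<dots> = u ^ k" using that by (simp add: powr_realpow)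
    finally have "u powr a * exp (- r * u) \<le> (k / r) ^ k * exp (r * u) * exp (- r * u)"
      using * by (intro mult_right_mono) auto
    then show ?thesis by (simp add: mult.assoc flip: exp_add)
  qed
  then show ?thesis by blast
qed

text \<open>Flatness at 0 is exponential decay seen through u -> 1/u: near 0 the bound exp(s u -
  1/(s u)) is at most exp s times exp(-(1/s) (1/u)), to which \<open>powr_exp_bounded\<close>
  applies with exponent -a.\<close>

lemma one_minus_cutoff_bounded:
  assumes "s > 0"
  shows "\<exists>C. \<forall>u. 0 < u \<and> u \<le> 1 \<longrightarrow> u powr a * (1 - cutoff s u) \<le> C"
proof -
  obtain C where C: "\<And>u. u \<ge> 1 \<Longrightarrow> u powr - a * exp (- (1 / s) * u) \<le> C"
    using powr_exp_bounded[of "1 / s" "- a"] assms by auto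
  have "u powr a * (1 - cutoff s u) \<le> exp s * C" if "0 < u" "u \<le> 1" for u
  proof -
    have "1 - cutoff s u \<le> exp (s * u - 1 / (s * u))" using one_minus_cutoff_le_exp that by simp
    also have "\<dots> \<le> exp (s + - (1 / s) * (1 / u))" using assms that by simp
    finally have "u powr a * (1 - cutoff s u) \<le> u powr a * exp (s + - (1 / s) * (1 / u))"
      by (intro mult_left_mono) auto
    also have "\<dots> = exp s * ((1 / u) powr - a * exp (- (1 / s) * (1 / u)))"
      using that by (simp only: exp_add mult_ac) (simp add: powr_divide powr_minus field_simps)
    also have "\<dots> \<le> exp s * C" using C[of "1 / u"] that by (intro mult_left_mono) auto
    finally show ?thesis .
  qed
  then show ?thesis by blast
qed

lemma flat_profile_nonpos: "h \<in> flat_profiles \<Longrightarrow> u \<le> 0 \<Longrightarrow> h u = 0"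
  by (induction rule: flat_profiles.induct) auto

text \<open>One statement for both ends: very negative \<open>a\<close> expresses flatness at 0,
  large \<open>a\<close> decay at infinity. It is proved for all \<open>a\<close> at once because
  multiplying by u^b shifts the exponent to a + b.\<close>

lemma flat_profile_bounded:
  assumes "h \<in> flat_profiles"
  shows "\<exists>B. \<forall>u>0. u powr a * \<bar>h u\<bar> \<le> B"
  using assms
proof (induction arbitrary: a)
  case (base r s)
  obtain B where B: "\<And>u. u \<ge> 1 \<Longrightarrow> u powr a * exp (- r * u) \<le> B"
    using powr_exp_bounded[OF base(1)] by blast
  obtain C where C: "\<And>u. 0 < u \<Longrightarrow> u \<le> 1 \<Longrightarrow> u powr a * (1 - cutoff s u) \<le> C"
    using one_minus_cutoff_bounded[OF base(2)] by blast
  have "u powr a * \<bar>cutoff r u * (1 - cutoff s u)\<bar> \<le> max (exp (1 / r) * B) C" if "u > 0" for u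
  proof (cases "u \<ge> 1")
    case True
    have "\<bar>cutoff r u * (1 - cutoff s u)\<bar> \<le> cutoff r u * 1"
      using cutoff_bounds[of r u] cutoff_bounds[of s u] unfolding abs_mult by (intro mult_mono) auto
    also have "\<dots> \<le> exp (1 / (r * u) - r * u)" using cutoff_le_exp that by simp
    also have "\<dots> \<le> exp (1 / r + - r * u)" using True base by (simp add: field_simps)
    finally have "u powr a * \<bar>cutoff r u * (1 - cutoff s u)\<bar> \<le> u powr a * exp (1 / r + - r * u)"
      by (intro mult_left_mono) auto
    also have "\<dots> = exp (1 / r) * (u powr a * exp (- r * u))" by (simp only: exp_add mult_ac)
    also have "\<dots> \<le> exp (1 / r) * B" using B True by (intro mult_left_mono) auto
    finally show ?thesis by simp
  next
    case False
    have "\<bar>cutoff r u * (1 - cutoff s u)\<bar> \<le> 1 * (1 - cutoff s u)"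
      using cutoff_bounds[of r u] cutoff_bounds[of s u] unfolding abs_mult by (intro mult_mono) auto
    then have "u powr a * \<bar>cutoff r u * (1 - cutoff s u)\<bar> \<le> u powr a * (1 - cutoff s u)"
      by (simp add: mult_left_mono)
    also have "\<dots> \<le> C" using C False that by simp
    finally show ?thesis by simp
  qed
  then show ?case by blast
next
  case (mult_powr h b)
  from mult_powr.IH[of "a + b"] show ?case by (auto simp: powr_add abs_mult mult.assoc)
next
  case (mult_cutoff h r)
  obtain B where B: "\<And>u. u > 0 \<Longrightarrow> u powr a * \<bar>h u\<bar> \<le> B" using mult_cutoff.IH by blast
  have "u powr a * \<bar>cutoff r u * h u\<bar> \<le> B" if "u > 0" for u
  proof -
    have "\<bar>cutoff r u * h u\<bar> \<le> 1 * \<bar>h u\<bar>"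
      unfolding abs_mult using cutoff_bounds[of r u] by (intro mult_right_mono) auto
    then have "u powr a * \<bar>cutoff r u * h u\<bar> \<le> u powr a * \<bar>h u\<bar>" by (intro mult_left_mono) auto
    then show ?thesis using B[OF that] by linarith
  qed
  then show ?case by blast
next
  case (add h k)
  obtain B C where B: "\<And>u. u > 0 \<Longrightarrow> u powr a * \<bar>h u\<bar> \<le> B" "\<And>u. u > 0 \<Longrightarrow> u powr a * \<bar>k u\<bar> \<le> C"
    using add.IH by meson
  have "u powr a * \<bar>h u + k u\<bar> \<le> B + C" if "u > 0" for u
  proof -
    have "u powr a * \<bar>h u + k u\<bar> \<le> u powr a * (\<bar>h u\<bar> + \<bar>k u\<bar>)" by (intro mult_left_mono) auto
    then show ?thesis using B[OF that] by (simp add: distrib_left)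
  qed
  then show ?case by blast
next
  case (scale h c)
  obtain B where B: "\<And>u. u > 0 \<Longrightarrow> u powr a * \<bar>h u\<bar> \<le> B" using scale.IH by blast
  have "u powr a * \<bar>c * h u\<bar> \<le> \<bar>c\<bar> * B" if "u > 0" for u
    using mult_left_mono[OF B[OF that], of "\<bar>c\<bar>"] by (simp add: abs_mult mult_ac)
  then show ?case by blast
qed

text \<open>Each case of the induction exhibits the derivative as a term built from the introduction
  rules of \<open>flat_profiles\<close>, so that membership is found by applying these
  rules.\<close>

lemma flat_profile_deriv_pos:
  assumes "h \<in> flat_profiles"
  shows "\<exists>h'\<in>flat_profiles. \<forall>u>0. (h has_real_derivative h' u) (at u)"
  using assms
proof induction
  case (base r s)
  let ?b = "\<lambda>u. cutoff r u * (1 - cutoff s u)"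
  let ?h = "\<lambda>u. (- r * ?b u + (- inverse r) * (u powr -2 * ?b u)) + (r * (cutoff r u * ?b u) + inverse r * (u powr -2 * (cutoff r u * ?b u)))
      + (s * (cutoff s u * ?b u) + inverse s * (u powr -2 * (cutoff s u * ?b u)))"
  \<comment> \<open>The left side is what the product rule delivers, the right side its expansion in
    the shape of \<open>?h\<close>. Here c and d stand for the two cutoffs, P for u^-2, and i and j
    for the inverses of r and s.\<close>
  have ring_identity: "- ((r + i * P) * (c * (1 - c))) * (1 - d) + (0 - - ((s + j * P) * (d * (1 - d)))) * c
      = - r * (c * (1 - d)) + (- i) * (P * (c * (1 - d)))
        + (r * (c * (c * (1 - d))) + i * (P * (c * (c * (1 - d)))))
        + (s * (d * (c * (1 - d))) + j * (P * (d * (c * (1 - d)))))" for c d i j P :: real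
    by (simp add: algebra_simps)
  have mem: "?h \<in> flat_profiles" by (rule flat_profiles.base flat_profiles.add flat_profiles.scale
      flat_profiles.mult_powr flat_profiles.mult_cutoff base)+
  have deriv: "(?b has_real_derivative ?h u) (at u)" if "u > 0" for u
    using DERIV_mult[OF cutoff_deriv[OF base(1) that]
        DERIV_diff[OF DERIV_const[of 1] cutoff_deriv[OF base(2) that]]]
    unfolding ring_identity .
  show ?case by (rule bexI[where x = ?h, OF _ mem]) (intro allI impI deriv)
next
  case (mult_powr h a)
  then obtain h' where h': "h' \<in> flat_profiles" "\<And>u. u > 0 \<Longrightarrow> (h has_real_derivative h' u) (at u)" by blast
  let ?h = "\<lambda>u. a * (u powr (a - 1) * h u) + u powr a * h' u"
  have mem: "?h \<in> flat_profiles" by (rule flat_profiles.base flat_profiles.add flat_profiles.scale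
      flat_profiles.mult_powr flat_profiles.mult_cutoff mult_powr h')+
  have deriv: "((\<lambda>u. u powr a * h u) has_real_derivative ?h u) (at u)" if "u > 0" for u
    by (rule DERIV_cong[OF DERIV_mult[OF has_real_derivative_powr[OF that] h'(2)[OF that]]]) simp
  show ?case by (rule bexI[where x = ?h, OF _ mem]) (intro allI impI deriv)
next
  case (mult_cutoff h r)
  then obtain h' where h': "h' \<in> flat_profiles" "\<And>u. u > 0 \<Longrightarrow> (h has_real_derivative h' u) (at u)" by blast
  let ?h = "\<lambda>u. (- r * (cutoff r u * h u) + (- inverse r) * (u powr -2 * (cutoff r u * h u)))
      + (r * (cutoff r u * (cutoff r u * h u)) + inverse r * (u powr -2 * (cutoff r u * (cutoff r u * h u))))
      + cutoff r u * h' u"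
  have ring_identity: "- ((r + i * P) * (c * (1 - c))) * y + z * c
      = - r * (c * y) + (- i) * (P * (c * y)) + (r * (c * (c * y)) + i * (P * (c * (c * y)))) + c * z"
    for c i P y z :: real
    by (simp add: algebra_simps)
  have mem: "?h \<in> flat_profiles" by (rule flat_profiles.base flat_profiles.add flat_profiles.scale
      flat_profiles.mult_powr flat_profiles.mult_cutoff mult_cutoff h')+
  have deriv: "((\<lambda>u. cutoff r u * h u) has_real_derivative ?h u) (at u)" if "u > 0" for u
    using DERIV_mult[OF cutoff_deriv[OF mult_cutoff.hyps(2) that] h'(2)[OF that]]
    unfolding ring_identity .
  show ?case by (rule bexI[where x = ?h, OF _ mem]) (intro allI impI deriv)
next
  case (add h k)
  then obtain h' k' where h': "h' \<in> flat_profiles" "\<And>u. u > 0 \<Longrightarrow> (h has_real_derivative h' u) (at u)"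
    "k' \<in> flat_profiles" "\<And>u. u > 0 \<Longrightarrow> (k has_real_derivative k' u) (at u)" by blast
  show ?case
    by (rule bexI[where x = "\<lambda>u. h' u + k' u"])
      (auto intro!: flat_profiles.add derivative_intros h')
next
  case (scale h c)
  then obtain h' where h': "h' \<in> flat_profiles" "\<And>u. u > 0 \<Longrightarrow> (h has_real_derivative h' u) (at u)" by blast
  show ?case
    by (rule bexI[where x = "\<lambda>u. c * h' u"])
      (auto intro!: flat_profiles.scale derivative_eq_intros h')
qed

lemma has_real_derivative_zero_if_quadratic:
  fixes h :: "real \<Rightarrow> real"
  assumes "\<And>u. \<bar>h u\<bar> \<le> B * u\<^sup>2"
  shows "(h has_real_derivative 0) (at 0)"
proof -
  have h0: "h 0 = 0" using assms[of 0] by simp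
  have "((\<lambda>u. B * u) \<longlongrightarrow> B * 0) (at (0::real))" by (intro tendsto_intros)
  then have lim: "((\<lambda>u. \<bar>B * u\<bar>) \<longlongrightarrow> 0) (at (0::real))" by (auto intro: tendsto_rabs_zero)
  have bound: "norm (h u / u) \<le> \<bar>B * u\<bar>" if "u \<noteq> 0" for u
  proof -
    have "\<bar>h u\<bar> \<le> \<bar>B\<bar> * u\<^sup>2" using assms[of u] by (smt (verit) mult_right_mono zero_le_power2)
    also have "\<dots> = \<bar>B * u\<bar> * \<bar>u\<bar>" by (simp add: abs_mult power2_eq_square)
    finally show ?thesis using that by (simp add: divide_le_eq)
  qed
  have "((\<lambda>u. h u / u) \<longlongrightarrow> 0) (at 0)"
    by (rule Lim_null_comparison[OF _ lim]) (auto simp only: eventually_at_filter intro!: always_eventually bound)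
  then show ?thesis unfolding DERIV_def using h0 by simp
qed

text \<open>At 0 the weighted bound with exponent -2 says |h u| <= B u^2, so the difference quotient
  tends to 0; to the left of 0 the function is constant.\<close>

lemma flat_profile_deriv_nonpos:
  assumes h: "\<And>u. u \<le> 0 \<Longrightarrow> h u = 0" and B: "\<And>u::real. u > 0 \<Longrightarrow> u powr -2 * \<bar>h u\<bar> \<le> B" and "u \<le> 0"
  shows "(h has_real_derivative 0) (at u)"
proof (cases "u = 0")
  case True
  have "0 \<le> B" using B[of 1] by (smt (verit) mult_nonneg_nonneg powr_ge_zero)
  have "\<bar>h u\<bar> \<le> B * u\<^sup>2" for u
  proof (cases "u > 0")
    case True
    then show ?thesis using B[of u] by (simp add: powr_minus powr_numeral field_simps)
  next
    case False
    then show ?thesis using h[of u] \<open>0 \<le> B\<close> by simp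
  qed
  then show ?thesis using True has_real_derivative_zero_if_quadratic by blast
next
  case False
  have "((\<lambda>_. 0) has_real_derivative 0) (at u)" by simp
  then show ?thesis
    by (rule has_field_derivative_transform_within_open[where S = "{..<0}"])
      (use False \<open>u \<le> 0\<close> h in auto)
qed

text \<open>The derivative found for u > 0 is itself a flat profile and hence 0 for u <= 0, where
  the derivative of \<open>h\<close> is 0 too. The same function therefore serves on the whole
  line.\<close>

lemma flat_profile_deriv:
  assumes "h \<in> flat_profiles"
  shows "\<exists>h'\<in>flat_profiles. \<forall>u. (h has_real_derivative h' u) (at u)"
proof -
  obtain h' where h': "h' \<in> flat_profiles" "\<And>u. u > 0 \<Longrightarrow> (h has_real_derivative h' u) (at u)"
    using flat_profile_deriv_pos[OF assms] by blast
  obtain B where "\<And>u. u > 0 \<Longrightarrow> u powr -2 * \<bar>h u\<bar> \<le> B" using flat_profile_bounded[OF assms] by blast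
  then have "(h has_real_derivative h' u) (at u)" if "u \<le> 0" for u
    using flat_profile_deriv_nonpos[of h B u] flat_profile_nonpos[OF assms] flat_profile_nonpos[OF h'(1)] that by simp
  then have "(h has_real_derivative h' u) (at u)" for u using h'(2)[of u] by (cases "u > 0") auto
  then show ?thesis by (intro bexI[OF _ h'(1)] allI)
qed

text \<open>A cutoff equals 1 on the negative axis and is not a flat profile, but its derivative is
  one. Adjoining the cutoff to \<open>flat_profiles\<close> thus gives a family closed under
  differentiation.\<close>

lemma cutoff_deriv_flat:
  assumes "r > 0"
  shows "\<exists>h'\<in>flat_profiles. \<forall>u. (cutoff r has_real_derivative h' u) (at u)"
proof -
  let ?b = "\<lambda>u. cutoff r u * (1 - cutoff r u)"
  let ?h = "\<lambda>u. (- r * ?b u + (- inverse r) * (u powr -2 * ?b u))"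
  have h: "?h \<in> flat_profiles" by (rule flat_profiles.base flat_profiles.add flat_profiles.scale
      flat_profiles.mult_powr flat_profiles.mult_cutoff assms)+
  have pos: "(cutoff r has_real_derivative ?h u) (at u)" if "u > 0" for u
    by (rule DERIV_cong[OF cutoff_deriv[OF assms that]]) (simp add: distrib_right)
  obtain C where C: "\<And>u. 0 < u \<Longrightarrow> u \<le> 1 \<Longrightarrow> u powr -2 * (1 - cutoff r u) \<le> C"
    using one_minus_cutoff_bounded[OF assms] by blast
  have "u powr -2 * \<bar>1 - cutoff r u\<bar> \<le> max 1 C" if "u > 0" for u
  proof (cases "u \<le> 1")
    case True
    then show ?thesis using C[OF that] cutoff_bounds[of r u] by simp
  next
    case False
    then have "u powr -2 * \<bar>1 - cutoff r u\<bar> \<le> 1 * 1"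
      using cutoff_bounds[of r u] by (intro mult_mono) (auto simp: powr_minus powr_numeral divide_simps)
    then show ?thesis by simp
  qed
  \<comment> \<open>The function that vanishes for u <= 0 is 1 minus the cutoff, so the derivative
    at such points is obtained for that one first.\<close>
  then have "((\<lambda>u. 1 - (1 - cutoff r u)) has_real_derivative 0 - 0) (at u)" if "u \<le> 0" for u
    using that by (intro DERIV_diff DERIV_const flat_profile_deriv_nonpos) auto
  then have "(cutoff r has_real_derivative ?h u) (at u)" if "u \<le> 0" for u
    using that flat_profile_nonpos[OF h that] by (simp only: ) simp
  then have "(cutoff r has_real_derivative ?h u) (at u)" for u using pos[of u] by (cases "u > 0") auto
  then show ?thesis by (intro bexI[OF _ h] allI)
qed

lemma flat_profile_rapid:
  assumes "h \<in> flat_profiles"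
  shows "\<exists>B. \<forall>u\<ge>0. (1 + u) ^ k * \<bar>h u\<bar> \<le> B"
proof -
  obtain B where B: "\<And>u. u > 0 \<Longrightarrow> u powr 0 * \<bar>h u\<bar> \<le> B" using flat_profile_bounded[OF assms] by blast
  obtain C where C: "\<And>u. u > 0 \<Longrightarrow> u powr real k * \<bar>h u\<bar> \<le> C" using flat_profile_bounded[OF assms] by blast
  have "0 \<le> B" using B[of 1] by auto
  have "0 \<le> C" using C[of 1] by auto
  have "(1 + u) ^ k * \<bar>h u\<bar> \<le> 2 ^ k * (B + C)" if "u \<ge> 0" for u
  proof (cases "u = 0")
    case True
    then show ?thesis using flat_profile_nonpos[OF assms, of u] \<open>0 \<le> B\<close> \<open>0 \<le> C\<close> by simp
  next
    case False
    with that have u: "u > 0" by simp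
    have "(1 + u) ^ k \<le> (2 * max 1 u) ^ k" using u by (intro power_mono) auto
    also have "\<dots> = 2 ^ k * max 1 u ^ k" by (simp add: power_mult_distrib)
    also have "\<dots> \<le> 2 ^ k * (1 + u ^ k)" using u by (intro mult_left_mono) (auto simp: max_def)
    finally have "(1 + u) ^ k * \<bar>h u\<bar> \<le> 2 ^ k * (1 + u ^ k) * \<bar>h u\<bar>" by (intro mult_right_mono) auto
    also have "\<dots> = 2 ^ k * (u powr 0 * \<bar>h u\<bar> + u powr real k * \<bar>h u\<bar>)"
      using u by (simp add: powr_realpow algebra_simps)
    also have "\<dots> \<le> 2 ^ k * (B + C)" using B[OF u] C[OF u] by (intro mult_left_mono add_mono) auto
    finally show ?thesis .
  qed
  then show ?thesis by blast
qed

lemma cutoff_rapid: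
  assumes "r > 0"
  shows "\<exists>B. \<forall>u\<ge>0. (1 + u) ^ k * \<bar>cutoff r u\<bar> \<le> B"
proof -
  obtain B where B: "\<And>u. u \<ge> 1 \<Longrightarrow> u powr real k * exp (- r * u) \<le> B"
    using powr_exp_bounded[OF assms] by blast
  have "(1 + u) ^ k * \<bar>cutoff r u\<bar> \<le> max (2 ^ k) (2 ^ k * exp (1 / r) * B)" if "u \<ge> 0" for u
  proof (cases "u \<ge> 1")
    case True
    have "(1 + u) ^ k \<le> (2 * u) ^ k" using True by (intro power_mono) auto
    then have "(1 + u) ^ k \<le> 2 ^ k * u powr real k" using True by (simp add: powr_realpow power_mult_distrib)
    moreover have "\<bar>cutoff r u\<bar> \<le> exp (1 / r) * exp (- r * u)"
    proof -
      have "\<bar>cutoff r u\<bar> \<le> exp (1 / (r * u) - r * u)" using cutoff_le_exp[of u r] cutoff_bounds[of r u] True by simp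
      also have "\<dots> \<le> exp (1 / r + - r * u)" using True assms by (simp add: field_simps)
      finally show ?thesis by (simp only: exp_add)
    qed
    ultimately have "(1 + u) ^ k * \<bar>cutoff r u\<bar> \<le> (2 ^ k * u powr real k) * (exp (1 / r) * exp (- r * u))"
      by (intro mult_mono) auto
    also have "\<dots> = 2 ^ k * exp (1 / r) * (u powr real k * exp (- r * u))" by simp
    also have "\<dots> \<le> 2 ^ k * exp (1 / r) * B" using B[OF True] by (intro mult_left_mono) auto
    finally show ?thesis by simp
  next
    case False
    have "(1 + u) ^ k * \<bar>cutoff r u\<bar> \<le> 2 ^ k * 1"
      using that False cutoff_bounds[of r u] by (intro mult_mono power_mono) auto
    then show ?thesis by simp
  qed
  then show ?thesis by blast
qed

text \<open>Dilating the frequency only changes the parameter: halving xi divides |xi|^2 by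
  4.\<close>

lemma cutoff_scale: "a > 0 \<Longrightarrow> cutoff r (a * u) = cutoff (a * r) u"
  by (simp add: cutoff_def zero_less_mult_iff mult_le_0_iff mult_ac)

lemma schwartz_flat_profile:
  assumes "h \<in> flat_profiles"
  shows "schwartz (\<lambda>x. complex_of_real (h ((norm x)\<^sup>2)))"
  by (rule schwartz_radial[OF assms flat_profile_deriv flat_profile_rapid])

lemma schwartz_cutoff:
  assumes "r > 0"
  shows "schwartz (\<lambda>x. complex_of_real (cutoff r ((norm x)\<^sup>2)))"
proof (rule schwartz_radial[of "cutoff r" "insert (cutoff r) flat_profiles"])
  show "\<exists>h'\<in>insert (cutoff r) flat_profiles. \<forall>u. (h has_real_derivative h' u) (at u)"
    if "h \<in> insert (cutoff r) flat_profiles" for h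
    using that flat_profile_deriv[of h] cutoff_deriv_flat[OF assms] by fast
  show "\<exists>B. \<forall>u\<ge>0. (1 + u) ^ k * \<bar>h u\<bar> \<le> B" if "h \<in> insert (cutoff r) flat_profiles" for h k
    using that flat_profile_rapid[of h k] cutoff_rapid[OF assms, of k] by fast
qed simp

text \<open>From c - d = c (1 - d) - d (1 - c). This difference is the reason why the base rule of
  \<open>flat_profiles\<close> carries two parameters.\<close>

lemma cutoff_diff_flat:
  assumes "r > 0" "s > 0"
  shows "(\<lambda>u. cutoff r u - cutoff s u) \<in> flat_profiles"
proof -
  have "(\<lambda>u. cutoff r u * (1 - cutoff s u) + (-1) * (cutoff s u * (1 - cutoff r u))) \<in> flat_profiles"
    using assms by (intro flat_profiles.add flat_profiles.scale flat_profiles.base)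
  then show ?thesis by (simp add: algebra_simps)
qed

section \<open>Dilations, cubes and decaying kernels\<close>

lemma nn_integral_lborel_affine:
  fixes f :: "real^'n \<Rightarrow> ennreal"
  assumes [measurable]: "f \<in> borel_measurable borel" and "t \<noteq> 0"
  shows "(\<integral>\<^sup>+x. f x \<partial>lborel) = ennreal (\<bar>t\<bar> ^ CARD('n)) * (\<integral>\<^sup>+z. f (a + t *\<^sub>R z) \<partial>lborel)"
  by (subst lborel_affine[OF \<open>t \<noteq> 0\<close>, of a])
    (simp add: nn_integral_density nn_integral_distr nn_integral_cmult)

lemma integral_lborel_affine:
  fixes f :: "real^'n \<Rightarrow> complex"
  assumes [measurable]: "f \<in> borel_measurable borel" and "t \<noteq> 0"
  shows "(\<integral>x. f x \<partial>lborel) = of_real (\<bar>t\<bar> ^ CARD('n)) * (\<integral>z. f (a + t *\<^sub>R z) \<partial>lborel)"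
  by (subst lborel_affine[OF \<open>t \<noteq> 0\<close>, of a])
    (simp add: integral_density integral_distr, simp add: scaleR_conv_of_real)

lemma cube_eq_cbox: "cube a l = cbox a (a + (\<chi> i. l))"
  by (auto simp: cube_def mem_box_cart)

lemma cube_measurable [measurable]: "cube a l \<in> sets borel"
  by (simp add: cube_eq_cbox)

lemma emeasure_cube:
  fixes a :: "real^'n"
  assumes "l \<ge> 0"
  shows "emeasure lborel (cube a l) = ennreal (l ^ CARD('n))"
proof -
  have "measure lborel (cbox a (a + (\<chi> i. l))) = l ^ CARD('n)"
    using assms by (subst content_cbox_cart) (auto simp: interval_ne_empty_cart)
  moreover have "emeasure lborel (cbox a (a + (\<chi> i. l))) \<noteq> \<infinity>" 
    using emeasure_lborel_cbox_finite[of a "a + (\<chi> i. l)"] by (simp add: less_top)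
  ultimately show ?thesis unfolding cube_eq_cbox
    by (simp add: emeasure_eq_ennreal_measure)
qed

abbreviation dyadic_cube :: "nat \<Rightarrow> (real^'n) set" where
  "dyadic_cube k \<equiv> cube (\<chi> i. - (2 ^ k)) (2 ^ Suc k)"

lemma mem_dyadic_cube: "x \<in> dyadic_cube k \<longleftrightarrow> (\<forall>i. \<bar>x $ i\<bar> \<le> 2 ^ k)"
  by (auto simp: cube_def abs_le_iff minus_le_iff)

lemma ennreal_le_suminf: "f k \<le> (\<Sum>i. f i)" for f :: "nat \<Rightarrow> ennreal"
  using sum_le_suminf[of f "{k}"] by simp

lemma one_plus_norm_power_pos [simp]: "0 < (1 + norm x) ^ N"
  by (intro zero_less_power add_pos_nonneg) auto

lemma decay_le_one: "1 / (1 + norm x) ^ N \<le> 1"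
  using one_le_power[of "1 + norm x" N] by (simp add: divide_le_eq_1)

text \<open>If k > 0 is the first index whose cube contains x, then x leaves the cube k - 1, so 1 +
  |x| >= 2^(k-1); the factor 2^N pays for this shift of the index. The dyadic cubes take the place
  of polar coordinates, and they let oscillations over cubes be summed against a decaying
  kernel.\<close>

lemma decay_le_dyadic_sum:
  fixes x :: "real^'n"
  shows "ennreal (1 / (1 + norm x) ^ N) \<le> (\<Sum>k. ennreal (2 ^ N * (1 / 2) ^ (k * N)) * indicator (dyadic_cube k) x)"
proof -
  obtain k0 :: nat where k0: "norm x < 2 ^ k0" using real_arch_pow[of 2 "norm x"] by auto
  have "x \<in> dyadic_cube k0"
    unfolding mem_dyadic_cube using component_le_norm_cart[of x] k0 by (meson less_imp_le order_trans)
  define k where "k = (LEAST k. x \<in> dyadic_cube k)"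
  have k: "x \<in> dyadic_cube k" unfolding k_def by (rule LeastI) fact
  have "1 / (1 + norm x) ^ N \<le> 2 ^ N * (1 / 2) ^ (k * N)"
  proof (cases k)
    case 0
    have "1 / (1 + norm x) ^ N \<le> 1" by (rule decay_le_one)
    also have "\<dots> \<le> 2 ^ N" by simp
    finally show ?thesis using 0 by simp
  next
    case (Suc j)
    then have "x \<notin> dyadic_cube j" unfolding k_def by (intro not_less_Least) simp
    then obtain i where "2 ^ j < \<bar>x $ i\<bar>" unfolding mem_dyadic_cube by (auto simp: not_le)
    then have "2 ^ j \<le> 1 + norm x" using component_le_norm_cart[of x i] by linarith
    then have "(2 ^ j) ^ N \<le> (1 + norm x) ^ N" by (intro power_mono) auto
    then have "1 / (1 + norm x) ^ N \<le> 1 / (2 ^ j) ^ N" by (intro divide_left_mono mult_pos_pos) auto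
    also have "\<dots> = 2 ^ N * (1 / 2) ^ (k * N)"
      using Suc by (simp add: power_one_over power_add mult.commute flip: power_mult)
    finally show ?thesis .
  qed
  then have "ennreal (1 / (1 + norm x) ^ N) \<le> ennreal (2 ^ N * (1 / 2) ^ (k * N)) * indicator (dyadic_cube k) x"
    using k by (simp add: ennreal_leI)
  also have "\<dots> \<le> (\<Sum>k. ennreal (2 ^ N * (1 / 2) ^ (k * N)) * indicator (dyadic_cube k) x)"
    by (rule ennreal_le_suminf)
  finally show ?thesis .
qed

text \<open>Consecutive terms have ratio 2^(m-N) <= 1/2. It is used with m = n for the integral of
  the decay, and with m = 2n for double integrals over a pair of cubes.\<close>

lemma dyadic_sum_finite:
  assumes "m < N"
  shows "(\<Sum>k. ennreal (2 ^ N * (1 / 2) ^ (k * N)) * ennreal ((2 ^ Suc k) ^ m)) < \<infinity>"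
proof -
  have "ennreal (2 ^ N * (1 / 2) ^ (k * N)) * ennreal ((2 ^ Suc k) ^ m) \<le> ennreal (2 ^ N * 2 ^ m * (1 / 2) ^ k)" for k
  proof -
    have "(1 / 2 :: real) ^ (k * N) * (2 ^ Suc k) ^ m \<le> (1 / 2) ^ (k * Suc m) * (2 ^ Suc k) ^ m"
      using mult_le_mono2[of "Suc m" N k] assms by (intro mult_right_mono power_decreasing) auto
    also have "\<dots> = 2 ^ m * (1 / 2) ^ k"
      by (simp add: power_add power_mult power_mult_distrib power_one_over field_simps flip: power_mult)
    finally have "2 ^ N * ((1 / 2 :: real) ^ (k * N) * (2 ^ Suc k) ^ m) \<le> 2 ^ N * (2 ^ m * (1 / 2) ^ k)"
      by (intro mult_left_mono) auto
    then show ?thesis by (simp add: ennreal_mult[symmetric] mult.assoc ennreal_leI del: ennreal_mult)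
  qed
  then have "(\<Sum>k. ennreal (2 ^ N * (1 / 2) ^ (k * N)) * ennreal ((2 ^ Suc k) ^ m))
      \<le> (\<Sum>k. ennreal (2 ^ N * 2 ^ m * (1 / 2) ^ k))" by (intro suminf_le) auto
  also have "\<dots> = ennreal (\<Sum>k. 2 ^ N * 2 ^ m * (1 / 2) ^ k)"
    by (intro suminf_ennreal2) (auto intro!: summable_mult)
  finally show ?thesis by (simp add: le_less_trans)
qed

lemma decay_nn_integral_finite:
  assumes "CARD('n) < N"
  shows "(\<integral>\<^sup>+x. ennreal (1 / (1 + norm (x::real^'n)) ^ N) \<partial>lborel) < \<infinity>"
proof -
  have "(\<integral>\<^sup>+x. ennreal (1 / (1 + norm (x::real^'n)) ^ N) \<partial>lborel)
      \<le> (\<integral>\<^sup>+x. (\<Sum>k. ennreal (2 ^ N * (1 / 2) ^ (k * N)) * indicator (dyadic_cube k) (x::real^'n)) \<partial>lborel)"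
    by (intro nn_integral_mono decay_le_dyadic_sum)
  also have "\<dots> = (\<Sum>k. ennreal (2 ^ N * (1 / 2) ^ (k * N)) * ennreal ((2 ^ Suc k) ^ CARD('n)))"
    by (subst nn_integral_suminf) (auto simp: nn_integral_cmult_indicator emeasure_cube simp del: power_Suc)
  also have "\<dots> < \<infinity>" by (rule dyadic_sum_finite[OF assms])
  finally show ?thesis .
qed

lemma integrable_decay:
  fixes h :: "real^'n \<Rightarrow> complex"
  assumes [measurable]: "h \<in> borel_measurable borel" and N: "CARD('n) < N"
    and C: "\<And>x. cmod (h x) \<le> C / (1 + norm x) ^ N"
  shows "integrable lborel h"
proof (rule integrableI_bounded)
  have "0 \<le> C" using order_trans[OF norm_ge_zero C[of 0]] by simp
  have "(\<integral>\<^sup>+x. ennreal (cmod (h x)) \<partial>lborel) \<le> (\<integral>\<^sup>+x. ennreal C * ennreal (1 / (1 + norm (x::real^'n)) ^ N) \<partial>lborel)"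
  proof (rule nn_integral_mono)
    show "ennreal (cmod (h x)) \<le> ennreal C * ennreal (1 / (1 + norm x) ^ N)" for x
      using C[of x] \<open>0 \<le> C\<close> by (simp add: ennreal_mult[symmetric] ennreal_leI)
  qed
  also have "\<dots> = ennreal C * (\<integral>\<^sup>+x. ennreal (1 / (1 + norm (x::real^'n)) ^ N) \<partial>lborel)"
    by (intro nn_integral_cmult) simp
  also have "\<dots> < \<infinity>" using decay_nn_integral_finite[OF N] by (simp add: ennreal_mult_less_top)
  finally show "(\<integral>\<^sup>+x. ennreal (cmod (h x)) \<partial>lborel) < \<infinity>" .
qed simp

text \<open>If a > c, then a = a^(1-p) a^p <= c^(1-p) a^p because 1 - p <= 0. The parameter c is
  later set to the expected size of a, which makes both terms comparable.\<close>

lemma le_add_powr: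
  fixes a c p :: real
  assumes "0 \<le> a" "0 < c" "1 \<le> p"
  shows "a \<le> c + c powr (1 - p) * a powr p"
proof (cases "a \<le> c")
  case False
  then have "a = a powr (1 - p) * a powr p" using assms by (simp flip: powr_add)
  also have "\<dots> \<le> c powr (1 - p) * a powr p"
    using False assms by (intro mult_right_mono powr_mono2') auto
  finally show ?thesis using assms by linarith
qed (simp add: add_increasing2)

text \<open>Integrating \<open>|f| \<le> c + c\<^sup>1\<^sup>-\<^sup>p |f|\<^sup>p\<close> replaces Hoelder's inequality.\<close>

lemma nn_integral_decay_Lp:
  fixes f :: "real^'n \<Rightarrow> complex"
  assumes [measurable]: "f \<in> borel_measurable borel" and "1 \<le> p" "0 < t" "0 < \<Lambda>"
    and f: "(\<integral>\<^sup>+x. ennreal (cmod (f x) powr p) \<partial>lborel) \<le> ennreal (\<Lambda> powr p)"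
  shows "(\<integral>\<^sup>+z. ennreal (cmod (f (x + t *\<^sub>R z))) * ennreal (1 / (1 + norm z) ^ N) \<partial>lborel)
    \<le> ennreal (t powr (- real CARD('n) / p) * \<Lambda>) *
        ((\<integral>\<^sup>+z. ennreal (1 / (1 + norm (z::real^'n)) ^ N) \<partial>lborel) + 1)"
proof -
  let ?w = "\<lambda>z::real^'n. ennreal (1 / (1 + norm z) ^ N)"
  \<comment> \<open>This bounds the L^p norm of z -> f(x + t z), since the change of variables
    divides the integral of |f|^p by t^n. With this choice the second term below integrates to at
    most \<open>c\<close>.\<close>
  define c where "c = t powr (- real CARD('n) / p) * \<Lambda>"
  have c: "c > 0" using assms by (simp add: c_def)
  have "(\<integral>\<^sup>+z. ennreal (cmod (f (x + t *\<^sub>R z))) * ?w z \<partial>lborel)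
      \<le> (\<integral>\<^sup>+z. ennreal c * ?w z + ennreal (c powr (1 - p)) * ennreal (cmod (f (x + t *\<^sub>R z)) powr p) \<partial>lborel)"
  proof (intro nn_integral_mono)
    fix z :: "real^'n"
    have w1: "1 / (1 + norm z) ^ N \<le> 1" by (rule decay_le_one)
    have "cmod (f (x + t *\<^sub>R z)) * (1 / (1 + norm z) ^ N)
        \<le> (c + c powr (1 - p) * cmod (f (x + t *\<^sub>R z)) powr p) * (1 / (1 + norm z) ^ N)"
      by (intro mult_right_mono le_add_powr) (use c assms in auto)
    also have "\<dots> \<le> c * (1 / (1 + norm z) ^ N) + c powr (1 - p) * cmod (f (x + t *\<^sub>R z)) powr p"
      using mult_left_mono[OF w1, of "c powr (1 - p) * cmod (f (x + t *\<^sub>R z)) powr p"]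
      by (simp add: add_divide_distrib)
    finally show "ennreal (cmod (f (x + t *\<^sub>R z))) * ?w z
        \<le> ennreal c * ?w z + ennreal (c powr (1 - p)) * ennreal (cmod (f (x + t *\<^sub>R z)) powr p)"
      using c by (simp add: ennreal_mult[symmetric] ennreal_plus[symmetric] ennreal_leI del: ennreal_plus)
  qed
  also have "\<dots> = ennreal c * (\<integral>\<^sup>+z. ?w z \<partial>lborel)
      + ennreal (c powr (1 - p)) * (\<integral>\<^sup>+z. ennreal (cmod (f (x + t *\<^sub>R z)) powr p) \<partial>lborel)"
    by (simp add: nn_integral_add nn_integral_cmult)
  also have "ennreal (c powr (1 - p)) * (\<integral>\<^sup>+z. ennreal (cmod (f (x + t *\<^sub>R z)) powr p) \<partial>lborel) \<le> ennreal c"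
  proof -
    let ?I = "\<integral>\<^sup>+z. ennreal (cmod (f (x + t *\<^sub>R z)) powr p) \<partial>lborel"
    have "ennreal (t ^ CARD('n)) * ?I \<le> ennreal (\<Lambda> powr p)"
      using nn_integral_lborel_affine[of "\<lambda>x. ennreal (cmod (f x) powr p)" t x] f \<open>0 < t\<close> by simp
    then have "ennreal (c powr (1 - p) / t ^ CARD('n)) * (ennreal (t ^ CARD('n)) * ?I)
        \<le> ennreal (c powr (1 - p) / t ^ CARD('n)) * ennreal (\<Lambda> powr p)" by (intro mult_left_mono) auto
    moreover have "ennreal (c powr (1 - p) / t ^ CARD('n)) * ennreal (t ^ CARD('n)) = ennreal (c powr (1 - p))"
      using \<open>0 < t\<close> by (simp add: ennreal_mult[symmetric])
    moreover have "c powr (1 - p) / t ^ CARD('n) * \<Lambda> powr p = c"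
    proof -
      have "c powr p = t powr (- real CARD('n)) * \<Lambda> powr p"
        using assms by (simp add: c_def powr_mult powr_powr)
      then have "c powr (1 - p) * c powr p = c powr (1 - p) / t ^ CARD('n) * \<Lambda> powr p"
        using \<open>0 < t\<close> by (simp add: powr_minus powr_realpow field_simps)
      then show ?thesis using c by (simp flip: powr_add)
    qed
    moreover have "ennreal (c powr (1 - p) / t ^ CARD('n)) * ennreal (\<Lambda> powr p)
        = ennreal (c powr (1 - p) / t ^ CARD('n) * \<Lambda> powr p)"
      using \<open>0 < t\<close> by (intro ennreal_mult[symmetric]) auto
    ultimately show ?thesis by (simp only: mult.assoc[symmetric])
  qed
  finally show ?thesis by (simp add: c_def distrib_left)
qed

section \<open>Fourier transforms of Schwartz functions\<close>

lemma schwartz_continuous: "schwartz h \<Longrightarrow> continuous_on UNIV h"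
  by (simp add: continuous_on_eq_continuous_at differentiable_imp_continuous_within schwartzD(1))

lemma schwartz_measurable [measurable_dest]: "schwartz h \<Longrightarrow> h \<in> borel_measurable borel"
  by (rule borel_measurable_continuous_onI[OF schwartz_continuous])

lemma rapidly_decreasingE:
  assumes "rapidly_decreasing h"
  obtains C where "\<And>x. cmod (h x) \<le> C / (1 + norm x) ^ N"
proof -
  obtain C where "\<And>x. (1 + norm x) ^ N * cmod (h x) \<le> C"
    using assms unfolding rapidly_decreasing_def by blast
  then have "\<And>x. cmod (h x) \<le> C / (1 + norm x) ^ N"
    by (subst le_divide_eq) (simp add: mult.commute)
  then show ?thesis by (rule that)
qed

lemma rapidly_decreasing_integrable:
  fixes h :: "real^'n \<Rightarrow> complex"
  assumes "rapidly_decreasing h" "h \<in> borel_measurable borel"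
  shows "integrable lborel h"
proof -
  obtain C where "\<And>x. cmod (h x) \<le> C / (1 + norm x) ^ (Suc CARD('n))"
    using rapidly_decreasingE[OF assms(1)] by blast
  then show ?thesis by (intro integrable_decay[of h "Suc CARD('n)" C]) (use assms in auto)
qed

lemma schwartz_integrable: "schwartz h \<Longrightarrow> integrable lborel h"
  by (intro rapidly_decreasing_integrable schwartzD schwartz_measurable)

lemma borel_measurable_cis [measurable]: "cis \<in> borel_measurable borel"
  by (intro borel_measurable_continuous_onI continuous_intros)

lemma fourier_lborel:
  assumes "h \<in> borel_measurable borel"
  shows "fourier h \<xi> = (\<integral>x. cis (- (x \<bullet> \<xi>)) * h x \<partial>lborel)"
proof -
  note [measurable] = assms
  show ?thesis unfolding fourier_def by (intro integral_completion) simp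
qed

lemma integrable_cis_mult:
  fixes h :: "real^'n \<Rightarrow> complex"
  assumes "integrable lborel h"
  shows "integrable lborel (\<lambda>x. cis (- (x \<bullet> \<xi>)) * h x)"
proof (rule Bochner_Integration.integrable_bound[OF assms])
  show "(\<lambda>x. cis (- (x \<bullet> \<xi>)) * h x) \<in> borel_measurable lborel"
    using borel_measurable_integrable[OF assms] by simp
qed (simp add: norm_mult)

lemma norm_fourier_le:
  assumes "integrable lborel h"
  shows "cmod (fourier h \<xi>) \<le> (\<integral>x. cmod (h x) \<partial>lborel)"
proof -
  have "cmod (fourier h \<xi>) \<le> (\<integral>x. cmod (cis (- (x \<bullet> \<xi>)) * h x) \<partial>lborel)"
    using borel_measurable_integrable[OF assms] by (subst fourier_lborel) (auto intro: integral_norm_bound)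
  then show ?thesis by (simp add: norm_mult)
qed

text \<open>The difference quotients \<open>D k\<close> have integral 0 by translation invariance
  and converge pointwise to the derivative. By the mean value inequality they are dominated by the
  decay of the derivative: the steps have length at most 1, and on such a segment 1 + |x| <= 2 (1 +
  |x + s e|).\<close>

lemma integral_partial_deriv_eq_0:
  fixes h :: "real^'n \<Rightarrow> complex"
  assumes h: "schwartz h"
  shows "(\<integral>x. partial_deriv i h x \<partial>lborel) = 0"
proof -
  define e where "e = (axis i 1 :: real^'n)"
  define D where "D = (\<lambda>k x. real (Suc k) *\<^sub>R (h (x + (1 / real (Suc k)) *\<^sub>R e) - h x))"
  let ?N = "Suc CARD('n)"
  have sp: "schwartz (partial_deriv i h)" by (intro schwartz_partial_deriv h)
  obtain C where C: "\<And>x. cmod (partial_deriv i h x) \<le> C / (1 + norm x) ^ ?N"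
    using rapidly_decreasingE[OF schwartzD(2)[OF sp]] by blast
  have "0 \<le> C" using order_trans[OF norm_ge_zero C[of 0]] by simp
  have norm_e: "norm e = 1" by (simp add: e_def)
  have line: "((\<lambda>s. h (x + s *\<^sub>R e)) has_vector_derivative partial_deriv i h (x + s *\<^sub>R e)) (at s within T)" for x s T
  proof -
    have "((\<lambda>s. x + s *\<^sub>R e) has_derivative (\<lambda>s. s *\<^sub>R e)) (at s within T)"
      by (auto intro!: derivative_eq_intros)
    from has_derivative_compose[OF this schwartz_has_derivative[OF h]]
    have "((\<lambda>s. h (x + s *\<^sub>R e)) has_derivative (\<lambda>s'. frechet_derivative h (at (x + s *\<^sub>R e)) (s' *\<^sub>R e))) (at s within T)" .
    moreover have "linear (frechet_derivative h (at (x + s *\<^sub>R e)))"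
      using schwartz_has_derivative[OF h] has_derivative_linear by blast
    ultimately show ?thesis
      unfolding has_vector_derivative_def partial_deriv_def by (simp only: linear_cmul e_def)
  qed
  have bound: "cmod (D k x) \<le> C * 2 ^ ?N / (1 + norm x) ^ ?N" for k x
  proof -
    define \<delta> where "\<delta> = 1 / real (Suc k)"
    have \<delta>: "0 < \<delta>" "\<delta> \<le> 1" by (auto simp: \<delta>_def)
    have "norm (h (x + \<delta> *\<^sub>R e) - h (x + 0 *\<^sub>R e)) \<le> (C * 2 ^ ?N / (1 + norm x) ^ ?N) * norm (\<delta> - 0)"
    proof (rule differentiable_bound[where S = "{0..\<delta>}" and f = "\<lambda>s. h (x + s *\<^sub>R e)"])
      fix s assume s: "s \<in> {0..\<delta>}"
      show "((\<lambda>s. h (x + s *\<^sub>R e)) has_derivative (\<lambda>s'. s' *\<^sub>R partial_deriv i h (x + s *\<^sub>R e))) (at s within {0..\<delta>})"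
        using line[of x s "{0..\<delta>}"] by (simp only: has_vector_derivative_def)
      have "norm x \<le> norm (x + s *\<^sub>R e) + norm (s *\<^sub>R e)" by (metis add_diff_cancel norm_triangle_ineq4)
      then have "1 + norm x \<le> 2 * (1 + norm (x + s *\<^sub>R e))" using s \<delta> norm_e by simp (smt (verit) norm_ge_zero)
      then have "(1 + norm x) ^ ?N \<le> (2 * (1 + norm (x + s *\<^sub>R e))) ^ ?N" by (intro power_mono) auto
      then have le: "(1 + norm x) ^ ?N \<le> 2 ^ ?N * (1 + norm (x + s *\<^sub>R e)) ^ ?N" by (simp only: power_mult_distrib)
      have "C / (1 + norm (x + s *\<^sub>R e)) ^ ?N = C * 2 ^ ?N / (2 ^ ?N * (1 + norm (x + s *\<^sub>R e)) ^ ?N)" by simp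
      also have "\<dots> \<le> C * 2 ^ ?N / (1 + norm x) ^ ?N"
        using le \<open>0 \<le> C\<close> by (intro divide_left_mono mult_pos_pos) (simp_all del: power_Suc)
      finally have "norm (partial_deriv i h (x + s *\<^sub>R e)) \<le> C * 2 ^ ?N / (1 + norm x) ^ ?N"
        using C order_trans by blast
      from mult_right_mono[OF this norm_ge_zero[where 'a = real]]
      show "onorm (\<lambda>s'. s' *\<^sub>R partial_deriv i h (x + s *\<^sub>R e)) \<le> C * 2 ^ ?N / (1 + norm x) ^ ?N"
        by (intro onorm_le) (simp only: norm_scaleR real_norm_def mult.commute)
    qed (use \<delta> in auto)
    then have "norm (h (x + \<delta> *\<^sub>R e) - h x) \<le> (C * 2 ^ ?N / (1 + norm x) ^ ?N) * \<delta>" using \<delta> by simp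
    then have "real (Suc k) * norm (h (x + \<delta> *\<^sub>R e) - h x) \<le> real (Suc k) * ((C * 2 ^ ?N / (1 + norm x) ^ ?N) * \<delta>)"
      by (intro mult_left_mono) auto
    also have "\<dots> = C * 2 ^ ?N / (1 + norm x) ^ ?N" by (simp add: \<delta>_def del: of_nat_Suc)
    finally show ?thesis by (simp add: D_def \<delta>_def del: of_nat_Suc)
  qed
  have [measurable]: "h \<in> borel_measurable borel" "partial_deriv i h \<in> borel_measurable borel"
    using h sp by (auto intro: schwartz_measurable)
  have D0: "(\<integral>x. D k x \<partial>lborel) = 0" for k
  proof -
    have "integrable lborel h" by (rule schwartz_integrable[OF h])
    moreover have "(\<integral>x. h (x + v) \<partial>lborel) = (\<integral>x. h x \<partial>lborel)" for v
      using integral_lborel_affine[of h 1 v] by (simp add: add.commute)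
    moreover have "integrable lborel (\<lambda>x. h (x + v))" for v
    proof -
      have "integrable (distr lborel borel (\<lambda>x. v + x)) h"
        using \<open>integrable lborel h\<close> by (simp add: lborel_distr_plus)
      then show ?thesis by (simp add: integrable_distr_eq add.commute)
    qed
    ultimately show ?thesis by (simp add: D_def del: of_nat_Suc)
  qed
  have lim: "(\<lambda>k. D k x) \<longlonglongrightarrow> partial_deriv i h x" for x
  proof -
    have "((\<lambda>s. h (x + s *\<^sub>R e)) has_vector_derivative partial_deriv i h x) (at 0)" using line[of x 0 UNIV] by simp
    then have "((\<lambda>s. (1 / norm (s - 0)) *\<^sub>R (h (x + s *\<^sub>R e) - (h (x + 0 *\<^sub>R e) + (s - 0) *\<^sub>R partial_deriv i h x))) \<longlongrightarrow> 0) (at 0)"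
      unfolding has_vector_derivative_def has_derivative_at2 by blast
    moreover have "filterlim (\<lambda>k. 1 / real (Suc k)) (at 0) sequentially"
      unfolding filterlim_at using lim_1_over_n[THEN LIMSEQ_Suc] by (auto simp del: of_nat_Suc)
    ultimately have "(\<lambda>k. (1 / norm (1 / real (Suc k) - 0)) *\<^sub>R (h (x + (1 / real (Suc k)) *\<^sub>R e) - (h (x + 0 *\<^sub>R e)
        + (1 / real (Suc k) - 0) *\<^sub>R partial_deriv i h x))) \<longlonglongrightarrow> 0"
      by (rule filterlim_compose)
    moreover have "(1 / norm (1 / real (Suc k) - 0)) *\<^sub>R (h (x + (1 / real (Suc k)) *\<^sub>R e) - (h (x + 0 *\<^sub>R e)
        + (1 / real (Suc k) - 0) *\<^sub>R partial_deriv i h x)) = D k x - partial_deriv i h x" for k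
      unfolding D_def by (simp add: scaleR_diff_right scaleR_add_right algebra_simps del: of_nat_Suc)
    ultimately have "(\<lambda>k. D k x - partial_deriv i h x) \<longlonglongrightarrow> 0" by simp
    then show ?thesis by (rule LIM_zero_cancel)
  qed
  have "(\<lambda>k. \<integral>x. D k x \<partial>lborel) \<longlonglongrightarrow> (\<integral>x. partial_deriv i h x \<partial>lborel)"
  proof (rule integral_dominated_convergence)
    show "integrable lborel (\<lambda>x::real^'n. C * 2 ^ ?N / (1 + norm x) ^ ?N)"
    proof -
      have "integrable lborel (\<lambda>x::real^'n. complex_of_real (C * 2 ^ ?N / (1 + norm x) ^ ?N))"
      proof (rule integrable_decay[of _ ?N "C * 2 ^ ?N"])
        show "cmod (complex_of_real (C * 2 ^ ?N / (1 + norm x) ^ ?N)) \<le> C * 2 ^ ?N / (1 + norm x) ^ ?N" for x :: "real^'n"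
          unfolding norm_of_real using \<open>0 \<le> C\<close>
          by (subst abs_of_nonneg) (auto intro!: divide_nonneg_pos simp del: power_Suc)
      qed simp_all
      then show ?thesis by (simp only: complex_of_real_integrable_eq)
    qed
    show "AE x in lborel. norm (D k x) \<le> C * 2 ^ ?N / (1 + norm x) ^ ?N" for k
      using bound by blast
    show "D k \<in> borel_measurable lborel" for k unfolding D_def by measurable
  qed (use lim in auto)
  then show ?thesis using D0 LIMSEQ_unique[OF _ tendsto_const] by simp
qed

text \<open>Integration by parts: the derivative of cis(- xi . x) h(x) has integral 0, and the
  product rule splits it into the two transforms.\<close>

lemma fourier_partial_deriv:
  fixes h :: "real^'n \<Rightarrow> complex"
  assumes h: "schwartz h"
  shows "fourier (partial_deriv i h) \<xi> = \<i> * of_real (\<xi> $ i) * fourier h \<xi>"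
proof -
  let ?g = "\<lambda>x. cis (- \<xi> \<bullet> x) * h x"
  have sp: "schwartz (partial_deriv i h)" by (intro schwartz_partial_deriv h)
  have "partial_deriv i ?g x = (- \<i> * of_real (\<xi> $ i)) * (cis (- (x \<bullet> \<xi>)) * h x) + cis (- (x \<bullet> \<xi>)) * partial_deriv i h x" for x
    by (subst partial_deriv_eqI[OF has_derivative_mult[OF has_derivative_cis_inner schwartz_has_derivative[OF h]]])
      (simp add: partial_deriv_def inner_axis scaleR_conv_of_real inner_commute algebra_simps)
  then have "0 = (\<integral>x. (- \<i> * of_real (\<xi> $ i)) * (cis (- (x \<bullet> \<xi>)) * h x) + cis (- (x \<bullet> \<xi>)) * partial_deriv i h x \<partial>lborel)"
    using integral_partial_deriv_eq_0[OF schwartz_cis[OF h, of "- \<xi>"], of i] by simp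
  also have "\<dots> = (- \<i> * of_real (\<xi> $ i)) * fourier h \<xi> + fourier (partial_deriv i h) \<xi>"
    by (simp add: fourier_lborel schwartz_measurable h sp integrable_cis_mult schwartz_integrable)
  finally show ?thesis by (simp add: algebra_simps)
qed

text \<open>Decay is all that is asked of the transforms below. Differentiating N times in a single
  direction i gives |xi_i|^N |F h(xi)| <= \<open>B i N\<close>, and taking i to be the largest
  coordinate of xi turns |xi_i| into |xi| up to the factor n. Summing over i makes the constant
  independent of that choice.\<close>

lemma fourier_decay:
  fixes h :: "real^'n \<Rightarrow> complex"
  assumes h: "schwartz h"
  obtains C where "\<And>\<xi>. cmod (fourier h \<xi>) \<le> C / (1 + norm \<xi>) ^ N"
proof -
  have iter: "schwartz ((partial_deriv i ^^ k) h) \<and>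
      fourier ((partial_deriv i ^^ k) h) \<xi> = (\<i> * of_real (\<xi> $ i)) ^ k * fourier h \<xi>" for i k \<xi>
    by (induction k) (auto simp: h schwartz_partial_deriv fourier_partial_deriv)
  define B where "B i k = (\<integral>x. cmod ((partial_deriv i ^^ k) h x) \<partial>lborel)" for i k
  have B: "\<bar>\<xi> $ i\<bar> ^ k * cmod (fourier h \<xi>) \<le> B i k" for \<xi> i k
    using norm_fourier_le[OF schwartz_integrable, of "(partial_deriv i ^^ k) h" \<xi>] iter[of k i \<xi>]
    by (simp add: B_def norm_mult norm_power)
  have B_nonneg: "0 \<le> B i k" for i k by (simp add: B_def)
  define n where "n = real CARD('n)"
  have n: "n \<ge> 1" by (simp add: n_def)
  define A where "A = (\<Sum>i\<in>UNIV. B i 0 + B i N)"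
  have "cmod (fourier h \<xi>) \<le> (1 + n) ^ N * A / (1 + norm \<xi>) ^ N" for \<xi>
  proof -
    obtain i where i: "\<And>j. \<bar>\<xi> $ j\<bar> \<le> \<bar>\<xi> $ i\<bar>"
    proof -
      have "Max (range (\<lambda>j. \<bar>\<xi> $ j\<bar>)) \<in> range (\<lambda>j. \<bar>\<xi> $ j\<bar>)" by (intro Max_in) auto
      then obtain i where "Max (range (\<lambda>j. \<bar>\<xi> $ j\<bar>)) = \<bar>\<xi> $ i\<bar>" by blast
      then have "\<bar>\<xi> $ j\<bar> \<le> \<bar>\<xi> $ i\<bar>" for j by (metis Max_ge finite_class.finite_UNIV finite_imageI rangeI)
      then show ?thesis by (rule that)
    qed
    have "norm \<xi> \<le> (\<Sum>j\<in>UNIV. \<bar>\<xi> $ j\<bar>)" by (rule norm_le_l1_cart)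
    also have "\<dots> \<le> n * \<bar>\<xi> $ i\<bar>" unfolding n_def using sum_bounded_above[of UNIV "\<lambda>j. \<bar>\<xi> $ j\<bar>"] i by simp
    finally have le: "norm \<xi> \<le> n * \<bar>\<xi> $ i\<bar>" .
    then have "1 + norm \<xi> \<le> (1 + n) * max 1 \<bar>\<xi> $ i\<bar>"
    proof -
      have "n * \<bar>\<xi> $ i\<bar> \<le> n * max 1 \<bar>\<xi> $ i\<bar>" using n by (intro mult_left_mono) auto
      then show ?thesis using le by (simp add: distrib_right)
    qed
    then have "(1 + norm \<xi>) ^ N \<le> ((1 + n) * max 1 \<bar>\<xi> $ i\<bar>) ^ N" by (intro power_mono) auto
    then have "(1 + norm \<xi>) ^ N * cmod (fourier h \<xi>) \<le> ((1 + n) * max 1 \<bar>\<xi> $ i\<bar>) ^ N * cmod (fourier h \<xi>)"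
      by (intro mult_right_mono) auto
    also have "\<dots> = (1 + n) ^ N * (max 1 \<bar>\<xi> $ i\<bar> ^ N * cmod (fourier h \<xi>))" by (simp add: power_mult_distrib)
    also have "\<dots> \<le> (1 + n) ^ N * (B i 0 + B i N)"
    proof (intro mult_left_mono)
      show "max 1 \<bar>\<xi> $ i\<bar> ^ N * cmod (fourier h \<xi>) \<le> B i 0 + B i N"
        using B[of \<xi> i 0] B[of \<xi> i N] B_nonneg[of i 0] B_nonneg[of i N] by (auto simp: max_def)
    qed (use n in auto)
    also have "\<dots> \<le> (1 + n) ^ N * A"
    proof (intro mult_left_mono)
      show "B i 0 + B i N \<le> A" unfolding A_def
        by (rule member_le_sum) (auto simp: B_nonneg)
    qed (use n in auto)
    finally show ?thesis by (subst le_divide_eq) (simp add: mult.commute)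
  qed
  then show ?thesis by (rule that)
qed

lemma fourier_measurable:
  fixes h :: "real^'n \<Rightarrow> complex"
  assumes "h \<in> borel_measurable borel"
  shows "fourier h \<in> borel_measurable borel"
proof -
  note [measurable] = assms
  have "(\<lambda>\<xi>. \<integral>x. cis (- (x \<bullet> \<xi>)) * h x \<partial>lborel) \<in> borel_measurable borel"
    by (intro lborel.borel_measurable_lebesgue_integral) simp
  moreover have "fourier h = (\<lambda>\<xi>. \<integral>x. cis (- (x \<bullet> \<xi>)) * h x \<partial>lborel)"
    by (rule ext) (rule fourier_lborel[OF assms])
  ultimately show ?thesis by simp
qed

lemma fourier_integrable:
  fixes h :: "real^'n \<Rightarrow> complex"
  assumes "schwartz h"
  shows "integrable lborel (fourier h)"
proof -
  obtain C where "\<And>\<xi>. cmod (fourier h \<xi>) \<le> C / (1 + norm \<xi>) ^ (Suc CARD('n))"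
    using fourier_decay[OF assms] by blast
  then show ?thesis
    by (intro integrable_decay[of _ "Suc CARD('n)" C] fourier_measurable schwartz_measurable assms) auto
qed

lemma fourier_multiplication_formula:
  fixes h g :: "real^'n \<Rightarrow> complex"
  assumes h: "integrable lborel h" and g: "integrable lborel g"
  shows "(\<integral>x. fourier h x * g x \<partial>lborel) = (\<integral>x. h x * fourier g x \<partial>lborel)"
proof -
  have hm: "h \<in> borel_measurable borel" and gm: "g \<in> borel_measurable borel"
    using borel_measurable_integrable[OF h] borel_measurable_integrable[OF g] by simp_all
  note [measurable] = hm gm
  let ?F = "\<lambda>(\<xi>, x). cis (- (\<xi> \<bullet> x)) * h \<xi> * g x"
  have int: "integrable (lborel \<Otimes>\<^sub>M lborel) ?F"
  proof (rule integrableI_bounded)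
    show "?F \<in> borel_measurable (lborel \<Otimes>\<^sub>M lborel)" by simp
    have "(\<integral>\<^sup>+z. ennreal (norm (?F z)) \<partial>(lborel \<Otimes>\<^sub>M lborel))
        = (\<integral>\<^sup>+\<xi>. \<integral>\<^sup>+x. ennreal (cmod (h \<xi>)) * ennreal (cmod (g x)) \<partial>lborel \<partial>lborel)"
      by (subst lborel.nn_integral_fst[symmetric]) (simp_all add: norm_mult ennreal_mult)
    also have "\<dots> = (\<integral>\<^sup>+\<xi>. ennreal (cmod (h \<xi>)) \<partial>lborel) * (\<integral>\<^sup>+x. ennreal (cmod (g x)) \<partial>lborel)"
      by (simp add: nn_integral_cmult nn_integral_multc)
    also have "\<dots> < \<infinity>" using h g by (simp add: integrable_iff_bounded ennreal_mult_less_top)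
    finally show "(\<integral>\<^sup>+z. ennreal (norm (?F z)) \<partial>(lborel \<Otimes>\<^sub>M lborel)) < \<infinity>" .
  qed
  have "(\<integral>x. fourier h x * g x \<partial>lborel) = (\<integral>x. (\<integral>\<xi>. cis (- (\<xi> \<bullet> x)) * h \<xi> * g x \<partial>lborel) \<partial>lborel)"
    by (simp add: fourier_lborel hm)
  also have "\<dots> = (\<integral>\<xi>. (\<integral>x. cis (- (\<xi> \<bullet> x)) * h \<xi> * g x \<partial>lborel) \<partial>lborel)"
    using lborel_pair.Fubini_integral[OF int] by simp
  also have "\<dots> = (\<integral>\<xi>. h \<xi> * fourier g \<xi> \<partial>lborel)"
  proof (rule Bochner_Integration.integral_cong)
    fix \<xi> :: "real^'n"
    have "(\<integral>x. cis (- (\<xi> \<bullet> x)) * h \<xi> * g x \<partial>lborel) = (\<integral>x. h \<xi> * (cis (- (x \<bullet> \<xi>)) * g x) \<partial>lborel)"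
      by (simp add: inner_commute mult_ac)
    also have "\<dots> = h \<xi> * fourier g \<xi>" by (simp add: fourier_lborel gm)
    finally show "(\<integral>x. cis (- (\<xi> \<bullet> x)) * h \<xi> * g x \<partial>lborel) = h \<xi> * fourier g \<xi>" .
  qed simp
  finally show ?thesis .
qed

text \<open>Modulation by \<open>y\<close> and dilation by \<open>t\<close> of the symbol move the
  kernel to centre \<open>y\<close> and scale \<open>t\<close>. The value is given at y + t x
  because that is the point reached by the substitution in the averages.\<close>

lemma fourier_dilation:
  fixes h :: "real^'n \<Rightarrow> complex"
  assumes hm: "h \<in> borel_measurable borel" and t: "t > 0"
  shows "fourier (\<lambda>\<xi>. cis (y \<bullet> \<xi>) * h (t *\<^sub>R \<xi>)) (y + t *\<^sub>R x) = of_real (1 / t ^ CARD('n)) * fourier h x"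
proof -
  note [measurable] = hm
  have "fourier h x = (\<integral>\<xi>. cis (- (\<xi> \<bullet> x)) * h \<xi> \<partial>lborel)" by (simp add: fourier_lborel hm)
  also have "\<dots> = of_real (\<bar>t\<bar> ^ CARD('n)) * (\<integral>\<xi>. cis (- ((0 + t *\<^sub>R \<xi>) \<bullet> x)) * h (0 + t *\<^sub>R \<xi>) \<partial>lborel)"
    using t by (intro integral_lborel_affine) auto
  also have "(\<integral>\<xi>. cis (- ((0 + t *\<^sub>R \<xi>) \<bullet> x)) * h (0 + t *\<^sub>R \<xi>) \<partial>lborel)
      = (\<integral>\<xi>. cis (- (\<xi> \<bullet> (y + t *\<^sub>R x))) * (cis (y \<bullet> \<xi>) * h (t *\<^sub>R \<xi>)) \<partial>lborel)"
    by (simp add: cis_mult inner_add_right inner_commute flip: mult.assoc)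
  also have "\<dots> = fourier (\<lambda>\<xi>. cis (y \<bullet> \<xi>) * h (t *\<^sub>R \<xi>)) (y + t *\<^sub>R x)" by (simp add: fourier_lborel)
  finally show ?thesis using t by simp
qed

section \<open>The Gaussian and Fourier inversion at the origin\<close>

definition gaussian :: "real^'n \<Rightarrow> complex" where
  "gaussian x = of_real (exp (- (norm x)\<^sup>2 / 2))"

text \<open>Fubini for tensor products, \<open>lborel\<close> being an image of the product measure;
  it reduces the Gaussian to one dimension.\<close>

lemma integral_lborel_prod_Basis:
  fixes f :: "'a::euclidean_space \<Rightarrow> real \<Rightarrow> complex"
  assumes f: "\<And>b. b \<in> Basis \<Longrightarrow> integrable lborel (f b)"
  shows "integrable lborel (\<lambda>x. \<Prod>b\<in>Basis. f b (x \<bullet> b))" (is ?int)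
    and "(\<integral>x. (\<Prod>b\<in>Basis. f b (x \<bullet> b)) \<partial>lborel) = (\<Prod>b\<in>Basis. \<integral>x. f b x \<partial>lborel)" (is ?eq)
proof -
  interpret product_sigma_finite "\<lambda>_::'a. lborel :: real measure" ..
  have [measurable]: "b \<in> Basis \<Longrightarrow> f b \<in> borel_measurable borel" for b
    using borel_measurable_integrable[OF f] by simp
  have meas: "(\<lambda>x. \<Prod>b\<in>Basis. f b (x \<bullet> b)) \<in> borel_measurable borel" by measurable
  have [measurable]: "(\<lambda>g. \<Sum>b\<in>Basis. g b *\<^sub>R b) \<in> measurable (\<Pi>\<^sub>M b\<in>Basis. lborel) (borel :: 'a measure)"
    by measurable
  have *: "(\<Prod>b\<in>Basis. f b ((\<Sum>c\<in>Basis. g c *\<^sub>R c) \<bullet> b)) = (\<Prod>b\<in>Basis. f b (g b))" for g :: "'a \<Rightarrow> real"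
    by (intro prod.cong refl) simp
  have "integrable (\<Pi>\<^sub>M b\<in>Basis. lborel) (\<lambda>g. \<Prod>b\<in>Basis. f b (g b))"
    using f by (intro product_integrable_prod) auto
  then show ?int
    by (subst lborel_eq, subst integrable_distr_eq) (use meas in \<open>simp_all add: *\<close>)
  have "(\<integral>x. (\<Prod>b\<in>Basis. f b (x \<bullet> b)) \<partial>lborel) = (\<integral>g. (\<Prod>b\<in>Basis. f b (g b)) \<partial>(\<Pi>\<^sub>M b\<in>Basis. lborel))"
    by (subst lborel_eq, subst integral_distr) (use meas in \<open>simp_all add: *\<close>)
  also have "\<dots> = (\<Prod>b\<in>Basis. \<integral>x. f b x \<partial>lborel)"
    using f by (intro product_integral_prod) auto
  finally show ?eq .
qed

text \<open>Read off from the characteristic function of the standard normal distribution at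
  -t.\<close>

lemma gaussian_1d:
  "integrable lborel (\<lambda>x. cis (- (x * t)) * complex_of_real (exp (- x\<^sup>2 / 2)))"
  "(\<integral>x. cis (- (x * t)) * complex_of_real (exp (- x\<^sup>2 / 2)) \<partial>lborel) = of_real (sqrt (2 * pi) * exp (- t\<^sup>2 / 2))"
proof -
  have dens: "exp (- x\<^sup>2 / 2) = sqrt (2 * pi) * std_normal_density x" for x
    by (simp add: std_normal_density_def)
  have "integrable lborel (\<lambda>x. complex_of_real (exp (- x\<^sup>2 / 2)))"
    unfolding dens complex_of_real_integrable_eq using integrable_std_normal_moment[of 0] by simp
  then show "integrable lborel (\<lambda>x. cis (- (x * t)) * complex_of_real (exp (- x\<^sup>2 / 2)))"
    by (rule Bochner_Integration.integrable_bound) (auto simp: norm_mult)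
  have "complex_of_real (exp (- (- t)\<^sup>2 / 2)) = char std_normal_distribution (- t)"
    by (simp add: char_std_normal_distribution)
  also have "\<dots> = (\<integral>x. std_normal_density x *\<^sub>R iexp (- t * x) \<partial>lborel)"
    unfolding char_def by (subst integral_density) auto
  finally have "(\<integral>x. std_normal_density x *\<^sub>R iexp (- t * x) \<partial>lborel) = of_real (exp (- t\<^sup>2 / 2))" by simp
  moreover have "cis (- (x * t)) * complex_of_real (exp (- x\<^sup>2 / 2))
      = complex_of_real (sqrt (2 * pi)) * (std_normal_density x *\<^sub>R iexp (- t * x))" for x
    unfolding dens by (simp add: cis_conv_exp scaleR_conv_of_real mult_ac)
  ultimately show "(\<integral>x. cis (- (x * t)) * complex_of_real (exp (- x\<^sup>2 / 2)) \<partial>lborel) = of_real (sqrt (2 * pi) * exp (- t\<^sup>2 / 2))"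
    by (simp only: integral_mult_right_zero of_real_mult)
qed

lemma gaussian_prod:
  fixes x \<xi> :: "real^'n"
  shows "cis (- (x \<bullet> \<xi>)) * gaussian x
    = (\<Prod>b\<in>Basis. cis (- ((x \<bullet> b) * (\<xi> \<bullet> b))) * complex_of_real (exp (- (x \<bullet> b)\<^sup>2 / 2)))"
proof -
  have "cis (- (x \<bullet> \<xi>)) = (\<Prod>b\<in>Basis. cis (- ((x \<bullet> b) * (\<xi> \<bullet> b))))"
    by (subst euclidean_inner[of x]) (simp add: cis_conv_exp exp_sum sum_distrib_left flip: sum_negf)
  moreover have "gaussian x = (\<Prod>b\<in>Basis. complex_of_real (exp (- (x \<bullet> b)\<^sup>2 / 2)))"
    unfolding gaussian_def power2_norm_eq_inner
    by (subst euclidean_inner[of x]) (simp add: sum_divide_distrib power2_eq_square flip: exp_sum sum_negf of_real_prod)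
  ultimately show ?thesis by (simp add: prod.distrib)
qed

lemma gaussian_integrable: "integrable lborel (gaussian :: real^'n \<Rightarrow> complex)"
  using integral_lborel_prod_Basis(1)[OF gaussian_1d(1)[of 0], where 'a = "real^'n"]
    gaussian_prod[of _ "0 :: real^'n", abs_def] by (simp cong: Bochner_Integration.integrable_cong)

lemma fourier_gaussian:
  fixes \<xi> :: "real^'n"
  shows "fourier gaussian \<xi> = of_real (sqrt (2 * pi) ^ CARD('n)) * gaussian \<xi>"
proof -
  have m: "gaussian \<in> borel_measurable (borel :: (real^'n) measure)"
    using borel_measurable_integrable[OF gaussian_integrable] by simp
  have "fourier gaussian \<xi> = (\<integral>x. (\<Prod>b\<in>Basis. cis (- ((x \<bullet> b) * (\<xi> \<bullet> b))) * complex_of_real (exp (- (x \<bullet> b)\<^sup>2 / 2))) \<partial>lborel)"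
    unfolding fourier_lborel[OF m] gaussian_prod ..
  also have "\<dots> = (\<Prod>b\<in>(Basis :: (real^'n) set). of_real (sqrt (2 * pi) * exp (- (\<xi> \<bullet> b)\<^sup>2 / 2)))"
    by (subst integral_lborel_prod_Basis(2)[OF gaussian_1d(1)]) (simp only: gaussian_1d(2))
  also have "\<dots> = of_real (sqrt (2 * pi) ^ CARD('n)) * gaussian \<xi>"
    using gaussian_prod[of \<xi> 0] by (simp add: prod.distrib)
  finally show ?thesis .
qed

text \<open>Insert the factor g(eps x) with g the Gaussian, move the transform to g by the
  multiplication formula, and let eps tend to 0. The number \<open>\<kappa>\<close> occurs twice, as
  the factor in the transform of g and as the integral of g, and its square is (2 pi)^n. The lemma
  yields the means of the low-pass and band-pass kernels.\<close>

lemma integral_fourier: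
  fixes h :: "real^'n \<Rightarrow> complex"
  assumes h: "schwartz h"
  shows "(\<integral>x. fourier h x \<partial>lborel) = of_real ((2 * pi) ^ CARD('n)) * h 0"
proof -
  define \<kappa> where "\<kappa> = complex_of_real (sqrt (2 * pi) ^ CARD('n))"
  define \<epsilon> where "\<epsilon> k = 1 / real (Suc k)" for k
  have \<epsilon>: "\<epsilon> k > 0" for k by (simp add: \<epsilon>_def)
  have \<epsilon>_lim: "\<epsilon> \<longlonglongrightarrow> 0" unfolding \<epsilon>_def using lim_1_over_n[THEN LIMSEQ_Suc] by simp
  have hm: "h \<in> borel_measurable borel" by (rule schwartz_measurable[OF h])
  have fm: "fourier h \<in> borel_measurable borel" by (rule fourier_measurable[OF hm])
  have gm: "gaussian \<in> borel_measurable (borel :: (real^'n) measure)"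
    using borel_measurable_integrable[OF gaussian_integrable] by simp
  note [measurable] = hm fm gm
  have g_lim: "(\<lambda>k. gaussian (\<epsilon> k *\<^sub>R x)) \<longlonglongrightarrow> 1" for x :: "real^'n"
  proof -
    have "(\<lambda>k. gaussian (\<epsilon> k *\<^sub>R x)) \<longlonglongrightarrow> of_real (exp (- (norm (0 *\<^sub>R x))\<^sup>2 / 2))"
      unfolding gaussian_def by (intro tendsto_intros \<epsilon>_lim) simp
    then show ?thesis by simp
  qed
  have h_lim: "(\<lambda>k. h (\<epsilon> k *\<^sub>R x)) \<longlonglongrightarrow> h 0" for x
  proof -
    have "isCont h (0 *\<^sub>R x)" using schwartz_continuous[OF h] by (simp add: continuous_on_eq_continuous_at)
    moreover have "(\<lambda>k. \<epsilon> k *\<^sub>R x) \<longlonglongrightarrow> 0 *\<^sub>R x" by (intro tendsto_intros \<epsilon>_lim)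
    ultimately show ?thesis using isCont_tendsto_compose by fastforce
  qed
  have eq: "(\<integral>x. fourier h x * gaussian (\<epsilon> k *\<^sub>R x) \<partial>lborel) = \<kappa> * (\<integral>x. h (\<epsilon> k *\<^sub>R x) * gaussian x \<partial>lborel)" for k
  proof -
    let ?h = "\<lambda>x. h (\<epsilon> k *\<^sub>R x)"
    have hs: "schwartz ?h" using \<epsilon>[of k] by (intro schwartz_dilation h) simp
    have "fourier ?h (0 + \<epsilon> k *\<^sub>R x) = of_real (1 / \<epsilon> k ^ CARD('n)) * fourier h x" for x
      using fourier_dilation[OF hm \<epsilon>, of 0 k x] by simp
    then have "(\<integral>x. fourier h x * gaussian (\<epsilon> k *\<^sub>R x) \<partial>lborel)
        = (\<integral>x. of_real (\<epsilon> k ^ CARD('n)) * (fourier ?h (0 + \<epsilon> k *\<^sub>R x) * gaussian (0 + \<epsilon> k *\<^sub>R x)) \<partial>lborel)"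
      using \<epsilon>[of k] by (simp add: field_simps)
    also have "\<dots> = (\<integral>x. fourier ?h x * gaussian x \<partial>lborel)"
      using \<epsilon>[of k] fourier_measurable[of ?h]
      by (subst integral_lborel_affine[of "\<lambda>x. fourier ?h x * gaussian x" "\<epsilon> k" 0]) auto
    also have "\<dots> = (\<integral>x. ?h x * fourier gaussian x \<partial>lborel)"
      by (intro fourier_multiplication_formula schwartz_integrable gaussian_integrable hs)
    also have "\<dots> = (\<integral>x. \<kappa> * (?h x * gaussian x) \<partial>lborel)"
      by (simp add: fourier_gaussian \<kappa>_def mult_ac)
    also have "\<dots> = \<kappa> * (\<integral>x. ?h x * gaussian x \<partial>lborel)" by (simp only: integral_mult_right_zero)
    finally show ?thesis .
  qed
  have "(\<lambda>k. \<integral>x. fourier h x * gaussian (\<epsilon> k *\<^sub>R x) \<partial>lborel) \<longlonglongrightarrow> (\<integral>x. fourier h x * 1 \<partial>lborel)"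
  proof (rule integral_dominated_convergence[where w = "\<lambda>x. cmod (fourier h x)"])
    show "integrable lborel (\<lambda>x. cmod (fourier h x))" by (intro integrable_norm fourier_integrable h)
    show "AE x in lborel. norm (fourier h x * gaussian (\<epsilon> k *\<^sub>R x)) \<le> cmod (fourier h x)" for k
      by (auto simp: norm_mult gaussian_def intro!: mult_left_le)
    show "AE x in lborel. (\<lambda>k. fourier h x * gaussian (\<epsilon> k *\<^sub>R x)) \<longlonglongrightarrow> fourier h x * 1"
      by (intro always_eventually allI tendsto_intros g_lim)
  qed auto
  moreover have "(\<lambda>k. \<integral>x. h (\<epsilon> k *\<^sub>R x) * gaussian x \<partial>lborel) \<longlonglongrightarrow> (\<integral>x. h 0 * gaussian (x :: real^'n) \<partial>lborel)"
  proof -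
    obtain C where C: "\<And>x. cmod (h x) \<le> C" using rapidly_decreasingE[OF schwartzD(2)[OF h], of 0] by auto
    show ?thesis
    proof (rule integral_dominated_convergence[where w = "\<lambda>x. C * cmod (gaussian x)"])
      show "integrable lborel (\<lambda>x. C * cmod (gaussian (x :: real^'n)))"
        by (intro integrable_mult_right integrable_norm gaussian_integrable)
      show "AE x in lborel. norm (h (\<epsilon> k *\<^sub>R x) * gaussian x) \<le> C * cmod (gaussian x)" for k
        by (auto simp: norm_mult intro!: mult_right_mono C)
      show "AE x in lborel. (\<lambda>k. h (\<epsilon> k *\<^sub>R x) * gaussian x) \<longlonglongrightarrow> h 0 * gaussian x"
        by (intro always_eventually allI tendsto_intros h_lim)
    qed auto
  qed
  ultimately have "(\<integral>x. fourier h x * 1 \<partial>lborel) = \<kappa> * (\<integral>x. h 0 * gaussian (x :: real^'n) \<partial>lborel)"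
    unfolding eq using LIMSEQ_unique tendsto_mult_left by blast
  moreover have "(\<integral>x. gaussian (x :: real^'n) \<partial>lborel) = \<kappa>"
    using fourier_gaussian[of "0 :: real^'n"] unfolding fourier_lborel[OF gm] \<kappa>_def
    by (simp add: gaussian_def)
  moreover have "\<kappa> * \<kappa> = of_real ((2 * pi) ^ CARD('n))"
    unfolding \<kappa>_def of_real_mult[symmetric] power_mult_distrib[symmetric] by simp
  ultimately show ?thesis by (simp add: mult_ac)
qed

section \<open>Oscillation and the Q-norm\<close>

lemma enn_powr_le_iff:
  assumes "p > 0" "\<Lambda> \<ge> 0"
  shows "enn_powr t (1 / p) \<le> ennreal \<Lambda> \<longleftrightarrow> t \<le> ennreal (\<Lambda> powr p)"
proof (cases t rule: ennreal_cases)
  case (real r)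
  have "r powr (1 / p) \<le> \<Lambda> \<longleftrightarrow> r \<le> \<Lambda> powr p"
  proof
    assume "r powr (1 / p) \<le> \<Lambda>"
    then have "(r powr (1 / p)) powr p \<le> \<Lambda> powr p" using assms by (intro powr_mono2) auto
    then show "r \<le> \<Lambda> powr p" using real assms by (simp add: powr_powr)
  next
    assume "r \<le> \<Lambda> powr p"
    then have "r powr (1 / p) \<le> (\<Lambda> powr p) powr (1 / p)" using real assms by (intro powr_mono2) auto
    then show "r powr (1 / p) \<le> \<Lambda>" using assms by (simp add: powr_powr)
  qed
  then show ?thesis using real assms by (simp add: enn_powr_def ennreal_le_iff)
qed (simp add: enn_powr_def top_unique)

lemma Q_norm_le_iff:
  fixes f :: "real^'n \<Rightarrow> complex"
  assumes "\<Lambda> \<ge> 0"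
  shows "Q_norm \<alpha> f \<le> ennreal \<Lambda> \<longleftrightarrow> (\<forall>a l. l > 0 \<longrightarrow>
    ennreal (l powr (2 * \<alpha> - real CARD('n))) *
      (\<integral>\<^sup>+x\<in>cube a l. (\<integral>\<^sup>+y\<in>cube a l.
        ennreal ((cmod (f x - f y))\<^sup>2 / norm (x - y) powr (real CARD('n) + 2 * \<alpha>)) \<partial>lborel) \<partial>lborel)
    \<le> ennreal (\<Lambda>\<^sup>2))"
proof -
  have "enn_powr X (1 / 2) \<le> ennreal \<Lambda> \<longleftrightarrow> X \<le> ennreal (\<Lambda>\<^sup>2)" for X
    using enn_powr_le_iff[of 2 \<Lambda> X] assms by (cases "\<Lambda> = 0") (simp_all add: powr_numeral)
  then show ?thesis unfolding Q_norm_def SUP_le_iff nn_integral_completion by auto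
qed

text \<open>Integrate |f x - f y| <= |f x - f z| + |f y - f z| over z in T. Control of f between S
  and a distant set T thus becomes control within S.\<close>

lemma oscillation_triangle:
  fixes f :: "real^'n \<Rightarrow> complex"
  assumes [measurable]: "f \<in> borel_measurable borel" "S \<in> sets borel" "T \<in> sets borel"
  shows "(\<integral>\<^sup>+x\<in>S. (\<integral>\<^sup>+y\<in>S. ennreal (cmod (f x - f y)) \<partial>lborel) \<partial>lborel) * emeasure lborel T
    \<le> 2 * emeasure lborel S * (\<integral>\<^sup>+x\<in>S. (\<integral>\<^sup>+z\<in>T. ennreal (cmod (f x - f z)) \<partial>lborel) \<partial>lborel)"
proof -
  define G where "G x = (\<integral>\<^sup>+z\<in>T. ennreal (cmod (f x - f z)) \<partial>lborel)" for x
  have G [measurable]: "G \<in> borel_measurable borel" unfolding G_def by measurable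
  have *: "ennreal (cmod (f x - f y)) * emeasure lborel T \<le> G x + G y" for x y
  proof -
    have "ennreal (cmod (f x - f y)) * emeasure lborel T = (\<integral>\<^sup>+z\<in>T. ennreal (cmod (f x - f y)) \<partial>lborel)"
      by (simp add: nn_integral_cmult_indicator)
    also have "\<dots> \<le> (\<integral>\<^sup>+z. ennreal (cmod (f x - f z)) * indicator T z + ennreal (cmod (f y - f z)) * indicator T z \<partial>lborel)"
    proof (rule nn_integral_mono)
      fix z
      have "cmod (f x - f y) \<le> cmod (f x - f z) + cmod (f y - f z)"
        using norm_triangle_ineq4[of "f x - f z" "f y - f z"] by simp
      then show "ennreal (cmod (f x - f y)) * indicator T z
          \<le> ennreal (cmod (f x - f z)) * indicator T z + ennreal (cmod (f y - f z)) * indicator T z"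
        by (auto split: split_indicator simp: ennreal_plus[symmetric] ennreal_leI simp del: ennreal_plus)
    qed
    also have "\<dots> = G x + G y" unfolding G_def by (rule nn_integral_add) measurable
    finally show ?thesis .
  qed
  have "(\<integral>\<^sup>+x\<in>S. (\<integral>\<^sup>+y\<in>S. ennreal (cmod (f x - f y)) \<partial>lborel) \<partial>lborel) * emeasure lborel T
      = (\<integral>\<^sup>+x\<in>S. (\<integral>\<^sup>+y\<in>S. ennreal (cmod (f x - f y)) * emeasure lborel T \<partial>lborel) \<partial>lborel)"
  proof -
    have "(\<integral>\<^sup>+y\<in>S. ennreal (cmod (f x - f y)) * emeasure lborel T \<partial>lborel)
        = (\<integral>\<^sup>+y\<in>S. ennreal (cmod (f x - f y)) \<partial>lborel) * emeasure lborel T" for x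
      by (subst nn_integral_multc[symmetric]) (simp_all add: ac_simps)
    then show ?thesis by (subst nn_integral_multc[symmetric]) (simp_all add: ac_simps)
  qed
  also have "\<dots> \<le> (\<integral>\<^sup>+x\<in>S. (\<integral>\<^sup>+y\<in>S. G x + G y \<partial>lborel) \<partial>lborel)"
    using * by (intro nn_integral_mono mult_right_mono) auto
  also have "\<dots> = (\<integral>\<^sup>+x\<in>S. G x * emeasure lborel S + (\<integral>\<^sup>+y\<in>S. G y \<partial>lborel) \<partial>lborel)"
    by (simp add: distrib_right nn_integral_add nn_integral_cmult_indicator)
  also have "\<dots> = (\<integral>\<^sup>+x\<in>S. G x \<partial>lborel) * emeasure lborel S + (\<integral>\<^sup>+y\<in>S. G y \<partial>lborel) * emeasure lborel S"
  proof -
    have "(\<integral>\<^sup>+x. G x * emeasure lborel S * indicator S x \<partial>lborel) = (\<integral>\<^sup>+x. G x * indicator S x * emeasure lborel S \<partial>lborel)"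
      by (simp add: ac_simps)
    also have "\<dots> = (\<integral>\<^sup>+x\<in>S. G x \<partial>lborel) * emeasure lborel S" by (rule nn_integral_multc) measurable
    finally show ?thesis by (simp add: distrib_right nn_integral_add nn_integral_cmult_indicator)
  qed
  also have "\<dots> = 2 * emeasure lborel S * (\<integral>\<^sup>+x\<in>S. G x \<partial>lborel)"
    by (simp add: mult_2 distrib_right ac_simps)
  finally show ?thesis unfolding G_def .
qed

text \<open>The weight \<open>|x - y|\<^sup>-\<^sup>n\<^sup>-\<^sup>2\<^sup>\<alpha>\<close> is bounded below by a multiple of \<open>l\<^sup>-\<^sup>n\<^sup>-\<^sup>2\<^sup>\<alpha>\<close>, uniformly in \<open>\<alpha> < 1\<close>,
  only on pairs at distance between \<open>l\<close> and \<open>\<surd>n l\<close>: when \<open>\<alpha>\<close> tends to minus infinity the part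
  \<open>|x - y| < l\<close> is lost. In dimension at least 2, opposite corners of the cube are that far apart.\<close>

lemma opposite_corner_distance:
  fixes x y a :: "real^'n"
  assumes n: "CARD('n) \<ge> 2" and r: "r > 0"
    and x: "x \<in> cube a r" and y: "y \<in> cube (a + (\<chi> i. 7 * r)) r"
  shows "8 * r \<le> norm (x - y)" "norm (x - y) \<le> sqrt (real CARD('n)) * (8 * r)"
proof -
  have comp: "6 * r \<le> \<bar>(x - y) $ i\<bar> \<and> \<bar>(x - y) $ i\<bar> \<le> 8 * r" for i
    using x[unfolded cube_def] y[unfolded cube_def] r by (auto dest!: spec[of _ i])
  have sq: "(norm (x - y))\<^sup>2 = (\<Sum>i\<in>UNIV. ((x - y) $ i)\<^sup>2)"
    unfolding norm_vec_def L2_set_def by (simp add: sum_nonneg)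
  have lo: "(6 * r)\<^sup>2 \<le> ((x - y) $ i)\<^sup>2" and hi: "((x - y) $ i)\<^sup>2 \<le> (8 * r)\<^sup>2" for i
    using power_mono[of "6 * r" "\<bar>(x - y) $ i\<bar>" 2] power_mono[of "\<bar>(x - y) $ i\<bar>" "8 * r" 2] comp[of i] r
    by simp_all
  \<comment> \<open>Since 64 <= 72: two coordinates, each differing by at least 6r, already give
    distance 8r, the edge of the large cube. Corner cubes of an eighth of that edge are small enough
    for this.\<close>
  have "(8 * r)\<^sup>2 \<le> 2 * (6 * r)\<^sup>2" by (simp add: power_mult_distrib)
  also have "\<dots> \<le> real CARD('n) * (6 * r)\<^sup>2" using n by (intro mult_right_mono) auto
  also have "\<dots> \<le> (norm (x - y))\<^sup>2"
    unfolding sq using sum_bounded_below[of UNIV "(6 * r)\<^sup>2" "\<lambda>i. ((x - y) $ i)\<^sup>2"] lo by simp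
  finally show "8 * r \<le> norm (x - y)" by (rule power2_le_imp_le) simp
  have "(norm (x - y))\<^sup>2 \<le> real CARD('n) * (8 * r)\<^sup>2"
    unfolding sq using sum_bounded_above[of UNIV "\<lambda>i. ((x - y) $ i)\<^sup>2" "(8 * r)\<^sup>2"] hi by simp
  also have "\<dots> = (sqrt (real CARD('n)) * (8 * r))\<^sup>2" by (simp add: power_mult_distrib)
  finally show "norm (x - y) \<le> sqrt (real CARD('n)) * (8 * r)"
    by (rule power2_le_imp_le) (use r in simp)
qed

text \<open>A nonnegative exponent uses the upper bound on d and n + 2\<alpha> <= n + 2, a negative
  one uses the lower bound d >= l. The resulting factor is free of \<alpha>.\<close>

lemma weight_upper_bound:
  assumes "1 \<le> n" "\<alpha> < 1" "0 < l" "l \<le> d" "d \<le> sqrt n * l"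
  shows "d powr (n + 2 * \<alpha>) \<le> sqrt n powr (n + 2) * l powr (n + 2 * \<alpha>)"
proof (cases "n + 2 * \<alpha> \<ge> 0")
  case True
  then have "d powr (n + 2 * \<alpha>) \<le> (sqrt n * l) powr (n + 2 * \<alpha>)" using assms by (intro powr_mono2) auto
  also have "\<dots> = sqrt n powr (n + 2 * \<alpha>) * l powr (n + 2 * \<alpha>)" by (rule powr_mult)
  also have "\<dots> \<le> sqrt n powr (n + 2) * l powr (n + 2 * \<alpha>)"
    using assms by (intro mult_right_mono powr_mono) auto
  finally show ?thesis .
next
  case False
  then have "d powr (n + 2 * \<alpha>) \<le> 1 * l powr (n + 2 * \<alpha>)" using assms by (simp add: powr_mono2')
  also have "\<dots> \<le> sqrt n powr (n + 2) * l powr (n + 2 * \<alpha>)"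
    using assms by (intro mult_right_mono ge_one_powr_ge_zero) auto
  finally show ?thesis .
qed

text \<open>The summand 1 is the constant term of \<open>le_add_powr\<close>, the power of
  \<open>sqrt n\<close> comes from \<open>weight_upper_bound\<close>, 8^(2n) from the passage to the
  cube of edge 8r, and the outer 2 from \<open>oscillation_triangle\<close>.\<close>

definition osc_const :: "nat \<Rightarrow> real" where
  "osc_const n = 2 * (1 + sqrt (real n) powr (real n + 2) * 8 ^ (2 * n))"

text \<open>A bound of BMO type in which \<alpha> no longer appears on the right. The cube
  \<open>J\<close> is compared with the opposite corner \<open>J'\<close> of the cube
  \<open>I\<close> of edge 8r; on \<open>J\<close> x \<open>J'\<close> the weight is bounded below,
  and the weighted integral over \<open>I\<close> x \<open>I\<close> is controlled by the
  Q-norm.\<close>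

lemma oscillation_le_Q_norm:
  fixes f :: "real^'n \<Rightarrow> complex"
  assumes n: "CARD('n) \<ge> 2" and \<alpha>: "\<alpha> < 1" and f [measurable]: "f \<in> borel_measurable borel"
    and \<Lambda>: "\<Lambda> > 0" "Q_norm \<alpha> f \<le> ennreal \<Lambda>" and r: "r > 0"
  shows "(\<integral>\<^sup>+x\<in>cube a r. (\<integral>\<^sup>+y\<in>cube a r. ennreal (cmod (f x - f y)) \<partial>lborel) \<partial>lborel)
    \<le> ennreal (osc_const CARD('n) * r ^ (2 * CARD('n)) * \<Lambda>)"
proof -
  define N where "N = real CARD('n)"
  define l where "l = 8 * r"
  define J where "J = cube a r"
  define J' where "J' = cube (a + (\<chi> i. 7 * r)) r"
  define I where "I = cube a l"
  define K where "K = sqrt N powr (N + 2)"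
  define m where "m = ennreal (r ^ CARD('n))"
  have l: "l > 0" using r by (simp add: l_def)
  have K: "K \<ge> 0" by (simp add: K_def)
  have [measurable]: "J \<in> sets borel" "J' \<in> sets borel" "I \<in> sets borel" by (simp_all add: J_def J'_def I_def)
  have sub: "J \<subseteq> I" "J' \<subseteq> I"
    using r unfolding J_def J'_def I_def l_def cube_def
    by (auto, (smt (verit))+)
  have mJ: "emeasure lborel J = m" "emeasure lborel J' = m"
    using r by (simp_all add: J_def J'_def m_def emeasure_cube)
  define W where "W x y = ennreal ((cmod (f x - f y))\<^sup>2 / norm (x - y) powr (N + 2 * \<alpha>))" for x y
  have [measurable]: "(\<lambda>(x, y). W x y) \<in> borel_measurable (borel \<Otimes>\<^sub>M borel)" unfolding W_def by measurable
  define E where "E = (\<integral>\<^sup>+x\<in>J. (\<integral>\<^sup>+z\<in>J'. ennreal (cmod (f x - f z)) \<partial>lborel) \<partial>lborel)"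
  have pt: "ennreal (cmod (f x - f y)) \<le> ennreal \<Lambda> + ennreal (K * l powr (N + 2 * \<alpha>) / \<Lambda>) * W x y"
    if "x \<in> J" "y \<in> J'" for x y
  proof -
    define d where "d = norm (x - y)"
    have d: "l \<le> d" "d \<le> sqrt N * l"
      using opposite_corner_distance[OF n r, of x a y] that by (simp_all add: J_def J'_def l_def d_def N_def)
    have "d powr (N + 2 * \<alpha>) \<le> K * l powr (N + 2 * \<alpha>)"
      unfolding K_def using n \<alpha> d l by (intro weight_upper_bound) (auto simp: N_def)
    moreover have "0 < d powr (N + 2 * \<alpha>)" using d l by simp
    ultimately have "1 \<le> K * l powr (N + 2 * \<alpha>) / d powr (N + 2 * \<alpha>)" by simp
    from mult_left_mono[OF this, of "(cmod (f x - f y))\<^sup>2 / \<Lambda>"] \<Lambda>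
    have "(cmod (f x - f y))\<^sup>2 / \<Lambda> \<le> K * l powr (N + 2 * \<alpha>) / \<Lambda> * ((cmod (f x - f y))\<^sup>2 / d powr (N + 2 * \<alpha>))"
      by (simp add: field_simps)
    \<comment> \<open>The case p = 2, c = \<open>\<Lambda>\<close> of \<open>le_add_powr\<close>, in
      place of Cauchy-Schwarz.\<close>
    moreover have "cmod (f x - f y) \<le> \<Lambda> + (cmod (f x - f y))\<^sup>2 / \<Lambda>"
      using le_add_powr[of "cmod (f x - f y)" \<Lambda> 2] \<Lambda> by (simp add: powr_minus powr_numeral field_simps)
    ultimately have "cmod (f x - f y) \<le> \<Lambda> + K * l powr (N + 2 * \<alpha>) / \<Lambda> * ((cmod (f x - f y))\<^sup>2 / d powr (N + 2 * \<alpha>))"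
      by linarith
    then show ?thesis unfolding W_def using \<Lambda> K
      by (simp add: d_def ennreal_mult[symmetric] ennreal_plus[symmetric] ennreal_leI del: ennreal_plus)
  qed
  have "E \<le> (\<integral>\<^sup>+x. (\<integral>\<^sup>+y. ennreal \<Lambda> * indicator J' y * indicator J x
      + ennreal (K * l powr (N + 2 * \<alpha>) / \<Lambda>) * (W x y * indicator I y * indicator I x) \<partial>lborel) \<partial>lborel)"
    unfolding E_def
  proof (rule nn_integral_mono)
    fix x
    have "ennreal (cmod (f x - f y)) * indicator J' y \<le> ennreal \<Lambda> * indicator J' y * indicator J x
        + ennreal (K * l powr (N + 2 * \<alpha>) / \<Lambda>) * (W x y * indicator I y * indicator I x)" if "x \<in> J" for y
    proof (cases "y \<in> J'")
      case True
      then have "y \<in> I" "x \<in> I" using that sub by auto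
      then show ?thesis using pt[OF that True] that True by simp
    qed simp
    then show "(\<integral>\<^sup>+z\<in>J'. ennreal (cmod (f x - f z)) \<partial>lborel) * indicator J x
        \<le> (\<integral>\<^sup>+y. ennreal \<Lambda> * indicator J' y * indicator J x
          + ennreal (K * l powr (N + 2 * \<alpha>) / \<Lambda>) * (W x y * indicator I y * indicator I x) \<partial>lborel)"
      by (cases "x \<in> J") (auto intro: nn_integral_mono)
  qed
  also have "\<dots> = ennreal \<Lambda> * m * m + ennreal (K * l powr (N + 2 * \<alpha>) / \<Lambda>) * (\<integral>\<^sup>+x\<in>I. (\<integral>\<^sup>+y\<in>I. W x y \<partial>lborel) \<partial>lborel)"
  proof -
    have "(\<integral>\<^sup>+y. ennreal \<Lambda> * indicator J' y * indicator J x
      + ennreal (K * l powr (N + 2 * \<alpha>) / \<Lambda>) * (W x y * indicator I y * indicator I x) \<partial>lborel)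
      = ennreal \<Lambda> * m * indicator J x + ennreal (K * l powr (N + 2 * \<alpha>) / \<Lambda>) * ((\<integral>\<^sup>+y\<in>I. W x y \<partial>lborel) * indicator I x)" for x
      by (simp add: nn_integral_add nn_integral_multc nn_integral_cmult nn_integral_cmult_indicator mJ)
    then show ?thesis
      by (simp add: nn_integral_add nn_integral_multc nn_integral_cmult nn_integral_cmult_indicator mJ)
  qed
  also have "\<dots> \<le> ennreal \<Lambda> * m * m + ennreal (K * l powr (2 * N) * \<Lambda>)"
  proof (intro add_left_mono)
    let ?D = "\<integral>\<^sup>+x\<in>I. (\<integral>\<^sup>+y\<in>I. W x y \<partial>lborel) \<partial>lborel"
    have "ennreal (l powr (2 * \<alpha> - N)) * ?D \<le> ennreal (\<Lambda>\<^sup>2)"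
      using \<Lambda> l Q_norm_le_iff[of \<Lambda> \<alpha> f] unfolding W_def N_def I_def by simp
    \<comment> \<open>Since l^(2N) l^(2\<alpha>-N) = l^(N+2\<alpha>), this factor turns the
      normalisation of the Q-norm into the weight bound, and \<alpha> drops out.\<close>
    then have "ennreal (K * l powr (2 * N) / \<Lambda>) * (ennreal (l powr (2 * \<alpha> - N)) * ?D)
        \<le> ennreal (K * l powr (2 * N) / \<Lambda>) * ennreal (\<Lambda>\<^sup>2)" by (intro mult_left_mono) auto
    moreover have "ennreal (K * l powr (2 * N) / \<Lambda>) * ennreal (l powr (2 * \<alpha> - N)) = ennreal (K * l powr (N + 2 * \<alpha>) / \<Lambda>)"
    proof -
      have "l powr (2 * N) * l powr (2 * \<alpha> - N) = l powr (N + 2 * \<alpha>)" by (simp flip: powr_add)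
      then show ?thesis using K \<Lambda> by (simp add: ennreal_mult[symmetric] mult_ac)
    qed
    moreover have "ennreal (K * l powr (2 * N) / \<Lambda>) * ennreal (\<Lambda>\<^sup>2) = ennreal (K * l powr (2 * N) * \<Lambda>)"
      using K \<Lambda> by (simp add: ennreal_mult[symmetric] power2_eq_square)
    ultimately show "ennreal (K * l powr (N + 2 * \<alpha>) / \<Lambda>) * ?D \<le> ennreal (K * l powr (2 * N) * \<Lambda>)"
      by (simp only: mult.assoc[symmetric])
  qed
  also have "\<dots> = ennreal (osc_const CARD('n) / 2 * r ^ (2 * CARD('n)) * \<Lambda>)"
  proof -
    have "l powr (2 * N) = 8 ^ (2 * CARD('n)) * r ^ (2 * CARD('n))"
      using powr_realpow[OF l, of "2 * CARD('n)"] by (simp add: N_def l_def power_mult_distrib)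
    then show ?thesis using \<Lambda> K r
      by (simp add: m_def osc_const_def K_def N_def ennreal_mult[symmetric] ennreal_plus[symmetric] algebra_simps
          flip: power_add mult_2 del: ennreal_plus)
  qed
  finally have E: "E \<le> ennreal (osc_const CARD('n) / 2 * r ^ (2 * CARD('n)) * \<Lambda>)" .
  have "(\<integral>\<^sup>+x\<in>J. (\<integral>\<^sup>+y\<in>J. ennreal (cmod (f x - f y)) \<partial>lborel) \<partial>lborel) * m \<le> 2 * m * E"
    using oscillation_triangle[of f J J'] unfolding mJ E_def by simp
  also have "\<dots> = (2 * E) * m" by (simp add: ac_simps)
  finally have "(\<integral>\<^sup>+x\<in>J. (\<integral>\<^sup>+y\<in>J. ennreal (cmod (f x - f y)) \<partial>lborel) \<partial>lborel) \<le> 2 * E"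
    using r ennreal_mult_le_mult_iff[of m] by (simp add: m_def mult.commute[of _ "ennreal (r ^ CARD('n))"])
  also have "\<dots> \<le> 2 * ennreal (osc_const CARD('n) / 2 * r ^ (2 * CARD('n)) * \<Lambda>)"
    by (intro mult_left_mono E) simp
  also have "\<dots> = ennreal (osc_const CARD('n) * r ^ (2 * CARD('n)) * \<Lambda>)"
  proof -
    have two: "2 * ennreal x = ennreal (2 * x)" if "x \<ge> 0" for x using that by (simp add: ennreal_mult)
    then show ?thesis using \<Lambda> r by (subst two) (auto simp: osc_const_def)
  qed
  finally show ?thesis unfolding J_def .
qed

text \<open>The affine substitution multiplies the double integral and the measure factor by the
  same t^(2n), so the bound does not see the scale \<open>t\<close>.\<close>

lemma oscillation_rescaled:
  fixes f :: "real^'n \<Rightarrow> complex"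
  assumes n: "CARD('n) \<ge> 2" and \<alpha>: "\<alpha> < 1" and f [measurable]: "f \<in> borel_measurable borel"
    and \<Lambda>: "\<Lambda> > 0" "Q_norm \<alpha> f \<le> ennreal \<Lambda>" and r: "r > 0" and t: "t > 0"
  shows "(\<integral>\<^sup>+y\<in>cube a r. (\<integral>\<^sup>+z\<in>cube a r. ennreal (cmod (f (x + t *\<^sub>R z) - f (x + t *\<^sub>R y))) \<partial>lborel) \<partial>lborel)
    \<le> ennreal (osc_const CARD('n) * r ^ (2 * CARD('n)) * \<Lambda>)"
proof -
  define Q where "Q = cube (x + t *\<^sub>R a) (t * r)"
  define m where "m = t ^ CARD('n)"
  have m: "m > 0" using t by (simp add: m_def)
  have [measurable]: "Q \<in> sets borel" by (simp add: Q_def)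
  have Q: "x + t *\<^sub>R z \<in> Q \<longleftrightarrow> z \<in> cube a r" for z
    using t by (auto simp: Q_def cube_def distrib_left[symmetric] simp del: distrib_left)
  have ind: "indicator Q (x + t *\<^sub>R z) = (indicator (cube a r) z :: ennreal)" for z
    by (simp add: indicator_def Q)
  define e where "e u v = ennreal (cmod (f u - f v))" for u v
  have [measurable]: "(\<lambda>(u, v). e u v) \<in> borel_measurable (borel \<Otimes>\<^sub>M borel)" unfolding e_def by measurable
  define G where "G v = (\<integral>\<^sup>+u\<in>Q. e u v \<partial>lborel)" for v
  have [measurable]: "G \<in> borel_measurable borel" unfolding G_def by measurable
  have G: "G v = ennreal m * (\<integral>\<^sup>+z\<in>cube a r. e (x + t *\<^sub>R z) v \<partial>lborel)" for v
    unfolding G_def m_def using t by (subst nn_integral_lborel_affine[of _ t x]) (simp_all add: ind)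
  have "ennreal m * ennreal m * (\<integral>\<^sup>+y\<in>cube a r. (\<integral>\<^sup>+z\<in>cube a r. e (x + t *\<^sub>R z) (x + t *\<^sub>R y) \<partial>lborel) \<partial>lborel)
      = ennreal m * (\<integral>\<^sup>+y\<in>cube a r. G (x + t *\<^sub>R y) \<partial>lborel)"
    unfolding G by (simp add: mult.assoc nn_integral_cmult)
  also have "\<dots> = (\<integral>\<^sup>+v\<in>Q. G v \<partial>lborel)"
    unfolding m_def using t by (subst nn_integral_lborel_affine[of "\<lambda>v. G v * indicator Q v" t x]) (simp_all add: ind)
  also have "\<dots> \<le> ennreal (osc_const CARD('n) * (t * r) ^ (2 * CARD('n)) * \<Lambda>)"
    using oscillation_le_Q_norm[OF n \<alpha> f \<Lambda>, of "t * r" "x + t *\<^sub>R a"] t r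
    unfolding G_def Q_def e_def by (simp add: norm_minus_commute)
  also have "\<dots> = ennreal (m * m) * ennreal (osc_const CARD('n) * r ^ (2 * CARD('n)) * \<Lambda>)"
    using m t \<Lambda> r by (subst ennreal_mult[symmetric])
      (auto simp: m_def power_mult_distrib osc_const_def power2_eq_square mult_ac simp flip: power_add mult_2)
  finally have "ennreal (m * m) * (\<integral>\<^sup>+y\<in>cube a r. (\<integral>\<^sup>+z\<in>cube a r. e (x + t *\<^sub>R z) (x + t *\<^sub>R y) \<partial>lborel) \<partial>lborel)
      \<le> ennreal (m * m) * ennreal (osc_const CARD('n) * r ^ (2 * CARD('n)) * \<Lambda>)"
    using m by (simp add: ennreal_mult)
  then show ?thesis
    using m ennreal_mult_le_mult_iff[of "ennreal (m * m)"] unfolding e_def by simp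
qed

text \<open>Mean zero allows f(x + t y) to be subtracted for any y, and the result is averaged over
  y in a fixed cube. The decay of the kernel is split over dyadic cubes. Decay of order 2n + 1 is
  taken because the oscillation over the k-th cube, a double integral, grows like 2^(2nk).\<close>

lemma mean_zero_kernel_le_Q_norm:
  assumes n: "CARD('n) \<ge> 2"
  obtains K where "K \<ge> 0"
    "\<And>\<alpha> (f :: real^'n \<Rightarrow> complex) \<Lambda> x t \<psi> C. \<lbrakk>\<alpha> < 1; f \<in> borel_measurable borel; \<Lambda> > 0;
      Q_norm \<alpha> f \<le> ennreal \<Lambda>; t > 0; \<And>z. cmod (\<psi> z) \<le> C / (1 + norm z) ^ Suc (2 * CARD('n));
      integrable lborel \<psi>; (\<integral>z. \<psi> z \<partial>lborel) = 0; integrable lborel (\<lambda>z. f (x + t *\<^sub>R z) * \<psi> z)\<rbrakk>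
      \<Longrightarrow> cmod (\<integral>z. f (x + t *\<^sub>R z) * \<psi> z \<partial>lborel) \<le> K * C * \<Lambda>"
proof -
  define N where "N = Suc (2 * CARD('n))"
  define c where "c k = 2 ^ N * (1 / 2 :: real) ^ (k * N)" for k
  define S where "S = (\<Sum>k. ennreal (c k) * ennreal ((2 ^ Suc k) ^ (2 * CARD('n))))"
  have S: "S < \<infinity>" unfolding S_def c_def by (rule dyadic_sum_finite) (simp add: N_def)
  define o_n where "o_n = osc_const CARD('n)"
  have o_n: "o_n \<ge> 0" by (simp add: o_n_def osc_const_def)
  show ?thesis
  proof (rule that[of "enn2real S * o_n"])
    show "0 \<le> enn2real S * o_n" using o_n by simp
  next
    fix \<alpha> and f :: "real^'n \<Rightarrow> complex" and \<Lambda> x t \<psi> C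
    assume \<alpha>: "\<alpha> < 1" and f [measurable]: "f \<in> borel_measurable borel" and \<Lambda>: "\<Lambda> > 0" "Q_norm \<alpha> f \<le> ennreal \<Lambda>"
      and t: "t > 0" and \<psi>: "\<And>z. cmod (\<psi> z) \<le> C / (1 + norm z) ^ Suc (2 * CARD('n))"
      and int: "integrable lborel \<psi>" "integrable lborel (\<lambda>z. f (x + t *\<^sub>R z) * \<psi> z)"
      and zero: "(\<integral>z. \<psi> z \<partial>lborel) = 0"
    have C: "0 \<le> C" using order_trans[OF norm_ge_zero \<psi>[of 0]] by simp
    have [measurable]: "\<psi> \<in> borel_measurable borel" using borel_measurable_integrable[OF int(1)] by simp
    define h where "h z = f (x + t *\<^sub>R z)" for z
    have h [measurable]: "h \<in> borel_measurable borel" unfolding h_def by measurable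
    let ?Q = "dyadic_cube :: nat \<Rightarrow> (real^'n) set"
    define e where "e z y = ennreal (cmod (h z - h y))" for z y
    have [measurable]: "(\<lambda>(u, v). e u v) \<in> borel_measurable (borel \<Otimes>\<^sub>M borel)" unfolding e_def by measurable
    define L where "L = cmod (\<integral>z. h z * \<psi> z \<partial>lborel)"
    \<comment> \<open>The left side does not depend on y, which stays free for the averaging
      below.\<close>
    have L: "ennreal L \<le> ennreal C * (\<Sum>k. ennreal (c k) * (\<integral>\<^sup>+z\<in>?Q k. e z y \<partial>lborel))" for y
    proof -
      have "(\<integral>z. (h z - h y) * \<psi> z \<partial>lborel) = (\<integral>z. h z * \<psi> z \<partial>lborel)"
        using int zero by (simp add: h_def left_diff_distrib)
      then have "ennreal L = ennreal (cmod (\<integral>z. (h z - h y) * \<psi> z \<partial>lborel))" by (simp add: L_def)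
      also have "\<dots> \<le> (\<integral>\<^sup>+z. ennreal (cmod ((h z - h y) * \<psi> z)) \<partial>lborel)"
        using int by (intro integral_norm_bound_ennreal) (simp add: h_def left_diff_distrib)
      also have "\<dots> \<le> (\<integral>\<^sup>+z. ennreal C * (\<Sum>k. ennreal (c k) * (e z y * indicator (?Q k) z)) \<partial>lborel)"
      proof (rule nn_integral_mono)
        fix z
        have "ennreal (cmod ((h z - h y) * \<psi> z)) = e z y * ennreal (cmod (\<psi> z))"
          by (simp add: e_def norm_mult ennreal_mult)
        also have "\<dots> \<le> e z y * ennreal (C * (1 / (1 + norm z) ^ N))"
          using \<psi>[of z] by (intro mult_left_mono ennreal_leI) (auto simp: N_def simp del: power_Suc)
        also have "\<dots> = ennreal C * (e z y * ennreal (1 / (1 + norm z) ^ N))"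
        proof -
          have "ennreal (C * (1 / (1 + norm z) ^ N)) = ennreal C * ennreal (1 / (1 + norm z) ^ N)"
            using C by (intro ennreal_mult) auto
          then show ?thesis by (simp only: ac_simps)
        qed
        also have "\<dots> \<le> ennreal C * (e z y * (\<Sum>k. ennreal (c k) * indicator (?Q k) z))"
          unfolding c_def by (intro mult_left_mono decay_le_dyadic_sum) auto
        also have "\<dots> = ennreal C * (\<Sum>k. ennreal (c k) * (e z y * indicator (?Q k) z))"
          by (simp only: ennreal_suminf_cmult[symmetric] mult.left_commute[of "e z y"])
        finally show "ennreal (cmod ((h z - h y) * \<psi> z)) \<le> ennreal C * (\<Sum>k. ennreal (c k) * (e z y * indicator (?Q k) z))" .
      qed
      also have "\<dots> = ennreal C * (\<Sum>k. ennreal (c k) * (\<integral>\<^sup>+z\<in>?Q k. e z y \<partial>lborel))"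
        by (simp add: nn_integral_cmult nn_integral_suminf)
      finally show ?thesis .
    qed
    \<comment> \<open>The cube \<open>?Q 0\<close> has measure 2^n >= 1, so integrating over it
      costs nothing.\<close>
    have "ennreal L \<le> (\<integral>\<^sup>+y\<in>?Q 0. ennreal L \<partial>lborel)"
    proof -
      have "(\<integral>\<^sup>+y\<in>?Q 0. ennreal L \<partial>lborel) = ennreal L * ennreal (2 ^ CARD('n))"
        by (simp add: nn_integral_cmult_indicator emeasure_cube)
      moreover have "ennreal L * 1 \<le> ennreal L * ennreal (2 ^ CARD('n))"
        by (intro mult_left_mono) (auto simp flip: ennreal_1 intro!: ennreal_leI)
      ultimately show ?thesis by simp
    qed
    also have "\<dots> \<le> (\<integral>\<^sup>+y. ennreal C * (\<Sum>k. ennreal (c k) * ((\<integral>\<^sup>+z\<in>?Q k. e z y \<partial>lborel) * indicator (?Q 0) y)) \<partial>lborel)"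
      using L by (intro nn_integral_mono) (auto split: split_indicator)
    also have "\<dots> = ennreal C * (\<Sum>k. ennreal (c k) * (\<integral>\<^sup>+y\<in>?Q 0. (\<integral>\<^sup>+z\<in>?Q k. e z y \<partial>lborel) \<partial>lborel))"
      by (simp add: nn_integral_cmult nn_integral_suminf)
    also have "\<dots> \<le> ennreal C * (\<Sum>k. ennreal (c k) * (ennreal ((2 ^ Suc k) ^ (2 * CARD('n))) * ennreal (o_n * \<Lambda>)))"
    proof (intro mult_left_mono suminf_le)
      fix k
      \<comment> \<open>Enlarging the range of y makes both variables run over the same cube, the
        form covered by the oscillation bound.\<close>
      have "?Q 0 \<subseteq> ?Q k"
        unfolding subset_iff mem_dyadic_cube using one_le_power[of "2 :: real" k] by (auto intro: order_trans)
      then have "(\<integral>\<^sup>+y\<in>?Q 0. (\<integral>\<^sup>+z\<in>?Q k. e z y \<partial>lborel) \<partial>lborel) \<le> (\<integral>\<^sup>+y\<in>?Q k. (\<integral>\<^sup>+z\<in>?Q k. e z y \<partial>lborel) \<partial>lborel)"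
        by (intro nn_integral_mono mult_left_mono) (auto split: split_indicator)
      also have "\<dots> \<le> ennreal (osc_const CARD('n) * (2 ^ Suc k) ^ (2 * CARD('n)) * \<Lambda>)"
        unfolding e_def h_def by (rule oscillation_rescaled[OF n \<alpha> f \<Lambda> _ t]) simp
      also have "\<dots> = ennreal ((2 ^ Suc k) ^ (2 * CARD('n))) * ennreal (o_n * \<Lambda>)"
        using o_n \<Lambda> by (simp add: ennreal_mult[symmetric] o_n_def mult_ac del: power_Suc)
      finally show "(\<integral>\<^sup>+y\<in>?Q 0. (\<integral>\<^sup>+z\<in>?Q k. e z y \<partial>lborel) \<partial>lborel)
          \<le> ennreal ((2 ^ Suc k) ^ (2 * CARD('n))) * ennreal (o_n * \<Lambda>)" .
    qed auto
    also have "\<dots> = ennreal C * (S * ennreal (o_n * \<Lambda>))"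
      unfolding S_def ennreal_suminf_multc[symmetric] by (simp only: mult.assoc)
    also have "S = ennreal (enn2real S)" using S by simp
    also have "ennreal C * (ennreal (enn2real S) * ennreal (o_n * \<Lambda>)) = ennreal (enn2real S * o_n * C * \<Lambda>)"
      using C o_n \<Lambda> by (simp add: ennreal_mult[symmetric] mult_ac)
    finally have "L \<le> enn2real S * o_n * C * \<Lambda>"
      using C o_n \<Lambda> by (subst (asm) ennreal_le_iff) auto
    then show "cmod (\<integral>z. f (x + t *\<^sub>R z) * \<psi> z \<partial>lborel) \<le> enn2real S * o_n * C * \<Lambda>"
      unfolding L_def h_def .
  qed
qed

section \<open>Recovering a function from its averages\<close>

text \<open>Used for f at scale 1, and for (-Laplacian)^(s/2) f with exponent \<open>q\<close> at
  scale 2^-k, where the growth t^(-n/q) is to be beaten by a factor t^s.\<close>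

lemma decay_kernel_bound:
  fixes f \<phi> :: "real^'n \<Rightarrow> complex"
  assumes [measurable]: "f \<in> borel_measurable borel" "\<phi> \<in> borel_measurable borel"
    and p: "1 \<le> p" and t: "0 < t" and \<Lambda>: "0 < \<Lambda>"
    and f: "(\<integral>\<^sup>+x. ennreal (cmod (f x) powr p) \<partial>lborel) \<le> ennreal (\<Lambda> powr p)"
    and N: "CARD('n) < N" and C: "\<And>z. cmod (\<phi> z) \<le> C / (1 + norm z) ^ N"
  shows "integrable lborel (\<lambda>z. f (x + t *\<^sub>R z) * \<phi> z)"
    and "cmod (\<integral>z. f (x + t *\<^sub>R z) * \<phi> z \<partial>lborel)
      \<le> C * (t powr (- real CARD('n) / p) * \<Lambda>)
          * (enn2real (\<integral>\<^sup>+z. ennreal (1 / (1 + norm (z::real^'n)) ^ N) \<partial>lborel) + 1)"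
proof -
  define W where "W = (\<integral>\<^sup>+z. ennreal (1 / (1 + norm (z::real^'n)) ^ N) \<partial>lborel)"
  have W: "W = ennreal (enn2real W)" using decay_nn_integral_finite[OF N] by (simp add: W_def)
  have C0: "0 \<le> C" using order_trans[OF norm_ge_zero C[of 0]] by simp
  have "(\<integral>\<^sup>+z. ennreal (cmod (f (x + t *\<^sub>R z) * \<phi> z)) \<partial>lborel)
      \<le> (\<integral>\<^sup>+z. ennreal C * (ennreal (cmod (f (x + t *\<^sub>R z))) * ennreal (1 / (1 + norm z) ^ N)) \<partial>lborel)"
  proof (rule nn_integral_mono)
    fix z
    have "cmod (f (x + t *\<^sub>R z) * \<phi> z) \<le> C * (cmod (f (x + t *\<^sub>R z)) * (1 / (1 + norm z) ^ N))"
      using mult_left_mono[OF C[of z], of "cmod (f (x + t *\<^sub>R z))"] by (simp add: norm_mult mult_ac)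
    then show "ennreal (cmod (f (x + t *\<^sub>R z) * \<phi> z))
        \<le> ennreal C * (ennreal (cmod (f (x + t *\<^sub>R z))) * ennreal (1 / (1 + norm z) ^ N))"
      using C0 by (simp add: ennreal_mult[symmetric] ennreal_leI)
  qed
  also have "\<dots> = ennreal C * (\<integral>\<^sup>+z. ennreal (cmod (f (x + t *\<^sub>R z))) * ennreal (1 / (1 + norm z) ^ N) \<partial>lborel)"
    by (rule nn_integral_cmult) simp
  also have "\<dots> \<le> ennreal C * (ennreal (t powr (- real CARD('n) / p) * \<Lambda>) * (W + 1))"
    unfolding W_def by (intro mult_left_mono nn_integral_decay_Lp p t \<Lambda> f) auto
  also have "W + 1 = ennreal (enn2real W + 1)" by (subst W) (simp add: ennreal_plus)
  also have "ennreal C * (ennreal (t powr (- real CARD('n) / p) * \<Lambda>) * ennreal (enn2real W + 1))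
      = ennreal (C * (t powr (- real CARD('n) / p) * \<Lambda>) * (enn2real W + 1))"
    using C0 \<Lambda> by (simp add: ennreal_mult[symmetric] mult.assoc del: ennreal_plus)
  finally have le: "(\<integral>\<^sup>+z. ennreal (cmod (f (x + t *\<^sub>R z) * \<phi> z)) \<partial>lborel)
      \<le> ennreal (C * (t powr (- real CARD('n) / p) * \<Lambda>) * (enn2real W + 1))" .
  then show int: "integrable lborel (\<lambda>z. f (x + t *\<^sub>R z) * \<phi> z)"
    by (intro integrableI_bounded) (auto intro: le_less_trans)
  have "ennreal (cmod (\<integral>z. f (x + t *\<^sub>R z) * \<phi> z \<partial>lborel))
      \<le> ennreal (C * (t powr (- real CARD('n) / p) * \<Lambda>) * (enn2real W + 1))"
    using integral_norm_bound_ennreal[OF int] le by (rule order_trans)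
  then show "cmod (\<integral>z. f (x + t *\<^sub>R z) * \<phi> z \<partial>lborel)
      \<le> C * (t powr (- real CARD('n) / p) * \<Lambda>) * (enn2real (\<integral>\<^sup>+z. ennreal (1 / (1 + norm (z::real^'n)) ^ N) \<partial>lborel) + 1)"
    using C0 \<Lambda> unfolding W_def by (subst (asm) ennreal_le_iff) auto
qed

lemma integrable_on_bounded_set_Lp:
  fixes f :: "real^'n \<Rightarrow> complex"
  assumes [measurable]: "f \<in> borel_measurable borel" "S \<in> sets borel" and "1 \<le> p"
    and f: "(\<integral>\<^sup>+x. ennreal (cmod (f x) powr p) \<partial>lborel) < \<infinity>" and S: "emeasure lborel S < \<infinity>"
  shows "integrable lborel (\<lambda>x. indicator S x *\<^sub>R f x)"
proof (rule integrableI_bounded)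
  have "(\<integral>\<^sup>+x. ennreal (norm (indicator S x *\<^sub>R f x)) \<partial>lborel)
      \<le> (\<integral>\<^sup>+x. indicator S x + ennreal (cmod (f x) powr p) \<partial>lborel)"
  proof (rule nn_integral_mono)
    fix x
    show "ennreal (norm (indicator S x *\<^sub>R f x)) \<le> indicator S x + ennreal (cmod (f x) powr p)"
      using le_add_powr[of "cmod (f x)" 1 p] \<open>1 \<le> p\<close>
      by (auto split: split_indicator simp: ennreal_plus[symmetric] ennreal_leI simp flip: ennreal_1 simp del: ennreal_plus)
  qed
  also have "\<dots> = emeasure lborel S + (\<integral>\<^sup>+x. ennreal (cmod (f x) powr p) \<partial>lborel)"
    by (simp add: nn_integral_add)
  also have "\<dots> < \<infinity>" using f S by simp
  finally show "(\<integral>\<^sup>+x. ennreal (norm (indicator S x *\<^sub>R f x)) \<partial>lborel) < \<infinity>" .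
qed simp

lemma emeasure_cball_less_top [simp]: "emeasure lborel (cball a r) < top"
  using emeasure_bounded_finite[of "cball a r"] by simp

text \<open>The averages of \<open>f\<close> are bounded by \<open>B\<close> uniformly in the centre
  and along scales tending to 0. By duality this bounds \<open>f\<close> almost everywhere once the
  kernel has nonzero mean; no pointwise convergence of the averages is involved.\<close>

locale bounded_averages =
  fixes f \<phi> :: "real^'n \<Rightarrow> complex" and t :: "nat \<Rightarrow> real" and p B :: real
  assumes f [measurable]: "f \<in> borel_measurable borel" and p: "1 \<le> p"
    and f_Lp: "(\<integral>\<^sup>+x. ennreal (cmod (f x) powr p) \<partial>lborel) < \<infinity>"
    and \<phi>: "integrable lborel \<phi>"
    and t_lim: "t \<longlonglongrightarrow> 0"
    and bound: "\<And>k y. cmod (\<integral>z. f (y + t k *\<^sub>R z) * \<phi> z \<partial>lborel) \<le> B"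
begin

lemma \<phi>_measurable [measurable]: "\<phi> \<in> borel_measurable borel"
  using borel_measurable_integrable[OF \<phi>] by simp

text \<open>By Fubini the integral of theta(y) times the average at y equals the integral of phi(z)
  H(t_k z), where H(v) pairs the translate of f by v with theta. The former is at most B times the
  integral of theta, the latter tends to the integral of phi times H(0).\<close>

lemma integral_test_function_le:
  fixes \<theta> :: "real^'n \<Rightarrow> real"
  assumes cont: "continuous_on UNIV \<theta>" and \<theta>: "\<And>x. 0 \<le> \<theta> x" "\<And>x. \<theta> x \<le> 1" and supp: "\<And>x. norm x > R \<Longrightarrow> \<theta> x = 0"
  shows "cmod ((\<integral>z. \<phi> z \<partial>lborel) * (\<integral>x. f x * \<theta> x \<partial>lborel)) \<le> B * (\<integral>x. \<theta> x \<partial>lborel)"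
proof -
  have [measurable]: "\<theta> \<in> borel_measurable borel" by (rule borel_measurable_continuous_onI[OF cont])
  \<comment> \<open>From |f| theta <= (1 + |f|^p) theta <= theta + |f|^p. This bound is unchanged by
    translations of f; it dominates \<open>H\<close> and justifies Fubini.\<close>
  define M where "M = (\<integral>\<^sup>+x. ennreal (\<theta> x) \<partial>lborel) + (\<integral>\<^sup>+x. ennreal (cmod (f x) powr p) \<partial>lborel)"
  have \<theta>_le: "\<theta> x \<le> indicator (cball 0 R) x" for x
    using \<theta> supp[of x] by (auto simp: indicator_def)
  have \<theta>_int: "integrable lborel \<theta>"
  proof (rule Bochner_Integration.integrable_bound)
    show "integrable lborel (indicator (cball 0 R) :: real^'n \<Rightarrow> real)"
      by (rule integrable_real_indicator) auto
    show "AE x in lborel. norm (\<theta> x) \<le> norm (indicator (cball 0 R) x :: real)" using \<theta> \<theta>_le by simp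
  qed simp
  have M: "M < \<infinity>"
    using \<theta>_int f_Lp \<theta> by (simp add: M_def integrable_iff_bounded)
  have H_bound: "(\<integral>\<^sup>+y. ennreal (cmod (f (y + v) * \<theta> y)) \<partial>lborel) \<le> M" for v
  proof -
    have "(\<integral>\<^sup>+y. ennreal (cmod (f (y + v) * \<theta> y)) \<partial>lborel)
        \<le> (\<integral>\<^sup>+y. ennreal (\<theta> y) + ennreal (cmod (f (y + v)) powr p) \<partial>lborel)"
    proof (rule nn_integral_mono)
      fix y
      have "cmod (f (y + v)) * \<theta> y \<le> (1 + cmod (f (y + v)) powr p) * \<theta> y"
        using le_add_powr[of "cmod (f (y + v))" 1 p] p \<theta> by (intro mult_right_mono) auto
      also have "\<dots> \<le> \<theta> y + cmod (f (y + v)) powr p"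
        using \<theta> by (simp add: distrib_right mult_left_le)
      finally show "ennreal (cmod (f (y + v) * \<theta> y)) \<le> ennreal (\<theta> y) + ennreal (cmod (f (y + v)) powr p)"
        using \<theta> by (simp add: norm_mult ennreal_plus[symmetric] ennreal_leI del: ennreal_plus)
    qed
    also have "\<dots> = M"
      using nn_integral_lborel_affine[of "\<lambda>x. ennreal (cmod (f x) powr p)" 1 v]
      by (simp add: M_def nn_integral_add add.commute)
    finally show ?thesis .
  qed
  define H where "H v = (\<integral>y. f (y + v) * \<theta> y \<partial>lborel)" for v
  have [measurable]: "(\<lambda>z. H (t k *\<^sub>R z)) \<in> borel_measurable borel" for k
    unfolding H_def by measurable
  have H_le: "cmod (H v) \<le> enn2real M" for v
  proof -
    have "integrable lborel (\<lambda>y. f (y + v) * complex_of_real (\<theta> y))"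
      using H_bound[of v] M by (intro integrableI_bounded) (auto intro: le_less_trans)
    from integral_norm_bound_ennreal[OF this] have "ennreal (cmod (H v)) \<le> M"
      unfolding H_def using H_bound order_trans by blast
    then show ?thesis using M by (metis enn2real_ennreal enn2real_mono norm_ge_zero infinity_ennreal_def)
  qed
  have H_lim: "(\<lambda>k. H (t k *\<^sub>R z)) \<longlonglongrightarrow> H 0" for z
  proof -
    \<comment> \<open>The translation is moved from f, which need not be continuous, to the test
      function, which is.\<close>
    have shift: "H v = (\<integral>y. f y * \<theta> (y - v) \<partial>lborel)" for v
      using integral_lborel_affine[of "\<lambda>y. f y * \<theta> (y - v)" 1 v] by (simp add: H_def add.commute)
    have tz: "(\<lambda>k. t k *\<^sub>R z) \<longlonglongrightarrow> 0" using tendsto_scaleR[OF t_lim tendsto_const[of z]] by simp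
    then have "\<forall>\<^sub>F k in sequentially. norm (t k *\<^sub>R z) < 1"
      using tendstoD[OF tz, of 1] by simp
    \<comment> \<open>From this index on the translated test functions live in the ball of radius R
      + 1, which gives a common dominating function.\<close>
    then obtain k0 where k0: "\<And>k. k \<ge> k0 \<Longrightarrow> norm (t k *\<^sub>R z) < 1"
      unfolding eventually_sequentially by blast
    have "(\<lambda>k. \<integral>y. f y * \<theta> (y - t (k + k0) *\<^sub>R z) \<partial>lborel) \<longlonglongrightarrow> (\<integral>y. f y * \<theta> (y - 0) \<partial>lborel)"
    proof (rule integral_dominated_convergence[where w = "\<lambda>y. norm (indicator (cball 0 (R + 1)) y *\<^sub>R f y)"])
      show "integrable lborel (\<lambda>y. norm (indicator (cball 0 (R + 1)) y *\<^sub>R f y))"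
        by (intro integrable_norm integrable_on_bounded_set_Lp[OF f _ p f_Lp])
          auto
      show "AE y in lborel. norm (f y * complex_of_real (\<theta> (y - t (k + k0) *\<^sub>R z))) \<le> norm (indicator (cball 0 (R + 1)) y *\<^sub>R f y)" for k
      proof (intro always_eventually allI)
        fix y
        show "norm (f y * complex_of_real (\<theta> (y - t (k + k0) *\<^sub>R z))) \<le> norm (indicator (cball 0 (R + 1)) y *\<^sub>R f y)"
        proof (cases "norm y \<le> R + 1")
          case True
          then show ?thesis using \<theta> by (simp add: norm_mult mult_left_le)
        next
          case False
          have "norm y \<le> norm (y - t (k + k0) *\<^sub>R z) + norm (t (k + k0) *\<^sub>R z)"
            by (metis diff_add_cancel norm_triangle_ineq)
          then have "norm (y - t (k + k0) *\<^sub>R z) > R" using False k0[of "k + k0"] by simp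
          then show ?thesis by (simp add: supp)
        qed
      qed
      have "(\<lambda>k. \<theta> (y - t (k + k0) *\<^sub>R z)) \<longlonglongrightarrow> \<theta> (y - 0)" for y
      proof -
        have "(\<lambda>k. y - t (k + k0) *\<^sub>R z) \<longlonglongrightarrow> y - 0"
          by (intro tendsto_diff tendsto_const LIMSEQ_ignore_initial_segment[OF tz])
        moreover have "isCont \<theta> (y - 0)" using cont by (simp add: continuous_on_eq_continuous_at)
        ultimately show ?thesis by (rule isCont_tendsto_compose[rotated])
      qed
      then show "AE y in lborel. (\<lambda>k. f y * complex_of_real (\<theta> (y - t (k + k0) *\<^sub>R z))) \<longlonglongrightarrow> f y * complex_of_real (\<theta> (y - 0))"
        by (intro always_eventually allI tendsto_intros)
    qed auto
    then have "(\<lambda>k. H (t (k + k0) *\<^sub>R z)) \<longlonglongrightarrow> H 0" unfolding shift .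
    then show ?thesis by (rule LIMSEQ_offset)
  qed
  have lim: "(\<lambda>k. \<integral>z. \<phi> z * H (t k *\<^sub>R z) \<partial>lborel) \<longlonglongrightarrow> (\<integral>z. \<phi> z * H 0 \<partial>lborel)"
  proof (rule integral_dominated_convergence[where w = "\<lambda>z. cmod (\<phi> z) * enn2real M"])
    show "integrable lborel (\<lambda>z. cmod (\<phi> z) * enn2real M)" by (intro integrable_mult_left integrable_norm \<phi>)
    show "AE z in lborel. norm (\<phi> z * H (t k *\<^sub>R z)) \<le> cmod (\<phi> z) * enn2real M" for k
      by (auto simp: norm_mult intro!: mult_left_mono H_le)
    show "AE z in lborel. (\<lambda>k. \<phi> z * H (t k *\<^sub>R z)) \<longlonglongrightarrow> \<phi> z * H 0"
      by (intro always_eventually allI tendsto_intros H_lim)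
  qed auto
  have le: "cmod (\<integral>z. \<phi> z * H (t k *\<^sub>R z) \<partial>lborel) \<le> B * (\<integral>x. \<theta> x \<partial>lborel)" for k
  proof -
    let ?F = "\<lambda>(y, z). f (y + t k *\<^sub>R z) * \<theta> y * \<phi> z"
    have int: "integrable (lborel \<Otimes>\<^sub>M lborel) ?F"
    proof (rule integrableI_bounded)
      show "?F \<in> borel_measurable (lborel \<Otimes>\<^sub>M lborel)" by measurable
      have "(\<integral>\<^sup>+x. ennreal (norm (?F x)) \<partial>(lborel \<Otimes>\<^sub>M lborel))
          = (\<integral>\<^sup>+z. \<integral>\<^sup>+y. ennreal (cmod (f (y + t k *\<^sub>R z) * \<theta> y)) * ennreal (cmod (\<phi> z)) \<partial>lborel \<partial>lborel)"
        by (subst lborel_pair.nn_integral_snd[symmetric]) (simp_all add: norm_mult ennreal_mult)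
      also have "\<dots> \<le> (\<integral>\<^sup>+z. M * ennreal (cmod (\<phi> z)) \<partial>lborel)"
        using H_bound by (intro nn_integral_mono) (simp add: nn_integral_multc mult_right_mono)
      also have "\<dots> = M * (\<integral>\<^sup>+z. ennreal (cmod (\<phi> z)) \<partial>lborel)" by (rule nn_integral_cmult) simp
      also have "\<dots> < \<infinity>" using M \<phi> by (simp add: integrable_iff_bounded ennreal_mult_less_top)
      finally show "(\<integral>\<^sup>+x. ennreal (norm (?F x)) \<partial>(lborel \<Otimes>\<^sub>M lborel)) < \<infinity>" .
    qed
    have "(\<integral>z. \<phi> z * H (t k *\<^sub>R z) \<partial>lborel) = (\<integral>z. (\<integral>y. f (y + t k *\<^sub>R z) * \<theta> y * \<phi> z \<partial>lborel) \<partial>lborel)"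
      by (simp add: H_def mult.commute[of "\<phi> _"])
    also have "\<dots> = (\<integral>y. (\<integral>z. f (y + t k *\<^sub>R z) * \<theta> y * \<phi> z \<partial>lborel) \<partial>lborel)"
      using lborel_pair.Fubini_integral[OF int] by simp
    also have "\<dots> = (\<integral>y. \<theta> y * (\<integral>z. f (y + t k *\<^sub>R z) * \<phi> z \<partial>lborel) \<partial>lborel)"
      by (simp add: mult.commute[of "f _" "of_real _"] mult.assoc)
    also have "cmod \<dots> \<le> (\<integral>y. norm (\<theta> y * (\<integral>z. f (y + t k *\<^sub>R z) * \<phi> z \<partial>lborel)) \<partial>lborel)"
      by (rule integral_norm_bound)
    also have "\<dots> \<le> (\<integral>y. B * \<theta> y \<partial>lborel)"
    proof (rule integral_mono)
      have "integrable lborel (\<lambda>y. \<integral>z. ?F (y, z) \<partial>lborel)" by (rule lborel_pair.integrable_fst'[OF int])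
      then show "integrable lborel (\<lambda>y. norm (\<theta> y * (\<integral>z. f (y + t k *\<^sub>R z) * \<phi> z \<partial>lborel)))"
        by (intro integrable_norm) (simp add: mult.commute[of "f _" "of_real _"] mult.assoc)
      show "integrable lborel (\<lambda>y. B * \<theta> y)" by (intro integrable_mult_right \<theta>_int)
      show "norm (\<theta> y * (\<integral>z. f (y + t k *\<^sub>R z) * \<phi> z \<partial>lborel)) \<le> B * \<theta> y" for y
        using mult_right_mono[OF bound[of y k] \<theta>(1)[of y]] \<theta>(1)[of y] by (simp add: norm_mult mult.commute)
    qed
    finally show ?thesis by simp
  qed
  have "cmod (\<integral>z. \<phi> z * H 0 \<partial>lborel) \<le> B * (\<integral>x. \<theta> x \<partial>lborel)"
    using le by (intro LIMSEQ_le_const2[OF tendsto_norm[OF lim]]) auto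
  then show ?thesis by (simp add: H_def)
qed

text \<open>The indicator of \<open>T\<close> is the limit of continuous functions of the distance
  to \<open>T\<close>, and both sides pass to the limit by dominated convergence.\<close>

lemma integral_compact_le:
  fixes T :: "(real^'n) set"
  assumes T: "compact T"
  shows "cmod ((\<integral>z. \<phi> z \<partial>lborel) * (\<integral>x. indicator T x *\<^sub>R f x \<partial>lborel)) \<le> B * measure lborel T"
proof (cases "T = {}")
  \<comment> \<open>The empty set is set apart because \<open>infdist\<close> to it is 0 by
    convention, and the functions below would then not vanish far away.\<close>
  case False
  obtain R where R: "\<forall>x\<in>T. norm x \<le> R" using compact_imp_bounded[OF T] unfolding bounded_iff ..
  have Tm [measurable]: "T \<in> sets borel" using T by (simp add: borel_compact)
  \<comment> \<open>With \<open>Suc j\<close> as slope every function, the one for j = 0 included,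
    vanishes at distance 1 or more from \<open>T\<close>, so a single ball contains all
    supports.\<close>
  define \<theta> where "\<theta> j x = max 0 (1 - real (Suc j) * infdist x T)" for j x
  have \<theta>_cont: "continuous_on UNIV (\<theta> j)" for j
    unfolding \<theta>_def by (intro continuous_intros)
  have [measurable]: "\<theta> j \<in> borel_measurable borel" for j by (rule borel_measurable_continuous_onI[OF \<theta>_cont])
  have \<theta>01: "0 \<le> \<theta> j x" "\<theta> j x \<le> 1" for j x by (auto simp: \<theta>_def infdist_nonneg)
  have supp: "\<theta> j x = 0" if "norm x > R + 1" for j x
  proof -
    have "1 \<le> infdist x T"
      unfolding infdist_notempty[OF False]
    proof (rule cINF_greatest[OF False])
      fix a assume "a \<in> T"
      then have "norm a \<le> R" using R by auto
      then show "1 \<le> dist x a" using that norm_triangle_ineq2[of x a] by (simp add: dist_norm)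
    qed
    then have "1 * 1 \<le> real (Suc j) * infdist x T" by (intro mult_mono) auto
    then show ?thesis by (simp add: \<theta>_def)
  qed
  have \<theta>_le: "\<theta> j x \<le> indicator (cball 0 (R + 1)) x" for j x
    using \<theta>01[of j x] supp[of x j] by (auto simp: indicator_def)
  have \<theta>_lim: "(\<lambda>j. \<theta> j x) \<longlonglongrightarrow> indicator T x" for x
  proof (cases "x \<in> T")
    case True
    then have "\<theta> j x = 1" for j by (simp add: \<theta>_def)
    then show ?thesis using True by simp
  next
    case False
    then have "infdist x T > 0"
      using T \<open>T \<noteq> {}\<close> by (metis compact_imp_closed in_closed_iff_infdist_zero infdist_nonneg less_eq_real_def)
    then obtain j0 where j0: "1 < real j0 * infdist x T" using reals_Archimedean3 by blast
    have "\<theta> j x = 0" if "j \<ge> j0" for j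
    proof -
      have "real j0 * infdist x T \<le> real (Suc j) * infdist x T" using that by (intro mult_right_mono) (auto simp: infdist_nonneg)
      then show ?thesis using j0 by (simp add: \<theta>_def)
    qed
    then have "\<forall>\<^sub>F j in sequentially. \<theta> j x = 0" unfolding eventually_sequentially by blast
    then show ?thesis using False by (auto intro: tendsto_eventually)
  qed
  have ball_fin: "emeasure lborel (cball (0::real^'n) (R + 1)) < \<infinity>" by simp
  have l1: "(\<lambda>j. \<integral>x. f x * \<theta> j x \<partial>lborel) \<longlonglongrightarrow> (\<integral>x. f x * indicator T x \<partial>lborel)"
  proof (rule integral_dominated_convergence[where w = "\<lambda>y. norm (indicator (cball 0 (R + 1)) y *\<^sub>R f y)"])
    show "integrable lborel (\<lambda>y. norm (indicator (cball 0 (R + 1)) y *\<^sub>R f y))"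
      by (intro integrable_norm integrable_on_bounded_set_Lp[OF f _ p f_Lp] ball_fin) auto
    show "AE x in lborel. norm (f x * complex_of_real (\<theta> j x)) \<le> norm (indicator (cball 0 (R + 1)) x *\<^sub>R f x)" for j
      using \<theta>_le[of j] \<theta>01[of j]
      by (auto simp: norm_mult mult.commute[of "cmod (f _)"] intro!: mult_right_mono)
    show "AE x in lborel. (\<lambda>j. f x * complex_of_real (\<theta> j x)) \<longlonglongrightarrow> f x * indicator T x"
    proof (intro always_eventually allI tendsto_mult tendsto_const)
      fix x
      have "(\<lambda>j. complex_of_real (\<theta> j x)) \<longlonglongrightarrow> complex_of_real (indicator T x)"
        by (intro tendsto_of_real \<theta>_lim)
      then show "(\<lambda>j. complex_of_real (\<theta> j x)) \<longlonglongrightarrow> indicator T x" by (cases "x \<in> T") simp_all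
    qed
  qed auto
  have l2: "(\<lambda>j. \<integral>x. \<theta> j x \<partial>lborel) \<longlonglongrightarrow> (\<integral>x. indicator T x \<partial>lborel)"
  proof (rule integral_dominated_convergence[where w = "indicator (cball 0 (R + 1))"])
    show "integrable lborel (indicator (cball 0 (R + 1)) :: real^'n \<Rightarrow> real)"
      by (rule integrable_real_indicator) (use ball_fin in auto)
    show "AE x in lborel. norm (\<theta> j x) \<le> indicator (cball 0 (R + 1)) x" for j
      using \<theta>_le[of j] \<theta>01[of j] by simp
  qed (use \<theta>_lim in auto)
  have "cmod ((\<integral>z. \<phi> z \<partial>lborel) * (\<integral>x. f x * indicator T x \<partial>lborel)) \<le> B * (\<integral>x. indicator T x \<partial>lborel)"
  proof (rule LIMSEQ_le)
    show "(\<lambda>j. cmod ((\<integral>z. \<phi> z \<partial>lborel) * (\<integral>x. f x * \<theta> j x \<partial>lborel)))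
        \<longlonglongrightarrow> cmod ((\<integral>z. \<phi> z \<partial>lborel) * (\<integral>x. f x * indicator T x \<partial>lborel))"
      by (intro tendsto_intros l1)
    show "(\<lambda>j. B * (\<integral>x. \<theta> j x \<partial>lborel)) \<longlonglongrightarrow> B * (\<integral>x. indicator T x \<partial>lborel)"
      by (intro tendsto_intros l2)
    show "\<exists>N. \<forall>j\<ge>N. cmod ((\<integral>z. \<phi> z \<partial>lborel) * (\<integral>x. f x * \<theta> j x \<partial>lborel)) \<le> B * (\<integral>x. \<theta> j x \<partial>lborel)"
      using integral_test_function_le[OF \<theta>_cont \<theta>01, of "R + 1"] supp by blast
  qed
  moreover have "f x * indicator T x = indicator T x *\<^sub>R f x" for x by (simp add: indicator_def)
  ultimately show ?thesis by simp
qed simp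

text \<open>If the bound failed on a set of positive measure, that set would contain a compact
  \<open>T\<close> of positive measure. On \<open>T\<close> the real part exceeds \<open>b\<close>,
  which contradicts \<open>integral_compact_le\<close>.\<close>

lemma AE_Re_le:
  assumes c: "(\<integral>z. \<phi> z \<partial>lborel) \<noteq> 0" and \<omega>: "cmod \<omega> = 1"
  shows "AE x in lborel. Re (\<omega> * f x) \<le> B / cmod (\<integral>z. \<phi> z \<partial>lborel)"
proof (rule ccontr)
  define b where "b = B / cmod (\<integral>z. \<phi> z \<partial>lborel)"
  define S where "S = {x. b < Re (\<omega> * f x)}"
  have Sm [measurable]: "S \<in> sets borel" unfolding S_def by measurable
  assume "\<not> (AE x in lborel. Re (\<omega> * f x) \<le> B / cmod (\<integral>z. \<phi> z \<partial>lborel))"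
  then have "S \<notin> null_sets lborel"
    using AE_iff_null_sets[of S lborel] by (auto simp: S_def b_def not_less)
  \<comment> \<open>Intersecting with a ball makes the measure finite and closed subsets
    compact.\<close>
  moreover have "S = (\<Union>m::nat. S \<inter> cball 0 (real m))"
    using real_arch_simple by auto
  ultimately obtain m :: nat where "S \<inter> cball 0 (real m) \<notin> null_sets lborel"
    by (metis null_sets_UN)
  define A where "A = S \<inter> cball 0 (real m)"
  have Am [measurable]: "A \<in> sets borel" by (simp add: A_def)
  have A0: "emeasure lborel A \<noteq> 0"
    using \<open>S \<inter> cball 0 (real m) \<notin> null_sets lborel\<close> Am unfolding A_def by (auto simp: null_sets_def)
  have "emeasure lborel A \<le> emeasure lborel (cball (0::real^'n) (real m))"
    by (intro emeasure_mono) (auto simp: A_def)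
  then have A_fin: "emeasure lborel A < \<infinity>" by (rule le_less_trans) simp
  define e where "e = measure lborel A"
  have e: "emeasure lborel A = ennreal e" using A_fin by (simp add: e_def emeasure_eq_ennreal_measure)
  have "e > 0" using A0 e by (metis ennreal_eq_0_iff not_le)
  \<comment> \<open>Inner regularity with the whole measure of \<open>A\<close> as tolerance: what
    is left out is strictly smaller than \<open>A\<close>, so \<open>T\<close> is not a null
    set.\<close>
  obtain T where T': "closed T" "T \<subseteq> A" "emeasure lebesgue (A - T) < ennreal e"
    using sets_lebesgue_inner_closed[of A e] \<open>e > 0\<close> by (metis Am sets_completionI_sets sets_lborel)
  have "bounded T" 
    by (rule bounded_subset[OF bounded_cball[of 0 "real m"]]) (use T'(2) in \<open>auto simp: A_def\<close>)
  then have T: "T \<subseteq> S" "compact T" using T' by (auto simp: A_def compact_eq_bounded_closed)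
  have Tm [measurable]: "T \<in> sets borel" using T by (simp add: borel_compact)
  have T0: "emeasure lborel T \<noteq> 0"
  proof
    assume "emeasure lborel T = 0"
    have "emeasure lborel A \<le> emeasure lborel T + emeasure lborel (A - T)"
      using T'(2) emeasure_subadditive[of T lborel "A - T"] by (simp add: Un_absorb1)
    then show False using \<open>emeasure lborel T = 0\<close> T'(3) e by simp
  qed
  have T_fin: "emeasure lborel T < \<infinity>" using T(2) by (rule emeasure_compact_finite)
  have int: "integrable lborel (\<lambda>x. indicator T x *\<^sub>R f x)"
    by (rule integrable_on_bounded_set_Lp[OF f Tm p f_Lp T_fin])
  define g where "g x = Re (\<omega> * (indicator T x *\<^sub>R f x)) - b * indicator T x" for x
  have intT: "integrable lborel (indicator T :: real^'n \<Rightarrow> real)"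
    by (rule integrable_real_indicator) (use T_fin in auto)
  have g_int: "integrable lborel g"
    unfolding g_def by (intro Bochner_Integration.integrable_diff integrable_Re integrable_mult_right int intT)
  have g_pos: "g x > 0" if "x \<in> T" for x using T(1) that by (auto simp: g_def S_def)
  have g_zero: "g x = 0" if "x \<notin> T" for x using that by (simp add: g_def)
  have "(\<integral>x. g x \<partial>lborel) = Re (\<omega> * (\<integral>x. indicator T x *\<^sub>R f x \<partial>lborel)) - b * measure lborel T"
  proof -
    have "(\<integral>x. Re (\<omega> * (indicator T x *\<^sub>R f x)) \<partial>lborel) = Re (\<integral>x. \<omega> * (indicator T x *\<^sub>R f x) \<partial>lborel)"
      by (rule integral_Re) (intro integrable_mult_right int)
    also have "\<dots> = Re (\<omega> * (\<integral>x. indicator T x *\<^sub>R f x \<partial>lborel))"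
      by (simp only: integral_mult_right_zero)
    finally have *: "(\<integral>x. Re (\<omega> * (indicator T x *\<^sub>R f x)) \<partial>lborel) = Re (\<omega> * (\<integral>x. indicator T x *\<^sub>R f x \<partial>lborel))" .
    have "integrable lborel (\<lambda>x. Re (\<omega> * (indicator T x *\<^sub>R f x)))"
      by (intro integrable_Re integrable_mult_right int)
    moreover have "integrable lborel (\<lambda>x. b * indicator T x)" by (intro integrable_mult_right intT)
    ultimately show ?thesis unfolding g_def by (subst Bochner_Integration.integral_diff) (simp_all only: *, simp)
  qed
  also have "Re (\<omega> * (\<integral>x. indicator T x *\<^sub>R f x \<partial>lborel)) \<le> cmod (\<omega> * (\<integral>x. indicator T x *\<^sub>R f x \<partial>lborel))"
    by (rule complex_Re_le_cmod)
  also have "\<dots> \<le> b * measure lborel T"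
    using integral_compact_le[OF T(2)] c \<omega> by (simp add: norm_mult b_def field_simps)
  finally have "(\<integral>x. g x \<partial>lborel) \<le> 0" by simp
  moreover have g_nonneg: "AE x in lborel. 0 \<le> g x"
    using g_pos g_zero by (intro always_eventually allI) (metis less_imp_le order_refl)
  ultimately have "(\<integral>x. g x \<partial>lborel) = 0" using integral_nonneg_AE[OF g_nonneg] by simp
  then have "AE x in lborel. g x = 0" using integral_nonneg_eq_0_iff_AE[OF g_int g_nonneg] by simp
  then have "AE x in lborel. x \<notin> T" by eventually_elim (use g_pos in force)
  then have "emeasure lborel T = 0" using AE_iff_measurable[of T lborel "\<lambda>x. x \<notin> T"] by simp
  then show False using T0 by simp
qed

text \<open>The directions 1, -1, i, -i bound |Re f| and |Im f|, and |f| is at most their sum; hence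
  the factor 2.\<close>

lemma AE_norm_le:
  assumes c: "(\<integral>z. \<phi> z \<partial>lborel) \<noteq> 0"
  shows "AE x in lborel. cmod (f x) \<le> 2 * B / cmod (\<integral>z. \<phi> z \<partial>lborel)"
proof -
  have "AE x in lborel. Re (1 * f x) \<le> B / cmod (\<integral>z. \<phi> z \<partial>lborel)"
    "AE x in lborel. Re ((-1) * f x) \<le> B / cmod (\<integral>z. \<phi> z \<partial>lborel)"
    "AE x in lborel. Re (\<i> * f x) \<le> B / cmod (\<integral>z. \<phi> z \<partial>lborel)"
    "AE x in lborel. Re ((-\<i>) * f x) \<le> B / cmod (\<integral>z. \<phi> z \<partial>lborel)"
    by (intro AE_Re_le c; simp)+
  then show ?thesis
  proof eventually_elim
    case (elim x)
    then show ?case using cmod_le[of "f x"] by simp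
  qed
qed

end

section \<open>Frequency decomposition\<close>

lemma fourier_cmult: "fourier (\<lambda>\<xi>. c * h \<xi>) x = c * fourier h x"
  unfolding fourier_def by (simp only: mult.left_commute[of _ c] integral_mult_right_zero)

lemma fourier_distr_cmult: "fourier_distr f (\<lambda>\<xi>. c * h \<xi>) = c * fourier_distr f h"
  unfolding fourier_distr_def fourier_cmult by (simp only: mult.left_commute[of _ c] integral_mult_right_zero)

text \<open>Identifies the distributional pairing with an average of \<open>f\<close> at centre
  \<open>y\<close> and scale \<open>t\<close>. The Jacobian t^n cancels the factor t^-n of
  \<open>fourier_dilation\<close>.\<close>

lemma fourier_distr_modulated_dilation:
  fixes f h :: "real^'n \<Rightarrow> complex"
  assumes f [measurable]: "f \<in> borel_measurable borel" and h [measurable]: "h \<in> borel_measurable borel" and t: "t > 0"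
  shows "fourier_distr f (\<lambda>\<xi>. cis (y \<bullet> \<xi>) * h (t *\<^sub>R \<xi>)) = (\<integral>z. f (y + t *\<^sub>R z) * fourier h z \<partial>lborel)"
proof -
  let ?h = "\<lambda>\<xi>. cis (y \<bullet> \<xi>) * h (t *\<^sub>R \<xi>)"
  have [measurable]: "fourier ?h \<in> borel_measurable borel" by (intro fourier_measurable) measurable
  have "fourier_distr f ?h = (\<integral>x. f x * fourier ?h x \<partial>lborel)"
    unfolding fourier_distr_def by (rule integral_completion) simp
  also have "\<dots> = of_real (t ^ CARD('n)) * (\<integral>z. f (y + t *\<^sub>R z) * fourier ?h (y + t *\<^sub>R z) \<partial>lborel)"
    using t by (subst integral_lborel_affine[of _ t y]) simp_all
  also have "(\<integral>z. f (y + t *\<^sub>R z) * fourier ?h (y + t *\<^sub>R z) \<partial>lborel)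
      = (\<integral>z. of_real (1 / t ^ CARD('n)) * (f (y + t *\<^sub>R z) * fourier h z) \<partial>lborel)"
    unfolding fourier_dilation[OF h t] by (simp only: mult.left_commute)
  also have "of_real (t ^ CARD('n)) * \<dots> = (\<integral>z. f (y + t *\<^sub>R z) * fourier h z \<partial>lborel)"
    using t by (simp only: integral_mult_right_zero) simp
  finally show ?thesis .
qed

definition low_pass :: "real^'n \<Rightarrow> complex" where
  "low_pass \<xi> = of_real (cutoff 1 ((norm \<xi>)\<^sup>2))"

text \<open>The parameter 1/4 is that of the low-pass symbol dilated by 1/2.\<close>

definition band_pass :: "real^'n \<Rightarrow> complex" where
  "band_pass \<xi> = of_real (cutoff (1 / 4) ((norm \<xi>)\<^sup>2) - cutoff 1 ((norm \<xi>)\<^sup>2))"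

text \<open>The band-pass symbol divided by |xi|^s. It is written as a power of |xi|^2 to be a flat
  profile; at 0 it vanishes because 0 \<open>powr\<close> anything is 0.\<close>

definition riesz_band_pass :: "real \<Rightarrow> real^'n \<Rightarrow> complex" where
  "riesz_band_pass s \<xi> = of_real (((norm \<xi>)\<^sup>2) powr (- s / 2) * (cutoff (1 / 4) ((norm \<xi>)\<^sup>2) - cutoff 1 ((norm \<xi>)\<^sup>2)))"

lemma schwartz_low_pass: "schwartz low_pass"
  unfolding low_pass_def[abs_def] by (rule schwartz_cutoff) simp

lemma schwartz_band_pass: "schwartz band_pass"
  unfolding band_pass_def[abs_def] by (rule schwartz_flat_profile[OF cutoff_diff_flat]) simp_all

lemma schwartz_riesz_band_pass: "schwartz (riesz_band_pass s)"
  unfolding riesz_band_pass_def[abs_def]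
  by (rule schwartz_flat_profile[OF flat_profiles.mult_powr[OF cutoff_diff_flat]]) simp_all

lemma low_pass_0: "low_pass 0 = 1"
  by (simp add: low_pass_def)

lemma band_pass_eq: "band_pass \<xi> = low_pass ((1 / 2) *\<^sub>R \<xi>) - low_pass \<xi>"
  using cutoff_scale[of "1 / 4" 1 "(norm \<xi>)\<^sup>2"]
  by (simp add: band_pass_def low_pass_def power_mult_distrib power_divide)

lemma riesz_band_pass_eq:
  assumes "t > 0"
  shows "of_real (norm \<xi> powr s) * riesz_band_pass s (t *\<^sub>R \<xi>) = of_real (t powr - s) * band_pass (t *\<^sub>R \<xi>)"
proof (cases "\<xi> = 0")
  case False
  then have "norm \<xi> powr s * ((norm (t *\<^sub>R \<xi>))\<^sup>2) powr (- s / 2) = t powr - s"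
    using assms by (simp add: powr_powr powr_mult flip: powr_numeral) (simp add: powr_minus)
  then show ?thesis
    unfolding riesz_band_pass_def band_pass_def of_real_mult[symmetric] mult.assoc[symmetric] by simp
qed (simp add: riesz_band_pass_def band_pass_def)

text \<open>The definition of \<open>is_frac_laplacian\<close>, tested on the modulated and dilated
  \<open>riesz_band_pass\<close>. Multiplying that symbol by |xi|^s leaves t^-s times the band-pass
  symbol, whence the gain t^s at small scales.\<close>

lemma band_pass_average:
  fixes f g :: "real^'n \<Rightarrow> complex"
  assumes f: "f \<in> borel_measurable borel" and g: "g \<in> borel_measurable borel"
    and lap: "is_frac_laplacian s f g" and t: "t > 0"
  shows "(\<integral>z. f (y + t *\<^sub>R z) * fourier band_pass z \<partial>lborel)
    = of_real (t powr s) * (\<integral>z. g (y + t *\<^sub>R z) * fourier (riesz_band_pass s) z \<partial>lborel)"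
proof -
  let ?\<psi> = "\<lambda>\<xi>. cis (y \<bullet> \<xi>) * riesz_band_pass s (t *\<^sub>R \<xi>)"
  note m = schwartz_measurable[OF schwartz_band_pass] schwartz_measurable[OF schwartz_riesz_band_pass]
  have "schwartz ?\<psi>"
    using t by (intro schwartz_cis schwartz_dilation schwartz_riesz_band_pass) simp
  then have "fourier_distr g ?\<psi> = fourier_distr f (\<lambda>\<xi>. of_real (norm \<xi> powr s) * ?\<psi> \<xi>)"
    using lap unfolding is_frac_laplacian_def by blast
  also have "(\<lambda>\<xi>. of_real (norm \<xi> powr s) * ?\<psi> \<xi>)
      = (\<lambda>\<xi>. of_real (t powr - s) * (cis (y \<bullet> \<xi>) * band_pass (t *\<^sub>R \<xi>)))"
    by (simp add: mult.left_commute[of "of_real _" "cis _"] riesz_band_pass_eq[OF t])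
  also have "fourier_distr f \<dots> = of_real (t powr - s) * fourier_distr f (\<lambda>\<xi>. cis (y \<bullet> \<xi>) * band_pass (t *\<^sub>R \<xi>))"
    by (rule fourier_distr_cmult)
  finally have "(\<integral>z. g (y + t *\<^sub>R z) * fourier (riesz_band_pass s) z \<partial>lborel)
      = of_real (t powr - s) * (\<integral>z. f (y + t *\<^sub>R z) * fourier band_pass z \<partial>lborel)"
    unfolding fourier_distr_modulated_dilation[OF g m(2) t] fourier_distr_modulated_dilation[OF f m(1) t] .
  then show ?thesis using t by (simp add: powr_minus)
qed

text \<open>Averaging at scale t/2 against the low-pass kernel is averaging at scale t against the
  transform of low_pass(xi/2), and that symbol is the sum of \<open>low_pass\<close> and
  \<open>band_pass\<close>.\<close>

lemma low_pass_average_half: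
  fixes f :: "real^'n \<Rightarrow> complex"
  assumes f: "f \<in> borel_measurable borel" and t: "t > 0"
    and int: "\<And>h. schwartz h \<Longrightarrow> integrable lborel (\<lambda>z. f (y + t *\<^sub>R z) * fourier h z)"
  shows "(\<integral>z. f (y + (t / 2) *\<^sub>R z) * fourier low_pass z \<partial>lborel)
    = (\<integral>z. f (y + t *\<^sub>R z) * fourier low_pass z \<partial>lborel) + (\<integral>z. f (y + t *\<^sub>R z) * fourier band_pass z \<partial>lborel)"
proof -
  let ?h = "\<lambda>\<xi>::real^'n. low_pass ((1 / 2) *\<^sub>R \<xi>)"
  note m = schwartz_measurable[OF schwartz_low_pass]
  have h: "schwartz ?h" by (intro schwartz_dilation schwartz_low_pass) simp
  have diff: "(\<lambda>\<xi>. ?h \<xi> - low_pass \<xi>) \<in> borel_measurable borel"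
    by (intro borel_measurable_diff schwartz_measurable h schwartz_low_pass)
  have "fourier band_pass z = fourier ?h z - fourier low_pass z" for z :: "real^'n"
    unfolding band_pass_eq[abs_def] fourier_lborel[OF diff] fourier_lborel[OF schwartz_measurable[OF h]] fourier_lborel[OF m]
    using integrable_cis_mult[OF schwartz_integrable[OF h], of z]
      integrable_cis_mult[OF schwartz_integrable[OF schwartz_low_pass], of z]
    by (simp add: right_diff_distrib)
  then have "(\<integral>z. f (y + t *\<^sub>R z) * fourier band_pass z \<partial>lborel)
      = (\<integral>z. f (y + t *\<^sub>R z) * fourier ?h z \<partial>lborel) - (\<integral>z. f (y + t *\<^sub>R z) * fourier low_pass z \<partial>lborel)"
    using int[OF h] int[OF schwartz_low_pass] by (simp add: right_diff_distrib)
  moreover have "(\<integral>z. f (y + t *\<^sub>R z) * fourier ?h z \<partial>lborel) = (\<integral>z. f (y + (t / 2) *\<^sub>R z) * fourier low_pass z \<partial>lborel)"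
    using fourier_distr_modulated_dilation[OF f schwartz_measurable[OF h] t, of y]
      fourier_distr_modulated_dilation[OF f m, of "t / 2" y] t by simp
  ultimately show ?thesis by simp
qed

text \<open>The first \<open>K\<close> increments are bounded by \<open>X\<close>, the later ones by
  the geometric series. The free choice of \<open>K\<close> is the source of the logarithm.\<close>

lemma norm_le_telescoping:
  fixes F :: "nat \<Rightarrow> 'a::real_normed_vector"
  assumes a: "0 < a" "a < 1" and "0 \<le> X" "0 \<le> Y"
    and X: "\<And>k. norm (F (Suc k) - F k) \<le> X" and Y: "\<And>k. norm (F (Suc k) - F k) \<le> Y * a ^ k"
  shows "norm (F k) \<le> norm (F 0) + real K * X + Y * a ^ K / (1 - a)"
proof -
  \<comment> \<open>With \<open>min\<close> and \<open>max\<close> one invariant covers both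
    regimes: the last term is the sum of Y a^j over K <= j < k, and it is 0 while k <= K.\<close>
  have "norm (F k) \<le> norm (F 0) + real (min k K) * X + Y * (a ^ K - a ^ max k K) / (1 - a)"
  proof (induction k)
    case 0
    then show ?case by simp
  next
    case (Suc k)
    have tri: "norm (F (Suc k)) \<le> norm (F k) + norm (F (Suc k) - F k)"
      by (metis add_diff_cancel_left' add_diff_eq norm_triangle_ineq)
    show ?case
    proof (cases "k < K")
      case True
      then show ?thesis using Suc X[of k] tri by (simp add: algebra_simps)
    next
      case False
      have "Y * a ^ k = Y * (a ^ k - a ^ Suc k) / (1 - a)" using a by (simp add: field_simps)
      then have "Y * (a ^ K - a ^ k) / (1 - a) + Y * a ^ k = Y * (a ^ K - a ^ Suc k) / (1 - a)"
        by (simp add: add_divide_distrib[symmetric] distrib_left[symmetric])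
      then show ?thesis using Suc Y[of k] tri False by simp
    qed
  qed
  also have "\<dots> \<le> norm (F 0) + real K * X + Y * a ^ K / (1 - a)"
    using a assms(3,4) by (intro add_mono divide_right_mono mult_right_mono mult_left_mono) auto
  finally show ?thesis .
qed

section \<open>The almost everywhere bound for Borel functions\<close>

lemma Lp_norm_le_iff:
  assumes "p > 0" "\<Lambda> \<ge> 0"
  shows "Lp_norm p f \<le> ennreal \<Lambda> \<longleftrightarrow> (\<integral>\<^sup>+x. ennreal (cmod (f x) powr p) \<partial>lborel) \<le> ennreal (\<Lambda> powr p)"
  unfolding Lp_norm_def nn_integral_completion by (rule enn_powr_le_iff[OF assms])

text \<open>\<open>D\<close> is fixed before \<alpha> and the functions. The norms enter through
  positive upper bounds because the weighted inequalities divide by powers of them.\<close>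

lemma AE_bound_borel:
  fixes p q s :: real
  assumes n: "CARD('n::finite) \<ge> 2" and q: "1 < q" and s: "real CARD('n) / q < s" and p: "1 \<le> p"
  obtains D where "D \<ge> 0"
    "\<And>\<alpha> (f :: real^'n \<Rightarrow> complex) g \<Lambda>\<^sub>1 \<Lambda>\<^sub>2 \<Lambda>\<^sub>3. \<lbrakk>\<alpha> < 1; f \<in> borel_measurable borel; g \<in> borel_measurable borel;
      is_frac_laplacian s f g; 0 < \<Lambda>\<^sub>1; 0 < \<Lambda>\<^sub>2; 0 < \<Lambda>\<^sub>3;
      Lp_norm p f \<le> ennreal \<Lambda>\<^sub>1; Q_norm \<alpha> f \<le> ennreal \<Lambda>\<^sub>2; Lp_norm q g \<le> ennreal \<Lambda>\<^sub>3\<rbrakk>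
      \<Longrightarrow> AE x in lborel. cmod (f x) \<le> D * (1 + (\<Lambda>\<^sub>1 + \<Lambda>\<^sub>2) * ln (exp 1 + \<Lambda>\<^sub>3))"
proof -
  \<comment> \<open>The gain t^s against the loss t^(-n/q) leaves t^\<delta>, so halving the scale
    improves the second bound by the factor \<open>a\<close>.\<close>
  define \<delta> where "\<delta> = s - real CARD('n) / q"
  have \<delta>: "\<delta> > 0" using s by (simp add: \<delta>_def)
  define a where "a = 2 powr - \<delta>"
  have "2 powr - \<delta> < 2 powr (0::real)" using \<delta> by (intro powr_less_mono) auto
  then have a: "0 < a" "a < 1" by (simp_all add: a_def)
  \<comment> \<open>The order of decay required by \<open>mean_zero_kernel_le_Q_norm\<close>; it
    also exceeds n, as integrability demands.\<close>
  define N where "N = Suc (2 * CARD('n))"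
  have N: "CARD('n) < N" by (simp add: N_def)
  define W where "W = enn2real (\<integral>\<^sup>+z. ennreal (1 / (1 + norm (z::real^'n)) ^ N) \<partial>lborel) + 1"
  have W: "W > 0" by (simp add: W_def add_nonneg_pos)
  obtain Cl where Cl: "\<And>z::real^'n. cmod (fourier low_pass z) \<le> Cl / (1 + norm z) ^ N"
    using fourier_decay[OF schwartz_low_pass] by blast
  obtain Cb where Cb: "\<And>z::real^'n. cmod (fourier band_pass z) \<le> Cb / (1 + norm z) ^ N"
    using fourier_decay[OF schwartz_band_pass] by blast
  obtain Cr where Cr: "\<And>z::real^'n. cmod (fourier (riesz_band_pass s) z) \<le> Cr / (1 + norm z) ^ N"
    using fourier_decay[OF schwartz_riesz_band_pass] by blast
  have nonneg: "0 \<le> Cl" "0 \<le> Cb" "0 \<le> Cr"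
    using order_trans[OF norm_ge_zero Cl[of 0]] order_trans[OF norm_ge_zero Cb[of 0]]
      order_trans[OF norm_ge_zero Cr[of 0]] by simp_all
  obtain K\<^sub>Q where K\<^sub>Q: "K\<^sub>Q \<ge> 0"
    and Q: "\<And>\<alpha> (f :: real^'n \<Rightarrow> complex) \<Lambda> x t \<psi> C. \<lbrakk>\<alpha> < 1; f \<in> borel_measurable borel; \<Lambda> > 0;
      Q_norm \<alpha> f \<le> ennreal \<Lambda>; t > 0; \<And>z. cmod (\<psi> z) \<le> C / (1 + norm z) ^ N;
      integrable lborel \<psi>; (\<integral>z. \<psi> z \<partial>lborel) = 0; integrable lborel (\<lambda>z. f (x + t *\<^sub>R z) * \<psi> z)\<rbrakk>
      \<Longrightarrow> cmod (\<integral>z. f (x + t *\<^sub>R z) * \<psi> z \<partial>lborel) \<le> K\<^sub>Q * C * \<Lambda>"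
    using mean_zero_kernel_le_Q_norm[OF n] unfolding N_def by blast
  define c where "c = cmod (\<integral>z. fourier low_pass (z :: real^'n) \<partial>lborel)"
  have c: "c > 0"
    using integral_fourier[OF schwartz_low_pass, where 'n = 'n] by (simp add: c_def low_pass_0)
  \<comment> \<open>Rounding up L / (\<delta> ln 2) adds at most 1, and 1 <= L, so the number of
    scales is at most \<open>\<kappa>\<close> times L.\<close>
  define \<kappa> where "\<kappa> = 1 / (\<delta> * ln 2) + 1"
  have \<kappa>: "\<kappa> \<ge> 0" using \<delta> by (simp add: \<kappa>_def)
  define D where "D = 2 * (Cl * W + \<kappa> * (K\<^sub>Q * Cb) + Cr * W / (1 - a)) / c"
  show ?thesis
  proof (rule that[of D])
    show "0 \<le> D" using nonneg W K\<^sub>Q \<kappa> a c by (simp add: D_def)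
  next
    fix \<alpha> and f g :: "real^'n \<Rightarrow> complex" and \<Lambda>\<^sub>1 \<Lambda>\<^sub>2 \<Lambda>\<^sub>3
    assume \<alpha>: "\<alpha> < 1" and f: "f \<in> borel_measurable borel" and g: "g \<in> borel_measurable borel"
      and lap: "is_frac_laplacian s f g" and \<Lambda>: "0 < \<Lambda>\<^sub>1" "0 < \<Lambda>\<^sub>2" "0 < \<Lambda>\<^sub>3"
      and f_p: "Lp_norm p f \<le> ennreal \<Lambda>\<^sub>1" and f_Q: "Q_norm \<alpha> f \<le> ennreal \<Lambda>\<^sub>2" and g_q: "Lp_norm q g \<le> ennreal \<Lambda>\<^sub>3"
    have f_int: "(\<integral>\<^sup>+x. ennreal (cmod (f x) powr p) \<partial>lborel) \<le> ennreal (\<Lambda>\<^sub>1 powr p)"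
      using f_p Lp_norm_le_iff[of p \<Lambda>\<^sub>1 f] p \<Lambda> by simp
    have g_int: "(\<integral>\<^sup>+x. ennreal (cmod (g x) powr q) \<partial>lborel) \<le> ennreal (\<Lambda>\<^sub>3 powr q)"
      using g_q Lp_norm_le_iff[of q \<Lambda>\<^sub>3 g] q \<Lambda> by simp
    have fm: "fourier h \<in> borel_measurable borel" if "schwartz h" for h :: "real^'n \<Rightarrow> complex"
      by (intro fourier_measurable schwartz_measurable that)
    have int: "integrable lborel (\<lambda>z. f (y + t *\<^sub>R z) * fourier h z)" if t: "t > 0" and h: "schwartz h" for y t h
    proof -
      obtain C where "\<And>z. cmod (fourier h z) \<le> C / (1 + norm z) ^ N" using fourier_decay[OF h] by blast
      then show ?thesis by (rule decay_kernel_bound(1)[OF f fm[OF h] p t \<Lambda>(1) f_int N])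
    qed
    define t where "t k = (1 / 2 :: real) ^ k" for k
    have t: "t k > 0" "t (Suc k) = t k / 2" for k by (simp_all add: t_def)
    define F where "F k y = (\<integral>z. f (y + t k *\<^sub>R z) * fourier low_pass z \<partial>lborel)" for k y
    have step: "F (Suc k) y - F k y = (\<integral>z. f (y + t k *\<^sub>R z) * fourier band_pass z \<partial>lborel)" for k y
      unfolding F_def t(2) using low_pass_average_half[OF f t(1) int[OF t(1)], of y k] by simp
    have F0: "cmod (F 0 y) \<le> Cl * \<Lambda>\<^sub>1 * W" for y
      using decay_kernel_bound(2)[OF f fm[OF schwartz_low_pass] p t(1) \<Lambda>(1) f_int N Cl, of y 0]
      by (simp add: F_def t_def W_def)
    have step_Q: "cmod (F (Suc k) y - F k y) \<le> K\<^sub>Q * Cb * \<Lambda>\<^sub>2" for k y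
      unfolding step
    proof (rule Q[OF \<alpha> f \<Lambda>(2) f_Q t(1) Cb])
      show "integrable lborel (fourier (band_pass :: real^'n \<Rightarrow> complex))" by (rule fourier_integrable[OF schwartz_band_pass])
      \<comment> \<open>The mean is (2 pi)^n times the symbol at 0, where both cutoffs equal
        1.\<close>
      show "(\<integral>z. fourier band_pass (z :: real^'n) \<partial>lborel) = 0"
        using integral_fourier[OF schwartz_band_pass, where 'n = 'n] by (simp add: band_pass_def)
      show "integrable lborel (\<lambda>z. f (y + t k *\<^sub>R z) * fourier band_pass z)"
        by (rule int[OF t(1) schwartz_band_pass])
    qed
    have step_g: "cmod (F (Suc k) y - F k y) \<le> Cr * W * \<Lambda>\<^sub>3 * a ^ k" for k y
    proof -
      have "cmod (F (Suc k) y - F k y) = t k powr s * cmod (\<integral>z. g (y + t k *\<^sub>R z) * fourier (riesz_band_pass s) z \<partial>lborel)"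
        unfolding step band_pass_average[OF f g lap t(1)] by (simp add: norm_mult)
      also have "\<dots> \<le> t k powr s * (Cr * (t k powr (- real CARD('n) / q) * \<Lambda>\<^sub>3) * W)"
        unfolding W_def using q
        by (intro mult_left_mono decay_kernel_bound(2)[OF g fm[OF schwartz_riesz_band_pass] _ t(1) \<Lambda>(3) g_int N Cr]) auto
      also have "\<dots> = Cr * W * \<Lambda>\<^sub>3 * (t k powr s * t k powr (- real CARD('n) / q))" by simp
      also have "t k powr s * t k powr (- real CARD('n) / q) = a ^ k"
      proof -
        have "t k powr s * t k powr (- real CARD('n) / q) = t k powr \<delta>" by (simp add: \<delta>_def flip: powr_add)
        also have "\<dots> = (2 powr - real k) powr \<delta>"
          by (simp add: t_def powr_minus powr_realpow power_one_over field_simps)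
        also have "\<dots> = (2 powr - \<delta>) powr real k" by (simp add: powr_powr mult.commute)
        also have "\<dots> = a ^ k" unfolding a_def[symmetric] using a by (simp add: powr_realpow)
        finally show ?thesis .
      qed
      finally show ?thesis .
    qed
    define L where "L = ln (exp 1 + \<Lambda>\<^sub>3)"
    have L: "L \<ge> 1" using \<Lambda>(3) ln_mono[of "exp 1" "exp 1 + \<Lambda>\<^sub>3"] by (simp add: L_def)
    \<comment> \<open>Chosen so that 2^(\<delta> K) >= exp L >= \<open>\<Lambda>\<^sub>3\<close>;
      the geometric tail then no longer depends on \<open>\<Lambda>\<^sub>3\<close>.\<close>
    define K where "K = nat \<lceil>L / (\<delta> * ln 2)\<rceil>"
    have K_ge: "L / (\<delta> * ln 2) \<le> real K" unfolding K_def by (rule real_nat_ceiling_ge)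
    have K_le: "real K \<le> \<kappa> * L"
    proof -
      have "0 \<le> L / (\<delta> * ln 2)" using L \<delta> by simp
      then have "real K \<le> L / (\<delta> * ln 2) + 1" unfolding K_def by linarith
      also have "\<dots> \<le> \<kappa> * L" using L by (simp add: \<kappa>_def distrib_right)
      finally show ?thesis .
    qed
    have aK: "\<Lambda>\<^sub>3 * a ^ K \<le> 1"
    proof -
      have "L \<le> real K * (\<delta> * ln 2)" using K_ge \<delta> by (simp add: divide_le_eq)
      have "\<Lambda>\<^sub>3 \<le> exp 1 + \<Lambda>\<^sub>3" by simp
      also have "\<dots> = exp L" unfolding L_def using \<Lambda>(3) by (intro exp_ln[symmetric] add_pos_pos) auto
      also have "\<dots> \<le> exp (real K * (\<delta> * ln 2))" using \<open>L \<le> real K * (\<delta> * ln 2)\<close> by simp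
      finally have "\<Lambda>\<^sub>3 \<le> exp (real K * (\<delta> * ln 2))" .
      moreover have "a ^ K = 1 / exp (real K * (\<delta> * ln 2))"
        by (simp add: a_def powr_def exp_minus field_simps flip: exp_of_nat_mult)
      ultimately show ?thesis by (simp add: divide_le_eq)
    qed
    define B where "B = Cl * \<Lambda>\<^sub>1 * W + real K * (K\<^sub>Q * Cb * \<Lambda>\<^sub>2) + Cr * W * \<Lambda>\<^sub>3 * a ^ K / (1 - a)"
    have F_le: "cmod (F k y) \<le> B" for k y
    proof -
      have "cmod (F k y) \<le> cmod (F 0 y) + real K * (K\<^sub>Q * Cb * \<Lambda>\<^sub>2) + Cr * W * \<Lambda>\<^sub>3 * a ^ K / (1 - a)"
        using a nonneg W K\<^sub>Q \<Lambda> step_Q step_g by (intro norm_le_telescoping[of a _ _ "\<lambda>k. F k y"]) auto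
      then show ?thesis using F0[of y] by (simp add: B_def)
    qed
    interpret bounded_averages f "fourier low_pass" t p B
    proof
      show "(\<integral>\<^sup>+x. ennreal (cmod (f x) powr p) \<partial>lborel) < \<infinity>" using f_int by (rule le_less_trans) simp
      show "t \<longlonglongrightarrow> 0" unfolding t_def by (rule LIMSEQ_power_zero) simp
      show "cmod (\<integral>z. f (y + t k *\<^sub>R z) * fourier low_pass z \<partial>lborel) \<le> B" for k y
        using F_le unfolding F_def .
    qed (use f p fourier_integrable[OF schwartz_low_pass] in auto)
    have B_le: "B \<le> (Cl * W + \<kappa> * (K\<^sub>Q * Cb) + Cr * W / (1 - a)) * (1 + (\<Lambda>\<^sub>1 + \<Lambda>\<^sub>2) * L)"
    proof -
      define R where "R = 1 + (\<Lambda>\<^sub>1 + \<Lambda>\<^sub>2) * L"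
      have "\<Lambda>\<^sub>1 * 1 \<le> \<Lambda>\<^sub>1 * L" using \<Lambda> L by (intro mult_left_mono) auto
      moreover have "0 \<le> \<Lambda>\<^sub>1 * L" "0 \<le> \<Lambda>\<^sub>2 * L" using \<Lambda> L by auto
      ultimately have R: "\<Lambda>\<^sub>1 \<le> R" "\<Lambda>\<^sub>2 * L \<le> R" "1 \<le> R" by (auto simp: R_def distrib_right)
      have "Cl * W * \<Lambda>\<^sub>1 \<le> Cl * W * R" using nonneg W R by (intro mult_left_mono) auto
      moreover have "real K * (K\<^sub>Q * Cb * \<Lambda>\<^sub>2) \<le> \<kappa> * (K\<^sub>Q * Cb) * R"
      proof -
        have "real K * (K\<^sub>Q * Cb * \<Lambda>\<^sub>2) \<le> \<kappa> * L * (K\<^sub>Q * Cb * \<Lambda>\<^sub>2)"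
          using K_le K\<^sub>Q nonneg \<Lambda> by (intro mult_right_mono) auto
        also have "\<dots> = \<kappa> * (K\<^sub>Q * Cb) * (\<Lambda>\<^sub>2 * L)" by simp
        also have "\<dots> \<le> \<kappa> * (K\<^sub>Q * Cb) * R" using \<kappa> K\<^sub>Q nonneg R by (intro mult_left_mono) auto
        finally show ?thesis .
      qed
      moreover have "Cr * W * \<Lambda>\<^sub>3 * a ^ K / (1 - a) \<le> Cr * W / (1 - a) * R"
      proof -
        have "Cr * W * \<Lambda>\<^sub>3 * a ^ K / (1 - a) = Cr * W / (1 - a) * (\<Lambda>\<^sub>3 * a ^ K)" by simp
        also have "\<dots> \<le> Cr * W / (1 - a) * R" using aK R nonneg W a by (intro mult_left_mono) auto
        finally show ?thesis .
      qed
      ultimately have "B \<le> Cl * W * R + \<kappa> * (K\<^sub>Q * Cb) * R + Cr * W / (1 - a) * R"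
        unfolding B_def by (simp add: mult_ac)
      then show ?thesis unfolding R_def[symmetric] by (simp only: distrib_right)
    qed
    have "2 * B / c \<le> D * (1 + (\<Lambda>\<^sub>1 + \<Lambda>\<^sub>2) * L)"
    proof -
      have "2 * B / c \<le> 2 * ((Cl * W + \<kappa> * (K\<^sub>Q * Cb) + Cr * W / (1 - a)) * (1 + (\<Lambda>\<^sub>1 + \<Lambda>\<^sub>2) * L)) / c"
        using c by (intro divide_right_mono mult_left_mono B_le) auto
      then show ?thesis by (simp only: D_def times_divide_eq_left mult.assoc)
    qed
    moreover have "AE x in lborel. cmod (f x) \<le> 2 * B / c"
      using AE_norm_le c unfolding c_def by simp
    ultimately show "AE x in lborel. cmod (f x) \<le> D * (1 + (\<Lambda>\<^sub>1 + \<Lambda>\<^sub>2) * ln (exp 1 + \<Lambda>\<^sub>3))"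
      unfolding L_def by (auto elim!: eventually_mono)
  qed
qed

section \<open>Replacing Lebesgue measurable functions by Borel representatives\<close>

lemma lebesgue_AE_eq_borel:
  fixes f :: "'a::euclidean_space \<Rightarrow> complex"
  assumes "f \<in> borel_measurable lebesgue"
  obtains f' where "f' \<in> borel_measurable borel" "AE x in lebesgue. f x = f' x"
proof -
  have "(\<lambda>x. Re (f x)) \<in> borel_measurable lebesgue" "(\<lambda>x. Im (f x)) \<in> borel_measurable lebesgue"
    using assms by measurable
  then obtain u v where u: "u \<in> borel_measurable lborel" "AE x in lborel. Re (f x) = u x"
    and v: "v \<in> borel_measurable lborel" "AE x in lborel. Im (f x) = v x"
    using completion_ex_borel_measurable_real by metis
  have [measurable]: "u \<in> borel_measurable borel" "v \<in> borel_measurable borel" using u v by simp_all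
  have "AE x in lborel. f x = Complex (u x) (v x)"
    using u(2) v(2) by eventually_elim (simp add: complex_eq_iff)
  moreover have "(\<lambda>x. Complex (u x) (v x)) \<in> borel_measurable borel"
    unfolding Complex_eq by measurable
  ultimately show ?thesis using that AE_completion by blast
qed

lemma Lp_norm_cong_AE:
  assumes "AE x in lebesgue. f x = f' x"
  shows "Lp_norm p f = Lp_norm p f'"
proof -
  have "(\<integral>\<^sup>+x. ennreal (cmod (f x) powr p) \<partial>lebesgue) = (\<integral>\<^sup>+x. ennreal (cmod (f' x) powr p) \<partial>lebesgue)"
    using assms by (intro nn_integral_cong_AE) auto
  then show ?thesis by (simp add: Lp_norm_def)
qed

lemma Q_norm_cong_AE:
  fixes f :: "real^'n \<Rightarrow> complex"
  assumes ae: "AE x in lebesgue. f x = f' x"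
  shows "Q_norm \<alpha> f = Q_norm \<alpha> f'"
proof -
  have "(\<integral>\<^sup>+x\<in>I. (\<integral>\<^sup>+y\<in>I. ennreal ((cmod (f x - f y))\<^sup>2 / w x y) \<partial>lebesgue) \<partial>lebesgue)
      = (\<integral>\<^sup>+x\<in>I. (\<integral>\<^sup>+y\<in>I. ennreal ((cmod (f' x - f' y))\<^sup>2 / w x y) \<partial>lebesgue) \<partial>lebesgue)" for I w
  proof (rule nn_integral_cong_AE)
    show "AE x in lebesgue. (\<integral>\<^sup>+y\<in>I. ennreal ((cmod (f x - f y))\<^sup>2 / w x y) \<partial>lebesgue) * indicator I x
        = (\<integral>\<^sup>+y\<in>I. ennreal ((cmod (f' x - f' y))\<^sup>2 / w x y) \<partial>lebesgue) * indicator I x"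
      using ae
    proof eventually_elim
      case (elim x)
      have "(\<integral>\<^sup>+y\<in>I. ennreal ((cmod (f x - f y))\<^sup>2 / w x y) \<partial>lebesgue)
          = (\<integral>\<^sup>+y\<in>I. ennreal ((cmod (f' x - f' y))\<^sup>2 / w x y) \<partial>lebesgue)"
        using ae elim by (intro nn_integral_cong_AE) auto
      then show ?case by simp
    qed
  qed
  then show ?thesis unfolding Q_norm_def by simp
qed

lemma fourier_distr_cong_AE:
  fixes f :: "real^'n \<Rightarrow> complex"
  assumes f: "f \<in> borel_measurable lebesgue" and f': "f' \<in> borel_measurable borel"
    and ae: "AE x in lebesgue. f x = f' x" and h: "h \<in> borel_measurable borel"
  shows "fourier_distr f h = fourier_distr f' h"
proof -
  note [measurable] = f
  have [measurable]: "fourier h \<in> borel_measurable lebesgue" "f' \<in> borel_measurable lebesgue"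
    using measurable_completion[of _ lborel borel] fourier_measurable[OF h] f' by simp_all
  show ?thesis
    unfolding fourier_distr_def using ae by (intro integral_cong_AE) auto
qed

lemma is_frac_laplacian_cong_AE:
  fixes f g :: "real^'n \<Rightarrow> complex"
  assumes "f \<in> borel_measurable lebesgue" "f' \<in> borel_measurable borel" "AE x in lebesgue. f x = f' x"
    and "g \<in> borel_measurable lebesgue" "g' \<in> borel_measurable borel" "AE x in lebesgue. g x = g' x"
    and lap: "is_frac_laplacian s f g"
  shows "is_frac_laplacian s f' g'"
  unfolding is_frac_laplacian_def
proof (intro allI impI)
  fix \<psi> :: "real^'n \<Rightarrow> complex"
  assume \<psi>: "schwartz \<psi>"
  note [measurable] = schwartz_measurable[OF \<psi>]
  have "(\<lambda>\<xi>. of_real (norm \<xi> powr s) * \<psi> \<xi>) \<in> borel_measurable borel" by measurable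
  then show "fourier_distr g' \<psi> = fourier_distr f' (\<lambda>\<xi>. of_real (norm \<xi> powr s) * \<psi> \<xi>)"
    using lap \<psi> fourier_distr_cong_AE[OF assms(1-3)] fourier_distr_cong_AE[OF assms(4-6) schwartz_measurable[OF \<psi>]]
    unfolding is_frac_laplacian_def by metis
qed

theorem proposition1p6:
  fixes p q s :: real
  assumes "CARD('n::finite) \<ge> 2"
    and "1 < q"
    and "real CARD('n) / q < s"
    and "1 \<le> p"
  shows "\<exists>C::real. C > 0 \<and>
    (\<forall>\<alpha><1. \<forall>(f :: real^'n \<Rightarrow> complex) g.
      f \<in> Lp_space p \<inter> Q_space \<alpha> \<longrightarrow>
      is_frac_laplacian s f g \<longrightarrow>
      g \<in> Lp_space q \<longrightarrow>
      Linf_norm f \<le>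
        ennreal (C * (1 + (enn2real (Lp_norm p f) + enn2real (Q_norm \<alpha> f)) *
                         ln (exp 1 + enn2real (Lp_norm q g)))))"
proof -
  obtain D where D: "D \<ge> 0"
    and bound: "\<And>\<alpha> (f :: real^'n \<Rightarrow> complex) g \<Lambda>\<^sub>1 \<Lambda>\<^sub>2 \<Lambda>\<^sub>3. \<lbrakk>\<alpha> < 1; f \<in> borel_measurable borel; g \<in> borel_measurable borel;
      is_frac_laplacian s f g; 0 < \<Lambda>\<^sub>1; 0 < \<Lambda>\<^sub>2; 0 < \<Lambda>\<^sub>3;
      Lp_norm p f \<le> ennreal \<Lambda>\<^sub>1; Q_norm \<alpha> f \<le> ennreal \<Lambda>\<^sub>2; Lp_norm q g \<le> ennreal \<Lambda>\<^sub>3\<rbrakk>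
      \<Longrightarrow> AE x in lborel. cmod (f x) \<le> D * (1 + (\<Lambda>\<^sub>1 + \<Lambda>\<^sub>2) * ln (exp 1 + \<Lambda>\<^sub>3))"
    using AE_bound_borel[OF assms] by metis
  \<comment> \<open>The 5 is the original 1 plus the 4 produced by enlarging the norms; the extra 1
    makes the constant positive even if \<open>D\<close> is 0.\<close>
  have main: "Linf_norm f \<le> ennreal ((5 * D + 1) * (1 + (enn2real (Lp_norm p f) + enn2real (Q_norm \<alpha> f)) *
                         ln (exp 1 + enn2real (Lp_norm q g))))"
    if \<alpha>: "\<alpha> < 1" and f: "f \<in> Lp_space p \<inter> Q_space \<alpha>" and lap: "is_frac_laplacian s f g" and g: "g \<in> Lp_space q"
    for \<alpha> and f g :: "real^'n \<Rightarrow> complex"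
  proof -
    have fm: "f \<in> borel_measurable lebesgue" and gm: "g \<in> borel_measurable lebesgue"
      using f g by (auto simp: Lp_space_def)
    obtain f' where f': "f' \<in> borel_measurable borel" "AE x in lebesgue. f x = f' x"
      using lebesgue_AE_eq_borel[OF fm] by blast
    obtain g' where g': "g' \<in> borel_measurable borel" "AE x in lebesgue. g x = g' x"
      using lebesgue_AE_eq_borel[OF gm] by blast
    define N1 where "N1 = enn2real (Lp_norm p f)"
    define N2 where "N2 = enn2real (Q_norm \<alpha> f)"
    define N3 where "N3 = enn2real (Lp_norm q g)"
    have N: "Lp_norm p f' = ennreal N1" "Q_norm \<alpha> f' = ennreal N2" "Lp_norm q g' = ennreal N3"
      using f g Lp_norm_cong_AE[OF f'(2), of p] Q_norm_cong_AE[OF f'(2), of \<alpha>] Lp_norm_cong_AE[OF g'(2), of q]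
      by (auto simp: Lp_space_def Q_space_def N1_def N2_def N3_def)
    have N_nonneg: "0 \<le> N1" "0 \<le> N2" "0 \<le> N3" by (simp_all add: N1_def N2_def N3_def)
    define L where "L = ln (exp 1 + N3)"
    have L: "L \<ge> 1" using N_nonneg(3) ln_mono[of "exp 1" "exp 1 + N3"] by (simp add: L_def)
    \<comment> \<open>The norms may be 0, so they are enlarged. Adding 1/L to the first two
      contributes only a constant after multiplication by a logarithm of size at most 2L.\<close>
    have "AE x in lborel. cmod (f' x) \<le> D * (1 + ((N1 + 1 / L) + (N2 + 1 / L)) * ln (exp 1 + (N3 + 1)))"
    proof (rule bound[OF \<alpha> f'(1) g'(1) is_frac_laplacian_cong_AE[OF fm f' gm g' lap]])
      show "0 < N1 + 1 / L" "0 < N2 + 1 / L" "0 < N3 + 1" using L N_nonneg by (auto intro!: add_nonneg_pos)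
      show "Lp_norm p f' \<le> ennreal (N1 + 1 / L)" "Q_norm \<alpha> f' \<le> ennreal (N2 + 1 / L)" "Lp_norm q g' \<le> ennreal (N3 + 1)"
        unfolding N using L by (auto intro!: ennreal_leI)
    qed
    moreover have "D * (1 + ((N1 + 1 / L) + (N2 + 1 / L)) * ln (exp 1 + (N3 + 1))) \<le> (5 * D + 1) * (1 + (N1 + N2) * L)"
    proof -
      \<comment> \<open>As e + \<open>N3\<close> >= 2, the enlarged argument is at most the square
        of the old one, so the logarithm at most doubles.\<close>
      have "exp 1 + (N3 + 1) \<le> (exp 1 + N3)\<^sup>2"
      proof -
        have "exp 1 + N3 \<ge> 2" using exp_ge_add_one_self[of "1 :: real"] N_nonneg by linarith
        then have "exp 1 + (N3 + 1) \<le> 2 * (exp 1 + N3)" by simp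
        also have "\<dots> \<le> (exp 1 + N3)\<^sup>2"
          unfolding power2_eq_square using \<open>exp 1 + N3 \<ge> 2\<close> by (intro mult_right_mono) auto
        finally show ?thesis .
      qed
      moreover have "0 < exp 1 + N3" using N_nonneg by (intro add_pos_nonneg) auto
      ultimately have "ln (exp 1 + (N3 + 1)) \<le> ln ((exp 1 + N3)\<^sup>2)"
        using N_nonneg by (intro ln_mono) (auto intro!: add_pos_nonneg)
      also have "\<dots> = 2 * L" using \<open>0 < exp 1 + N3\<close> by (simp add: L_def ln_realpow)
      finally have "((N1 + 1 / L) + (N2 + 1 / L)) * ln (exp 1 + (N3 + 1)) \<le> ((N1 + 1 / L) + (N2 + 1 / L)) * (2 * L)"
        using N_nonneg L by (intro mult_left_mono) auto
      also have "\<dots> = 2 * ((N1 + N2) * L) + 4" using L by (simp add: field_simps)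
      finally have "D * (1 + ((N1 + 1 / L) + (N2 + 1 / L)) * ln (exp 1 + (N3 + 1))) \<le> D * (5 + 5 * ((N1 + N2) * L))"
        using D N_nonneg L by (intro mult_left_mono) (auto intro: order_trans)
      also have "\<dots> \<le> (5 * D + 1) * (1 + (N1 + N2) * L)"
        using N_nonneg L by (simp add: algebra_simps)
      finally show ?thesis .
    qed
    ultimately have "AE x in lborel. cmod (f' x) \<le> (5 * D + 1) * (1 + (N1 + N2) * L)"
      by (auto elim!: eventually_mono)
    then have "AE x in lebesgue. cmod (f' x) \<le> (5 * D + 1) * (1 + (N1 + N2) * L)" by (rule AE_completion)
    then have "AE x in lebesgue. ennreal (cmod (f x)) \<le> ennreal ((5 * D + 1) * (1 + (N1 + N2) * L))"
      using f'(2) by eventually_elim (simp add: ennreal_leI)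
    moreover have "(\<lambda>x. ennreal (cmod (f x))) \<in> borel_measurable lebesgue" using fm by measurable
    ultimately show ?thesis
      unfolding Linf_norm_def N1_def[symmetric] N2_def[symmetric] N3_def[symmetric] L_def[symmetric]
      by (intro esssup_I)
  qed
  show ?thesis
    by (rule exI[of _ "5 * D + 1"]) (use D main in auto)
qed

end
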